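(* Let $(N,\langle\,,\rangle)$ be a simply connected 2-step nilpotent Lie group with a left-invariant metric, with Lie algebra $\mathfrak n$ such that $\dim(\mathfrak z/C(\mathfrak n))\le1$, where $\mathfrak z$ is the center and $C(\mathfrak n)=[\mathfrak n,\mathfrak n]$. Let $F$ be a left-invariant Lorentz force on $N$ with magnetic trajectory $\sigma(t)=\exp(V(t)+Z(t))$ through the identity element at $t=0$, where $V(t)\in\mathfrak v=\mathfrak z^\perp$ and $Z(t)\in\mathfrak z$. Denote by $\lambda=\exp(W_1+Z_1)$ an element of $N$, with $W_1\in\mathfrak v$, $Z_1\in\mathfrak z$. (i) If $\sigma$ is $\lambda$-periodic of period $\omega$, then $W_1\in\ker F_{\mathfrak z}$ and $V'$ is periodic of period $\omega$. (ii) Conversely, assume that $V'$ is periodic of period $\omega$ and that $W_1:=V(\omega)$ belongs to the kernel of $F_{\mathfrak z}$. Then the magnetic curve $\sigma$ is $\lambda$-periodic for $\lambda=\exp(W_1+Z_1)$, where $Z_1:=Z(\omega)$.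
   Context: A left-invariant Lorentz force is a left-invariant skew-symmetric $(1,1)$-tensor $F$ on $N$ (equivalently a skew-symmetric linear map of $\mathfrak n$) such that the 2-form $\langle F\cdot,\cdot\rangle$ is closed. A magnetic trajectory for $F$ is a curve $\gamma:\mathbb{R}\to N$ with $\nabla_{\gamma'}\gamma'=qF\gamma'$, where $q$ is a fixed real constant (the charge) and $\nabla$ is the Levi-Civita connection. $\mathfrak n=\mathfrak v\oplus\mathfrak z$ is the orthogonal decomposition, and $F_{\mathfrak z}=p_{\mathfrak z}\circ F$, where $p_{\mathfrak z}:\mathfrak n\to\mathfrak z$ is the orthogonal projection. For $\lambda\in N$ different from the identity, a curve $\sigma$ is $\lambda$-periodic with period $\omega\ne0$ if $\lambda\sigma(t)=\sigma(t+\omega)$ for all $t\in\mathbb{R}$.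
   Formalization: Part (i) is stated for nonzero charge q (it fails for geodesics, q = 0); in part (ii) λσ(t)=σ(t+ω) is always concluded, and σ is called λ-periodic only when λ=exp(V(ω)+Z(ω)) is not the identity. *)

theory Defs
  imports "HOL-Analysis.Analysis" "HOL-Algebra.Group"
begin

section \<open>Smooth maps and manifolds\<close>

text \<open>\<open>C\<^sup>k\<close> and smooth maps between normed spaces, meant for \<^emph>\<open>open\<close> sets \<open>S\<close>.\<close>

fun Ck_on :: "nat \<Rightarrow> 'a::real_normed_vector set \<Rightarrow> ('a \<Rightarrow> 'b::real_normed_vector) \<Rightarrow> bool" where
  "Ck_on 0 S f \<longleftrightarrow> continuous_on S f"
| "Ck_on (Suc k) S f \<longleftrightarrow> (\<forall>x\<in>S. f differentiable (at x)) \<and>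
     (\<forall>v. Ck_on k S (\<lambda>x. frechet_derivative f (at x) v))"

definition smooth_on :: "'a::real_normed_vector set \<Rightarrow> ('a \<Rightarrow> 'b::real_normed_vector) \<Rightarrow> bool" where
  "smooth_on S f \<longleftrightarrow> (\<forall>k. Ck_on k S f)"

text \<open>A chart \<open>(U, \<phi>)\<close> consists of a domain \<open>U\<close> and a coordinate map \<open>\<phi>\<close>, whose values outside
  \<open>U\<close> are irrelevant.\<close>

type_synonym ('g, 'a) chart = "'g set \<times> ('g \<Rightarrow> 'a)"

definition chart_inv :: "('g, 'a) chart \<Rightarrow> 'a \<Rightarrow> 'g" where
  "chart_inv c = inv_into (fst c) (snd c)"

definition is_chart :: "('g::topological_space, 'a::euclidean_space) chart \<Rightarrow> bool" where
  "is_chart c \<longleftrightarrow> open (fst c) \<and> open (snd c ` fst c) \<and>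
     homeomorphism (fst c) (snd c ` fst c) (snd c) (chart_inv c)"

definition smooth_atlas :: "('g::topological_space, 'a::euclidean_space) chart set \<Rightarrow> bool" where
  "smooth_atlas A \<longleftrightarrow> (\<forall>c\<in>A. is_chart c) \<and> (\<Union>c\<in>A. fst c) = UNIV \<and>
     (\<forall>c\<in>A. \<forall>d\<in>A. smooth_on (snd c ` (fst c \<inter> fst d)) (snd d \<circ> chart_inv c))"

definition smooth_map :: "('g::topological_space, 'a::euclidean_space) chart set \<Rightarrow>
    ('h::topological_space, 'b::euclidean_space) chart set \<Rightarrow> ('g \<Rightarrow> 'h) \<Rightarrow> bool" where
  "smooth_map A B f \<longleftrightarrow> continuous_on UNIV f \<and>
     (\<forall>c\<in>A. \<forall>d\<in>B. smooth_on (snd c ` (fst c \<inter> f -` fst d)) (snd d \<circ> f \<circ> chart_inv c))"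

definition prod_atlas :: "('g, 'a) chart set \<Rightarrow> ('h, 'b) chart set \<Rightarrow> ('g \<times> 'h, 'a \<times> 'b) chart set" where
  "prod_atlas A B = {(fst c \<times> fst d, map_prod (snd c) (snd d)) |c d. c \<in> A \<and> d \<in> B}"

definition real_atlas :: "(real, real) chart set" where
  "real_atlas = {(UNIV, id)}"

section \<open>Lie groups with a left-invariant metric\<close>

text \<open>A group with an atlas and a distinguished chart \<open>base\<close> around the identity element. The
  differential of \<open>base\<close> identifies the tangent space at the identity, i.e. the Lie algebra, with
  the Euclidean space \<^typ>\<open>'a\<close>. A left-invariant metric is an inner product on the Lie algebra; the
  distinguished chart is taken to be one for which this inner product is the one of \<^typ>\<open>'a\<close>. Every
  left-invariant metric arises in this way, by composing a chart with a linear isomorphism.\<close>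

record ('g, 'a) lie_structure = "'g monoid" +
  atlas :: "('g, 'a) chart set"
  base :: "('g, 'a) chart"

definition lie_group ::
    "('g::{t2_space, second_countable_topology}, 'a::euclidean_space) lie_structure \<Rightarrow> bool" where
  "lie_group N \<longleftrightarrow> group N \<and> carrier N = UNIV \<and> smooth_atlas (atlas N) \<and>
     smooth_map (prod_atlas (atlas N) (atlas N)) (atlas N) (\<lambda>(x, y). x \<otimes>\<^bsub>N\<^esub> y) \<and>
     smooth_map (atlas N) (atlas N) (\<lambda>x. inv\<^bsub>N\<^esub> x) \<and>
     base N \<in> atlas N \<and> \<one>\<^bsub>N\<^esub> \<in> fst (base N)"

text \<open>Tangent vectors at \<open>p\<close> are represented by their components in a chart \<open>c\<close> around \<open>p\<close>.
  \<open>to_lie\<close> is the differential at \<open>p\<close> of the left translation by the inverse of \<open>p\<close>, and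
  \<open>from_lie\<close> is the differential at the identity of the left translation by \<open>p\<close>; thus
  \<open>p \<mapsto> from_lie N c p X\<close> is the left-invariant vector field determined by \<open>X\<close>.\<close>

definition to_lie :: "('g, 'a::euclidean_space) lie_structure \<Rightarrow> ('g, 'a) chart \<Rightarrow> 'g \<Rightarrow> 'a \<Rightarrow> 'a" where
  "to_lie N c p u =
     frechet_derivative (\<lambda>y. snd (base N) (inv\<^bsub>N\<^esub> p \<otimes>\<^bsub>N\<^esub> chart_inv c y)) (at (snd c p)) u"

definition from_lie :: "('g, 'a::euclidean_space) lie_structure \<Rightarrow> ('g, 'a) chart \<Rightarrow> 'g \<Rightarrow> 'a \<Rightarrow> 'a" where
  "from_lie N c p X =
     frechet_derivative (\<lambda>y. snd c (p \<otimes>\<^bsub>N\<^esub> chart_inv (base N) y)) (at (snd (base N) \<one>\<^bsub>N\<^esub>)) X"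

text \<open>The bracket of the Lie algebra is the value at the identity of the Lie bracket of
  left-invariant vector fields; in coordinates \<open>[X, Y] = DY(X) - DX(Y)\<close>.\<close>

definition lie_bracket :: "('g, 'a::euclidean_space) lie_structure \<Rightarrow> 'a \<Rightarrow> 'a \<Rightarrow> 'a" where
  "lie_bracket N X Y =
     (let b = base N; e = snd b \<one>\<^bsub>N\<^esub>
      in frechet_derivative (\<lambda>y. from_lie N b (chart_inv b y) Y) (at e) X
       - frechet_derivative (\<lambda>y. from_lie N b (chart_inv b y) X) (at e) Y)"

definition one_param_subgroup ::
    "('g::topological_space, 'a::euclidean_space) lie_structure \<Rightarrow> (real \<Rightarrow> 'g) \<Rightarrow> bool" where
  "one_param_subgroup N \<gamma> \<longleftrightarrow> smooth_map real_atlas (atlas N) \<gamma> \<and>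
     (\<forall>s t. \<gamma> (s + t) = \<gamma> s \<otimes>\<^bsub>N\<^esub> \<gamma> t)"

definition lie_exp :: "('g::topological_space, 'a::euclidean_space) lie_structure \<Rightarrow> 'a \<Rightarrow> 'g" where
  "lie_exp N X = (THE \<gamma>. one_param_subgroup N \<gamma> \<and>
     ((snd (base N) \<circ> \<gamma>) has_vector_derivative X) (at 0)) 1"

definition lie_center :: "('g, 'a::euclidean_space) lie_structure \<Rightarrow> 'a set" where
  "lie_center N = {Z. \<forall>X. lie_bracket N Z X = 0}"

definition lie_commutator :: "('g, 'a::euclidean_space) lie_structure \<Rightarrow> 'a set" where
  "lie_commutator N = span {lie_bracket N X Y |X Y. True}"

definition two_step_nilpotent :: "('g, 'a::euclidean_space) lie_structure \<Rightarrow> bool" where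
  "two_step_nilpotent N \<longleftrightarrow> (\<forall>X Y Z. lie_bracket N (lie_bracket N X Y) Z = 0)"

section \<open>Levi-Civita connection and magnetic trajectories\<close>

text \<open>For a Riemannian metric given in coordinates by \<open>g x u v\<close>, the Levi-Civita connection is
  \<open>\<nabla>\<^sub>u v = D\<^sub>u v + \<Gamma>(u, v)\<close>, where
  \<open>2 g(\<Gamma>(u, v), w) = D\<^sub>u g(v, w) + D\<^sub>v g(u, w) - D\<^sub>w g(u, v)\<close> for constant \<open>u\<close>, \<open>v\<close>, \<open>w\<close>.\<close>

definition christoffel :: "('a::euclidean_space \<Rightarrow> 'a \<Rightarrow> 'a \<Rightarrow> real) \<Rightarrow> 'a \<Rightarrow> 'a \<Rightarrow> 'a \<Rightarrow> 'a" where
  "christoffel g x u v = (THE a. \<forall>w. 2 * g x a w =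
       frechet_derivative (\<lambda>y. g y v w) (at x) u
     + frechet_derivative (\<lambda>y. g y u w) (at x) v
     - frechet_derivative (\<lambda>y. g y u v) (at x) w)"

definition covariant_acceleration ::
    "('a::euclidean_space \<Rightarrow> 'a \<Rightarrow> 'a \<Rightarrow> real) \<Rightarrow> (real \<Rightarrow> 'a) \<Rightarrow> real \<Rightarrow> 'a" where
  "covariant_acceleration g \<gamma> t =
     vector_derivative (\<lambda>s. vector_derivative \<gamma> (at s)) (at t)
     + christoffel g (\<gamma> t) (vector_derivative \<gamma> (at t)) (vector_derivative \<gamma> (at t))"

definition metric :: "('g, 'a::euclidean_space) lie_structure \<Rightarrow> ('g, 'a) chart \<Rightarrow> 'a \<Rightarrow> 'a \<Rightarrow> 'a \<Rightarrow> real" where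
  "metric N c y u v = to_lie N c (chart_inv c y) u \<bullet> to_lie N c (chart_inv c y) v"

text \<open>The left-invariant (1,1)-tensor determined by an endomorphism \<open>F\<close> of the Lie algebra, at the
  point \<open>p\<close> in the chart \<open>c\<close>.\<close>

definition left_inv_tensor ::
    "('g, 'a::euclidean_space) lie_structure \<Rightarrow> ('a \<Rightarrow> 'a) \<Rightarrow> ('g, 'a) chart \<Rightarrow> 'g \<Rightarrow> 'a \<Rightarrow> 'a" where
  "left_inv_tensor N F c p u = from_lie N c p (F (to_lie N c p u))"

definition closed_two_form_on :: "'a::euclidean_space set \<Rightarrow> ('a \<Rightarrow> 'a \<Rightarrow> 'a \<Rightarrow> real) \<Rightarrow> bool" where
  "closed_two_form_on S \<omega> \<longleftrightarrow> (\<forall>x\<in>S. \<forall>u v w.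
       frechet_derivative (\<lambda>y. \<omega> y v w) (at x) u
     - frechet_derivative (\<lambda>y. \<omega> y u w) (at x) v
     + frechet_derivative (\<lambda>y. \<omega> y u v) (at x) w = 0)"

definition lorentz_force :: "('g, 'a::euclidean_space) lie_structure \<Rightarrow> ('a \<Rightarrow> 'a) \<Rightarrow> bool" where
  "lorentz_force N F \<longleftrightarrow> linear F \<and> (\<forall>X Y. F X \<bullet> Y = - (X \<bullet> F Y)) \<and>
     (\<forall>c\<in>atlas N. closed_two_form_on (snd c ` fst c)
        (\<lambda>y u v. metric N c y (left_inv_tensor N F c (chart_inv c y) u) v))"

definition magnetic_trajectory :: "('g::topological_space, 'a::euclidean_space) lie_structure \<Rightarrow>
    ('a \<Rightarrow> 'a) \<Rightarrow> real \<Rightarrow> (real \<Rightarrow> 'g) \<Rightarrow> bool" where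
  "magnetic_trajectory N F q \<gamma> \<longleftrightarrow> smooth_map real_atlas (atlas N) \<gamma> \<and>
     (\<forall>t. \<forall>c\<in>atlas N. \<gamma> t \<in> fst c \<longrightarrow>
        covariant_acceleration (metric N c) (snd c \<circ> \<gamma>) t =
        q *\<^sub>R left_inv_tensor N F c (\<gamma> t) (vector_derivative (snd c \<circ> \<gamma>) (at t)))"

section \<open>Orthogonal projection and periodicity\<close>

definition orth_proj :: "'a::euclidean_space set \<Rightarrow> 'a \<Rightarrow> 'a" where
  "orth_proj S X = (THE Y. Y \<in> S \<and> X - Y \<in> orthogonal_comp S)"

definition F_center :: "('g, 'a::euclidean_space) lie_structure \<Rightarrow> ('a \<Rightarrow> 'a) \<Rightarrow> 'a \<Rightarrow> 'a" where
  "F_center N F = orth_proj (lie_center N) \<circ> F"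

definition periodic_of_period :: "(real \<Rightarrow> 'a) \<Rightarrow> real \<Rightarrow> bool" where
  "periodic_of_period f \<omega> \<longleftrightarrow> \<omega> \<noteq> 0 \<and> (\<forall>t. f (t + \<omega>) = f t)"

definition translation_periodic ::
    "('g, 'm) monoid_scheme \<Rightarrow> 'g \<Rightarrow> (real \<Rightarrow> 'g) \<Rightarrow> real \<Rightarrow> bool" where
  "translation_periodic N l \<sigma> \<omega> \<longleftrightarrow> l \<noteq> \<one>\<^bsub>N\<^esub> \<and> \<omega> \<noteq> 0 \<and> (\<forall>t. l \<otimes>\<^bsub>N\<^esub> \<sigma> t = \<sigma> (t + \<omega>))"

end

theory Submission
  imports Defs
begin

text \<open>The exponential map is obtained by inverting a logarithm. For a 2-step nilpotent Lie algebra
  the Maurer--Cartan form \<open>\<theta>\<close> is closed modulo the center, and two applications of the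
  Poincare lemma give a local solution \<open>f\<close> of \<open>f' = \<theta> + [f, \<theta>] / 2\<close>: a local isomorphism
  onto the Lie algebra with the product \<open>X \<star> Y = X + Y + [X, Y] / 2\<close>. Its local inverse extends by
  doubling to a homomorphism on the whole Lie algebra, which is bijective because \<open>N\<close> is simply
  connected, and this homomorphism is the exponential map. Hence, if \<open>\<xi>\<close> is the left-trivialized
  velocity of \<open>\<sigma>\<close>, then \<open>c = V + Z\<close> satisfies \<open>c' = \<xi> + [c, \<xi>] / 2\<close>; in particular \<open>V'\<close> is
  the component of \<open>\<xi>\<close> orthogonal to the center.

  The central component of the Euler--Arnold equation is \<open>\<xi>\<^sub>z' = q F\<^sub>z \<xi>\<close>. Closedness of
  \<open>\<langle>F\<cdot>, \<cdot>\<rangle>\<close> makes \<open>F\<close> send the commutator to the orthogonal complement of the center,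
  and by the dimension hypothesis and skew-symmetry it sends the whole center there. Therefore
  \<open>\<xi>\<^sub>z - q F\<^sub>z V\<close> is constant. If \<open>\<sigma>\<close> is \<open>\<lambda>\<close>-periodic, then \<open>V(t + \<omega>) = V(t) + W\<^sub>1\<close> and
  \<open>\<xi>\<close> is periodic, so \<open>F\<^sub>z W\<^sub>1 = 0\<close>. Conversely, the two conditions make \<open>\<xi>\<close> periodic, so that
  \<open>\<lambda>\<sigma>(t)\<close> and \<open>\<sigma>(t + \<omega>)\<close> have the same velocity and the same value at \<open>0\<close>.\<close>

section \<open>Calculus of smooth maps\<close>

text \<open>The definite description in \<open>lie_exp\<close> calls for existence and uniqueness of
  one-parameter subgroups. The classical route integrates left-invariant fields, proves their
  completeness and then needs the derivative of the exponential map. Starting from a logarithm turns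
  all of this into one total differential equation, linear in \<open>f\<close>. As a bracket ignores
  central summands, the equation is triangular: the part of \<open>f\<close> outside the center is
  the primitive of a form that is closed because brackets are central, and the rest is the primitive
  of a form involving only that first part. The same equation yields the derivative of
  \<open>V\<close> along a trajectory, since its bracket term is central. Injectivity of the
  extended homomorphism is a statement about its kernel, so covering theory shrinks to lifting one
  homotopy from a square. Of the equation of motion only the central component is used, where the
  coadjoint term disappears; the other component of the velocity enters through
  \<open>V'\<close>.\<close>

lemma Ck_on_cong:
  assumes "open S" "\<And>x. x \<in> S \<Longrightarrow> f x = g x" "Ck_on k S f"
  shows "Ck_on k S g"
  using assms(2,3)
proof (induction k arbitrary: f g)
  case 0
  then show ?case using continuous_on_cong by force
next
  case (Suc k)
  have fd: "frechet_derivative f (at x) = frechet_derivative g (at x)" if "x \<in> S" for x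
    using Suc.prems that \<open>open S\<close> by (intro frechet_derivative_transform_within_open) auto
  have "g differentiable (at x)" if "x \<in> S" for x
    using Suc.prems that \<open>open S\<close> unfolding differentiable_def
    by (metis (no_types, lifting) Ck_on.simps(2) differentiable_def has_derivative_transform_within_open)
  moreover have "Ck_on k S (\<lambda>x. frechet_derivative g (at x) v)" for v
    using Suc.IH[of "\<lambda>x. frechet_derivative f (at x) v" "\<lambda>x. frechet_derivative g (at x) v"] fd Suc.prems
    by auto
  ultimately show ?case by simp
qed

text \<open>Any explicit pointwise derivative may replace \<open>frechet_derivative\<close>, so
  product and chain rules can be used in their usual form.\<close>

lemma Ck_on_SucI:
  assumes "open S" "\<And>x. x \<in> S \<Longrightarrow> (f has_derivative f' x) (at x)"
    and "\<And>v. Ck_on k S (\<lambda>x. f' x v)"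
  shows "Ck_on (Suc k) S f"
proof -
  have "Ck_on k S (\<lambda>x. frechet_derivative f (at x) v)" for v
    using frechet_derivative_at[OF assms(2)] by (intro Ck_on_cong[OF \<open>open S\<close> _ assms(3)[of v]]) simp
  then show ?thesis using assms(2) by (auto simp: differentiable_def)
qed

lemma Ck_on_SucD: "Ck_on (Suc k) S f \<Longrightarrow> Ck_on k S f"
proof (induction k arbitrary: f)
  case 0
  then show ?case
    by (auto intro!: differentiable_imp_continuous_on simp: differentiable_on_def
        differentiable_at_withinI)
next
  case (Suc k)
  then show ?case by (metis Ck_on.simps(2))
qed

lemma Ck_on_const: "Ck_on k S (\<lambda>x. c)"
  by (induction k arbitrary: c) auto

lemma Ck_on_add:
  assumes "open S" "Ck_on k S f" "Ck_on k S g"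
  shows "Ck_on k S (\<lambda>x. f x + g x)"
  using assms(2,3)
proof (induction k arbitrary: f g)
  case 0
  then show ?case by (auto intro: continuous_intros)
next
  case (Suc k)
  let ?d = "\<lambda>x h. frechet_derivative f (at x) h + frechet_derivative g (at x) h"
  have der: "((\<lambda>x. f x + g x) has_derivative ?d x) (at x)" if "x \<in> S" for x
    using Suc.prems that by (intro has_derivative_add) (auto simp: frechet_derivative_works[symmetric])
  have "Ck_on k S (\<lambda>x. ?d x v)" for v
    by (intro Suc.IH) (use Suc.prems in auto)
  then show ?case using Ck_on_SucI[OF _ der] assms by blast
qed

text \<open>Both summands of the product rule have the original shape with one factor
  differentiated, so the induction generalizes over \<open>f\<close> and \<open>g\<close>;
  \<open>Ck_on_SucD\<close> lowers the order of the other factor.\<close>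

lemma Ck_on_bilinear:
  assumes "bounded_bilinear p" "open S" "Ck_on k S f" "Ck_on k S g"
  shows "Ck_on k S (\<lambda>x. p (f x) (g x))"
  using assms(3,4)
proof (induction k arbitrary: f g)
  case 0
  then show ?case using bounded_bilinear.continuous_on[OF assms(1)] by auto
next
  case (Suc k)
  let ?d = "\<lambda>x h. p (f x) (frechet_derivative g (at x) h) + p (frechet_derivative f (at x) h) (g x)"
  have der: "((\<lambda>x. p (f x) (g x)) has_derivative ?d x) (at x)" if "x \<in> S" for x
    using Suc.prems that
    by (intro bounded_bilinear.FDERIV[OF assms(1)]) (auto simp: frechet_derivative_works[symmetric])
  have "Ck_on k S (\<lambda>x. ?d x v)" for v
    by (intro Ck_on_add[OF \<open>open S\<close>] Suc.IH) (use Suc.prems Ck_on_SucD in auto)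
  then show ?case using Ck_on_SucI[OF _ der] assms by blast
qed

text \<open>The inner derivative is the constant map \<open>A\<close>, so a derivative in direction
  \<open>v\<close> is again a function of \<open>A x + c\<close>. Left translations and
  left-invariant fields arise from the multiplication by such affine slices.\<close>

lemma Ck_on_affine:
  assumes "open S" "bounded_linear A" "\<And>x. x \<in> S \<Longrightarrow> A x + c \<in> T" "Ck_on k T f"
  shows "Ck_on k S (\<lambda>x. f (A x + c))"
  using assms(4)
proof (induction k arbitrary: f)
  case 0
  then show ?case
    using assms(3) by (auto intro!: continuous_on_compose2[of T f] continuous_intros
        bounded_linear.continuous_on[OF assms(2)])
next
  case (Suc k)
  have der: "((\<lambda>x. f (A x + c)) has_derivative (\<lambda>v. frechet_derivative f (at (A x + c)) (A v))) (at x)"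
    if "x \<in> S" for x
  proof -
    have "((\<lambda>x. A x + c) has_derivative A) (at x)"
      using assms(2) by (auto intro!: derivative_eq_intros bounded_linear_imp_has_derivative)
    moreover have "(f has_derivative frechet_derivative f (at (A x + c))) (at (A x + c))"
      using Suc.prems assms(3) that by (auto simp: frechet_derivative_works[symmetric])
    ultimately show ?thesis
      using diff_chain_at[of "\<lambda>x. A x + c"] by (simp add: o_def)
  qed
  have "Ck_on k S (\<lambda>x. frechet_derivative f (at (A x + c)) (A v))" for v
    using Suc by (intro Suc.IH) auto
  then show ?case using Ck_on_SucI[OF _ der] assms by blast
qed

lemma smooth_on_cong:
  "open S \<Longrightarrow> (\<And>x. x \<in> S \<Longrightarrow> f x = g x) \<Longrightarrow> smooth_on S f \<Longrightarrow> smooth_on S g"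
  unfolding smooth_on_def using Ck_on_cong by blast

lemma smooth_on_frechet_derivative:
  "smooth_on S f \<Longrightarrow> smooth_on S (\<lambda>x. frechet_derivative f (at x) v)"
  unfolding smooth_on_def by (metis Ck_on.simps(2))

lemma smooth_on_imp_has_derivative:
  assumes "smooth_on S f" "x \<in> S"
  shows "(f has_derivative frechet_derivative f (at x)) (at x)"
proof -
  have "Ck_on (Suc 0) S f" using assms unfolding smooth_on_def by blast
  then show ?thesis using assms(2) by (auto simp: frechet_derivative_works[symmetric])
qed

lemma smooth_on_imp_continuous_on: "smooth_on S f \<Longrightarrow> continuous_on S f"
  unfolding smooth_on_def by (metis Ck_on.simps(1))

lemma smooth_on_const: "smooth_on S (\<lambda>x. c)"
  unfolding smooth_on_def by (simp add: Ck_on_const)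

lemma smooth_on_ident: "open S \<Longrightarrow> smooth_on S (\<lambda>x. x)"
proof -
  assume S: "open S"
  have "Ck_on k S (\<lambda>x. x)" for k
  proof (cases k)
    case (Suc n)
    show ?thesis unfolding Suc by (rule Ck_on_SucI[OF S has_derivative_ident]) (rule Ck_on_const)
  qed simp
  then show ?thesis by (simp add: smooth_on_def)
qed

lemma smooth_on_sum:
  assumes "open S" "\<And>i. i \<in> I \<Longrightarrow> smooth_on S (f i)"
  shows "smooth_on S (\<lambda>x. \<Sum>i\<in>I. f i x)"
  using assms(2)
  by (induction I rule: infinite_finite_induct)
    (auto simp: smooth_on_def intro: Ck_on_const Ck_on_add[OF \<open>open S\<close>])

lemma smooth_on_bilinear:
  "bounded_bilinear p \<Longrightarrow> open S \<Longrightarrow> smooth_on S f \<Longrightarrow> smooth_on S g \<Longrightarrow> smooth_on S (\<lambda>x. p (f x) (g x))"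
  unfolding smooth_on_def using Ck_on_bilinear by blast

lemma smooth_on_affine:
  "open S \<Longrightarrow> bounded_linear A \<Longrightarrow> (\<And>x. x \<in> S \<Longrightarrow> A x + c \<in> T) \<Longrightarrow> smooth_on T f \<Longrightarrow>
    smooth_on S (\<lambda>x. f (A x + c))"
  unfolding smooth_on_def using Ck_on_affine by blast

section \<open>Families of linear maps and integral curves\<close>

lemma linear_basis_expansion:
  fixes A :: "'a::euclidean_space \<Rightarrow> 'b::real_vector"
  assumes "linear A"
  shows "A w = (\<Sum>i\<in>Basis. (w \<bullet> i) *\<^sub>R A i)"
proof -
  have "A w = A (\<Sum>i\<in>Basis. (w \<bullet> i) *\<^sub>R i)" by (simp add: euclidean_representation)
  then show ?thesis by (simp add: linear_sum[OF assms] linear_cmul[OF assms])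
qed

lemma smooth_on_frechet_derivative_along:
  fixes h :: "'a::euclidean_space \<Rightarrow> 'b::real_normed_vector"
  assumes "open S" "smooth_on S h" "smooth_on S Y"
  shows "smooth_on S (\<lambda>x. frechet_derivative h (at x) (Y x))"
proof (rule smooth_on_cong[OF \<open>open S\<close>])
  show "smooth_on S (\<lambda>x. \<Sum>i\<in>Basis. (Y x \<bullet> i) *\<^sub>R frechet_derivative h (at x) i)"
    by (intro smooth_on_sum smooth_on_bilinear[OF bounded_bilinear_scaleR]
        smooth_on_bilinear[OF bounded_bilinear_inner] smooth_on_frechet_derivative
        smooth_on_const assms)
  fix x assume "x \<in> S"
  then have "linear (frechet_derivative h (at x))"
    using smooth_on_imp_has_derivative[OF assms(2)] has_derivative_linear by blast
  then show "(\<Sum>i\<in>Basis. (Y x \<bullet> i) *\<^sub>R frechet_derivative h (at x) i) = frechet_derivative h (at x) (Y x)"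
    by (rule linear_basis_expansion[symmetric])
qed

text \<open>Differentiating \<open>h\<close> along the curve gives the derivative of
  \<open>h\<close> in direction \<open>Y\<close>, a smooth function again, so the induction runs
  over \<open>h\<close>. Smoothness of \<open>\<gamma>\<close> itself is the case where
  \<open>h\<close> is the identity.\<close>

lemma smooth_on_integral_curve:
  fixes Y :: "'a::euclidean_space \<Rightarrow> 'a" and h :: "'a \<Rightarrow> 'b::real_normed_vector"
  assumes "open S" "open I" "smooth_on S Y" "smooth_on S h" "\<And>t. t \<in> I \<Longrightarrow> \<gamma> t \<in> S"
    and "\<And>t. t \<in> I \<Longrightarrow> (\<gamma> has_vector_derivative Y (\<gamma> t)) (at t)"
  shows "smooth_on I (\<lambda>t. h (\<gamma> t))"
proof -
  have "Ck_on k I (\<lambda>t. h (\<gamma> t))" for k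
    using assms(4)
  proof (induction k arbitrary: h)
    case 0
    have "continuous_on I \<gamma>"
      using assms(6) by (meson has_vector_derivative_continuous continuous_at_imp_continuous_on)
    then show ?case
      using assms(5) smooth_on_imp_continuous_on[OF 0] by (auto intro: continuous_on_compose2)
  next
    case (Suc k)
    let ?h = "\<lambda>x. frechet_derivative h (at x) (Y x)"
    have der: "((\<lambda>t. h (\<gamma> t)) has_derivative (\<lambda>s. s *\<^sub>R ?h (\<gamma> t))) (at t)" if "t \<in> I" for t
    proof -
      have *: "(h has_derivative frechet_derivative h (at (\<gamma> t))) (at (\<gamma> t))"
        using smooth_on_imp_has_derivative Suc.prems assms(5) that by blast
      have "((\<lambda>t. h (\<gamma> t)) has_derivative (\<lambda>s. frechet_derivative h (at (\<gamma> t)) (s *\<^sub>R Y (\<gamma> t)))) (at t)"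
        using diff_chain_at[OF assms(6)[OF that, unfolded has_vector_derivative_def] *] by (simp add: o_def)
      then show ?thesis
        by (simp add: linear_cmul[OF has_derivative_linear[OF *]])
    qed
    have "Ck_on k I (\<lambda>t. ?h (\<gamma> t))"
      by (rule Suc.IH) (rule smooth_on_frechet_derivative_along[OF assms(1) Suc.prems assms(3)])
    then have "Ck_on k I (\<lambda>t. s *\<^sub>R ?h (\<gamma> t))" for s
      by (intro Ck_on_bilinear[OF bounded_bilinear_scaleR] Ck_on_const assms)
    then show ?case using Ck_on_SucI[OF _ der] assms by blast
  qed
  then show ?thesis unfolding smooth_on_def by simp
qed

text \<open>The product rule for evaluation when differentiability is known only for each
  vector-valued function \<open>A y u\<close>; expanding \<open>w y\<close> in the basis avoids the
  operator norm.\<close>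

lemma has_derivative_linear_family:
  fixes A :: "'x::real_normed_vector \<Rightarrow> 'a::euclidean_space \<Rightarrow> 'b::real_normed_vector"
  assumes "open T" "x \<in> T" "\<And>y. y \<in> T \<Longrightarrow> linear (A y)"
    and dA: "\<And>u. ((\<lambda>y. A y u) has_derivative A' u) (at x)"
    and dw: "(w has_derivative w') (at x)"
  shows "((\<lambda>y. A y (w y)) has_derivative (\<lambda>v. A' (w x) v + A x (w' v))) (at x)"
proof -
  have "((\<lambda>y. \<Sum>i\<in>Basis. (w x \<bullet> i) *\<^sub>R A y i) has_derivative (\<lambda>v. \<Sum>i\<in>Basis. (w x \<bullet> i) *\<^sub>R A' i v)) (at x)"
    by (intro derivative_intros dA)
  then have "((\<lambda>y. A y (w x)) has_derivative (\<lambda>v. \<Sum>i\<in>Basis. (w x \<bullet> i) *\<^sub>R A' i v)) (at x)"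
    by (rule has_derivative_transform_within_open[OF _ assms(1,2)])
      (simp add: linear_basis_expansion[OF assms(3), symmetric])
  \<comment> \<open>Linearity of \<open>A'\<close> in its first argument is not assumed; uniqueness
    of derivatives supplies the basis expansion at \<open>w x\<close>.\<close>
  then have A': "A' (w x) = (\<lambda>v. \<Sum>i\<in>Basis. (w x \<bullet> i) *\<^sub>R A' i v)"
    using dA has_derivative_unique by blast
  have "((\<lambda>y. \<Sum>i\<in>Basis. (w y \<bullet> i) *\<^sub>R A y i) has_derivative
      (\<lambda>v. \<Sum>i\<in>Basis. (w x \<bullet> i) *\<^sub>R A' i v + (w' v \<bullet> i) *\<^sub>R A x i)) (at x)"
    by (intro has_derivative_sum has_derivative_scaleR dA) (intro derivative_intros dw)
  then have "((\<lambda>y. A y (w y)) has_derivative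
      (\<lambda>v. \<Sum>i\<in>Basis. (w x \<bullet> i) *\<^sub>R A' i v + (w' v \<bullet> i) *\<^sub>R A x i)) (at x)"
    by (rule has_derivative_transform_within_open[OF _ assms(1,2)])
      (simp add: linear_basis_expansion[OF assms(3), symmetric])
  moreover have "(\<Sum>i\<in>Basis. (w x \<bullet> i) *\<^sub>R A' i v + (w' v \<bullet> i) *\<^sub>R A x i) = A' (w x) v + A x (w' v)" for v
    using linear_basis_expansion[OF assms(3)[OF assms(2)], of "w' v"] A' by (simp add: sum.distrib)
  ultimately show ?thesis by simp
qed

lemma continuous_on_linear_family:
  fixes A :: "'x::topological_space \<Rightarrow> 'a::euclidean_space \<Rightarrow> 'b::real_normed_vector"
  assumes "\<And>y. y \<in> T \<Longrightarrow> linear (A y)" "\<And>u. continuous_on T (\<lambda>y. A y u)" "continuous_on T w"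
  shows "continuous_on T (\<lambda>y. A y (w y))"
proof -
  have "continuous_on T (\<lambda>y. \<Sum>i\<in>Basis. (w y \<bullet> i) *\<^sub>R A y i)"
    by (intro continuous_intros assms)
  then show ?thesis
    by (rule continuous_on_eq) (simp add: linear_basis_expansion[OF assms(1), symmetric])
qed

lemma smooth_map_real_atlas:
  "smooth_map real_atlas B \<gamma> \<longleftrightarrow>
    continuous_on UNIV \<gamma> \<and> (\<forall>d\<in>B. smooth_on (\<gamma> -` fst d) (\<lambda>t. snd d (\<gamma> t)))"
proof -
  have "inv_into UNIV id = (id :: real \<Rightarrow> real)" using inv_id by simp
  then show ?thesis
    by (simp add: smooth_map_def real_atlas_def chart_inv_def o_def)
qed

lemma has_vector_derivative_shift:
  assumes "(h has_vector_derivative h') (at (t + \<omega>))"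
  shows "((\<lambda>s. h (s + \<omega>)) has_vector_derivative h') (at (t :: real))"
proof -
  have "((\<lambda>s. s + \<omega>) has_vector_derivative 1) (at t)" by (auto intro!: derivative_eq_intros)
  from vector_diff_chain_at[OF this, of h h'] assms show ?thesis by (simp add: o_def)
qed

section \<open>Symmetry of second derivatives\<close>

lemma mixed_difference_mean_value:
  fixes g :: "'a::real_normed_vector \<Rightarrow> real"
  assumes s: "s > 0" and u: "\<And>x. x \<in> S \<Longrightarrow> (g has_derivative g' x) (at x)"
    and v: "\<And>x. x \<in> S \<Longrightarrow> ((\<lambda>x. g' x v) has_derivative g'' x) (at x)"
    and S: "\<And>a b. 0 \<le> a \<Longrightarrow> a \<le> s \<Longrightarrow> 0 \<le> b \<Longrightarrow> b \<le> s \<Longrightarrow> x + a *\<^sub>R u + b *\<^sub>R v \<in> S"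
  shows "\<exists>a b. 0 < a \<and> a < s \<and> 0 < b \<and> b < s \<and>
    g (x + s *\<^sub>R u + s *\<^sub>R v) - g (x + s *\<^sub>R u) - g (x + s *\<^sub>R v) + g x = s * s * g'' (x + a *\<^sub>R u + b *\<^sub>R v) u"
proof -
  let ?p = "\<lambda>b. g (x + s *\<^sub>R u + b *\<^sub>R v) - g (x + b *\<^sub>R v)"
  have d1: "((\<lambda>b. g (x + a *\<^sub>R u + b *\<^sub>R v)) has_real_derivative g' (x + a *\<^sub>R u + b *\<^sub>R v) v) (at b)"
    if "0 \<le> a" "a \<le> s" "0 \<le> b" "b \<le> s" for a b
  proof -
    have 1: "(g has_derivative g' (x + a *\<^sub>R u + b *\<^sub>R v)) (at (x + a *\<^sub>R u + b *\<^sub>R v))"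
      using u S that by blast
    have "((\<lambda>b. x + a *\<^sub>R u + b *\<^sub>R v) has_derivative (\<lambda>h. h *\<^sub>R v)) (at b)"
      by (auto intro!: derivative_eq_intros)
    from diff_chain_at[OF this 1]
    have "((\<lambda>b. g (x + a *\<^sub>R u + b *\<^sub>R v)) has_derivative (\<lambda>h. g' (x + a *\<^sub>R u + b *\<^sub>R v) (h *\<^sub>R v))) (at b)"
      by (simp add: o_def)
    then show ?thesis
      unfolding has_field_derivative_def
      by (rule has_derivative_eq_rhs) (simp add: linear_cmul[OF has_derivative_linear[OF 1]] mult.commute fun_eq_iff)
  qed
  have d2: "((\<lambda>a. g' (x + a *\<^sub>R u + b *\<^sub>R v) v) has_real_derivative g'' (x + a *\<^sub>R u + b *\<^sub>R v) u) (at a)"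
    if "0 \<le> a" "a \<le> s" "0 \<le> b" "b \<le> s" for a b
  proof -
    have 1: "((\<lambda>x. g' x v) has_derivative g'' (x + a *\<^sub>R u + b *\<^sub>R v)) (at (x + a *\<^sub>R u + b *\<^sub>R v))"
      using v S that by blast
    have "((\<lambda>a. x + a *\<^sub>R u + b *\<^sub>R v) has_derivative (\<lambda>h. h *\<^sub>R u)) (at a)"
      by (auto intro!: derivative_eq_intros)
    from diff_chain_at[OF this 1]
    have "((\<lambda>a. g' (x + a *\<^sub>R u + b *\<^sub>R v) v) has_derivative (\<lambda>h. g'' (x + a *\<^sub>R u + b *\<^sub>R v) (h *\<^sub>R u))) (at a)"
      by (simp add: o_def)
    then show ?thesis
      unfolding has_field_derivative_def
      by (rule has_derivative_eq_rhs) (simp add: linear_cmul[OF has_derivative_linear[OF 1]] mult.commute fun_eq_iff)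
  qed
  have "\<exists>b>0. b < s \<and> ?p s - ?p 0 = (s - 0) * (g' (x + s *\<^sub>R u + b *\<^sub>R v) v - g' (x + b *\<^sub>R v) v)"
    using s by (intro MVT2) (auto intro!: DERIV_diff d1 d1[of 0, simplified])
  then obtain b where b: "0 < b" "b < s"
    "?p s - ?p 0 = s * (g' (x + s *\<^sub>R u + b *\<^sub>R v) v - g' (x + b *\<^sub>R v) v)" by auto
  have "\<exists>a>0. a < s \<and> g' (x + s *\<^sub>R u + b *\<^sub>R v) v - g' (x + 0 *\<^sub>R u + b *\<^sub>R v) v =
      (s - 0) * g'' (x + a *\<^sub>R u + b *\<^sub>R v) u"
    using s b by (intro MVT2 d2) auto
  then obtain a where "0 < a" "a < s"
    "g' (x + s *\<^sub>R u + b *\<^sub>R v) v - g' (x + b *\<^sub>R v) v = s * g'' (x + a *\<^sub>R u + b *\<^sub>R v) u" by auto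
  with b show ?thesis by (intro exI[of _ a] exI[of _ b]) (auto simp: algebra_simps)
qed

text \<open>The second difference over a small parallelogram is symmetric in \<open>u\<close> and
  \<open>v\<close>. By the mean value theorem in each direction it is \<open>s * s\<close> times
  either mixed derivative at a nearby point, and continuity compares both points with
  \<open>x\<close>.\<close>

lemma second_derivative_symmetric_real:
  fixes g :: "'a::real_normed_vector \<Rightarrow> real"
  assumes "open S" "x \<in> S" and g: "\<And>x. x \<in> S \<Longrightarrow> (g has_derivative g' x) (at x)"
    and g': "\<And>x w. x \<in> S \<Longrightarrow> ((\<lambda>x. g' x w) has_derivative g'' w x) (at x)"
    and cont: "\<And>v w. continuous_on S (\<lambda>x. g'' w x v)"
  shows "g'' v x u = g'' u x v"
proof (rule ccontr)
  assume neq: "g'' v x u \<noteq> g'' u x v"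
  \<comment> \<open>Two numbers at distance \<open>2 * \<epsilon>\<close> cannot both be closer than
    \<open>\<epsilon>\<close> to a common value.\<close>
  define \<epsilon> where "\<epsilon> = dist (g'' v x u) (g'' u x v) / 2"
  have "\<epsilon> > 0" using neq by (simp add: \<epsilon>_def)
  obtain r where r: "r > 0" "ball x r \<subseteq> S" using assms(1,2) openE by blast
  obtain d1 where d1: "d1 > 0" "\<And>y. y \<in> S \<Longrightarrow> dist y x < d1 \<Longrightarrow> dist (g'' v y u) (g'' v x u) < \<epsilon>"
    using cont \<open>\<epsilon> > 0\<close> \<open>x \<in> S\<close> unfolding continuous_on_iff by meson
  obtain d2 where d2: "d2 > 0" "\<And>y. y \<in> S \<Longrightarrow> dist y x < d2 \<Longrightarrow> dist (g'' u y v) (g'' u x v) < \<epsilon>"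
    using cont \<open>\<epsilon> > 0\<close> \<open>x \<in> S\<close> unfolding continuous_on_iff by meson
  \<comment> \<open>The summand \<open>1\<close> keeps \<open>K\<close> positive when
    \<open>u\<close> and \<open>v\<close> vanish; the choice of \<open>s\<close> below puts the
    whole parallelogram within \<open>d / 2\<close> of \<open>x\<close>.\<close>
  define K where "K = norm u + norm v + 1"
  have K: "K > 0" by (simp add: K_def add_nonneg_pos)
  define d where "d = min r (min d1 d2)"
  have "d > 0" using r d1 d2 by (simp add: d_def)
  define s where "s = d / (2 * K)"
  have s: "s > 0" using \<open>d > 0\<close> K by (simp add: s_def)
  have near: "dist (x + a *\<^sub>R u + b *\<^sub>R v) x < d" if "0 \<le> a" "a \<le> s" "0 \<le> b" "b \<le> s" for a b
  proof -
    have "dist (x + a *\<^sub>R u + b *\<^sub>R v) x \<le> a * norm u + b * norm v"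
      using norm_triangle_ineq[of "a *\<^sub>R u" "b *\<^sub>R v"] that by (simp add: dist_norm)
    also have "\<dots> \<le> s * norm u + s * norm v" using that by (intro add_mono mult_right_mono) auto
    also have "\<dots> \<le> s * K" using s by (simp add: K_def algebra_simps)
    also have "\<dots> < d" using K \<open>d > 0\<close> by (simp add: s_def)
    finally show ?thesis .
  qed
  have inS: "x + a *\<^sub>R u + b *\<^sub>R v \<in> S" if "0 \<le> a" "a \<le> s" "0 \<le> b" "b \<le> s" for a b
    using near[OF that] r by (auto simp: d_def dist_commute)
  obtain a b where ab: "0 < a" "a < s" "0 < b" "b < s"
    "g (x + s *\<^sub>R u + s *\<^sub>R v) - g (x + s *\<^sub>R u) - g (x + s *\<^sub>R v) + g x = s * s * g'' v (x + a *\<^sub>R u + b *\<^sub>R v) u"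
    using mixed_difference_mean_value[OF s g g' inS] by blast
  have inS': "x + a *\<^sub>R v + b *\<^sub>R u \<in> S" if "0 \<le> a" "a \<le> s" "0 \<le> b" "b \<le> s" for a b
    using inS[OF that(3,4,1,2)] by (simp add: algebra_simps)
  obtain a' b' where ab': "0 < a'" "a' < s" "0 < b'" "b' < s"
    "g (x + s *\<^sub>R v + s *\<^sub>R u) - g (x + s *\<^sub>R v) - g (x + s *\<^sub>R u) + g x = s * s * g'' u (x + a' *\<^sub>R v + b' *\<^sub>R u) v"
    using mixed_difference_mean_value[OF s g g' inS'] by blast
  have "g (x + s *\<^sub>R u + s *\<^sub>R v) = g (x + s *\<^sub>R v + s *\<^sub>R u)" by (simp add: algebra_simps)
  then have "s * s * g'' v (x + a *\<^sub>R u + b *\<^sub>R v) u = s * s * g'' u (x + a' *\<^sub>R v + b' *\<^sub>R u) v"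
    using ab(5) ab'(5) by linarith
  then have eq: "g'' v (x + a *\<^sub>R u + b *\<^sub>R v) u = g'' u (x + b' *\<^sub>R u + a' *\<^sub>R v) v"
    using s by (simp add: algebra_simps)
  have "dist (g'' v (x + a *\<^sub>R u + b *\<^sub>R v) u) (g'' v x u) < \<epsilon>"
    using near[of a b] inS[of a b] ab by (intro d1) (auto simp: d_def)
  moreover have "dist (g'' u (x + b' *\<^sub>R u + a' *\<^sub>R v) v) (g'' u x v) < \<epsilon>"
    using near[of b' a'] inS[of b' a'] ab' by (intro d2) (auto simp: d_def)
  ultimately show False
    using eq dist_triangle2[of "g'' v x u" "g'' u x v" "g'' v (x + a *\<^sub>R u + b *\<^sub>R v) u"]
    unfolding \<epsilon>_def by (simp add: dist_commute)
qed

lemma smooth_on_second_derivative_symmetric: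
  fixes f :: "'a::real_normed_vector \<Rightarrow> 'b::euclidean_space"
  assumes "open S" "x \<in> S" "smooth_on S f"
  shows "frechet_derivative (\<lambda>x. frechet_derivative f (at x) v) (at x) u =
    frechet_derivative (\<lambda>x. frechet_derivative f (at x) u) (at x) v"
proof (rule euclidean_eqI)
  fix i :: 'b assume "i \<in> Basis"
  let ?D = "\<lambda>w x. frechet_derivative (\<lambda>x. frechet_derivative f (at x) w) (at x)"
  have "(\<lambda>v. ?D w x v \<bullet> i) = (\<lambda>v. ?D w x v \<bullet> i)" for w x by simp
  show "?D v x u \<bullet> i = ?D u x v \<bullet> i"
    by (rule second_derivative_symmetric_real[where S=S and g="\<lambda>x. f x \<bullet> i"
          and g'="\<lambda>x w. frechet_derivative f (at x) w \<bullet> i" and g''="\<lambda>w x v. ?D w x v \<bullet> i"])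
      (intro assms has_derivative_inner_left smooth_on_imp_has_derivative[where S=S]
        smooth_on_frechet_derivative continuous_on_inner continuous_on_const
        smooth_on_imp_continuous_on | assumption)+
qed

lemma open_Collect_mem_continuous:
  "open S \<Longrightarrow> continuous_on UNIV f \<Longrightarrow> open {x. f x \<in> S}"
  using open_vimage[of S f] by (simp add: vimage_def)

lemma open_contains_ball_square:
  fixes W :: "('a::metric_space \<times> 'a) set"
  assumes "open W" "(a, a) \<in> W"
  obtains r where "r > 0" "\<And>x y. x \<in> ball a r \<Longrightarrow> y \<in> ball a r \<Longrightarrow> (x, y) \<in> W"
proof -
  obtain A B where AB: "open A" "open B" "(a, a) \<in> A \<times> B" "A \<times> B \<subseteq> W"
    using open_prod_elim[OF assms] by blast
  then have "open (A \<inter> B)" "a \<in> A \<inter> B" by auto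
  then obtain r where r: "r > 0" "ball a r \<subseteq> A \<inter> B" using openE by blast
  have "(x, y) \<in> W" if "x \<in> ball a r" "y \<in> ball a r" for x y
    using that r(2) subsetD[OF AB(4), of "(x, y)"] by blast
  then show ?thesis using that r(1) by blast
qed

section \<open>Inverting a family of linear maps\<close>

lemma linear_inverse_function:
  assumes "linear L" "\<And>u. T (L u) = u" "\<And>u. L (T u) = u"
  shows "linear T"
proof (rule linearI)
  show "T (x + y) = T x + T y" for x y
    using assms(2)[of "T x + T y"] by (simp add: linear_add[OF assms(1)] assms(3))
  show "T (c *\<^sub>R x) = c *\<^sub>R T x" for c x
    using assms(2)[of "c *\<^sub>R T x"] by (simp add: linear_cmul[OF assms(1)] assms(3))
qed

text \<open>A perturbation estimate: the difference \<open>?d\<close> of the inverses is bounded by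
  a multiple of \<open>L x ?d\<close> plus an error proportional to \<open>?d\<close>, which can be
  absorbed once \<open>L x\<close> is close to \<open>L x0\<close> on the basis.\<close>

lemma inverse_family_continuous:
  fixes L T :: "'x::metric_space \<Rightarrow> 'a::euclidean_space \<Rightarrow> 'a"
  assumes S: "open S" "x0 \<in> S" and L: "\<And>x. x \<in> S \<Longrightarrow> linear (L x)"
    and TL: "\<And>x u. x \<in> S \<Longrightarrow> T x (L x u) = u" and LT: "\<And>x u. x \<in> S \<Longrightarrow> L x (T x u) = u"
    and cont: "\<And>u. isCont (\<lambda>x. L x u) x0"
  shows "isCont (\<lambda>x. T x u) x0"
proof -
  have "linear (T x0)"
    using linear_inverse_function L TL LT S(2) by blast
  then obtain B where B: "B > 0" "\<And>y. norm (T x0 y) \<le> B * norm y"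
    using linear_bounded_pos by blast
  define e where "e x = (\<Sum>i\<in>Basis. norm (L x i - L x0 i))" for x
  have e: "norm (L x X - L x0 X) \<le> e x * norm X" if "x \<in> S" for x X
  proof -
    have "L x X - L x0 X = (\<Sum>i\<in>Basis. (X \<bullet> i) *\<^sub>R (L x i - L x0 i))"
      using linear_basis_expansion[OF L[OF that], of X] linear_basis_expansion[OF L[OF S(2)], of X]
      by (simp add: sum_subtractf scaleR_diff_right)
    also have "norm \<dots> \<le> (\<Sum>i\<in>Basis. norm ((X \<bullet> i) *\<^sub>R (L x i - L x0 i)))" by (rule norm_sum)
    also have "\<dots> \<le> (\<Sum>i\<in>Basis. norm X * norm (L x i - L x0 i))"
      by (intro sum_mono) (auto intro!: mult_right_mono Basis_le_norm)
    finally show ?thesis by (simp add: e_def sum_distrib_left mult.commute)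
  qed
  have "(e \<longlongrightarrow> e x0) (at x0)"
    unfolding e_def using cont by (intro tendsto_intros) (auto simp: isCont_def)
  then have "(e \<longlongrightarrow> 0) (at x0)" by (simp add: e_def)
  \<comment> \<open>This threshold makes the error at most half of \<open>norm ?d\<close>, whence
    the factor \<open>2 * B\<close> below.\<close>
  then have "eventually (\<lambda>x. e x < 1 / (2 * B)) (at x0)"
    using B(1) by (intro order_tendstoD) auto
  then have "eventually (\<lambda>x. x \<in> S \<and> e x < 1 / (2 * B)) (at x0)"
    using S by (simp add: eventually_conj_iff eventually_at_in_open')
  then have "eventually (\<lambda>x. norm (T x u - T x0 u) \<le> 2 * B * norm (L x (T x0 u) - L x0 (T x0 u))) (at x0)"
  proof eventually_elim
    case (elim x)
    let ?d = "T x u - T x0 u"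
    have d: "L x ?d = u - L x (T x0 u)"
      using elim by (simp add: linear_diff[OF L] LT)
    have "norm ?d = norm (T x0 (L x0 ?d))" using S by (simp add: TL)
    also have "\<dots> \<le> B * norm (L x0 ?d)" by (rule B)
    also have "\<dots> \<le> B * (norm (L x ?d) + norm (L x ?d - L x0 ?d))"
      using B(1) norm_triangle_sub[of "L x0 ?d" "L x ?d"]
      by (intro mult_left_mono) (simp_all add: norm_minus_commute)
    also have "\<dots> \<le> B * (norm (L x ?d) + 1 / (2 * B) * norm ?d)"
      using e[of x ?d] elim B(1) mult_right_mono[of "e x" "1 / (2 * B)" "norm ?d"]
      by (intro mult_left_mono add_left_mono) auto
    also have "\<dots> = B * norm (L x ?d) + norm ?d / 2" using B(1) by (simp add: field_simps)
    finally have "norm ?d \<le> 2 * B * norm (L x ?d)" by simp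
    then show ?case using d S by (simp add: LT norm_minus_commute)
  qed
  moreover have "((\<lambda>x. 2 * B * norm (L x (T x0 u) - L x0 (T x0 u))) \<longlongrightarrow> 2 * B * norm (L x0 (T x0 u) - L x0 (T x0 u))) (at x0)"
    using cont by (intro tendsto_intros) (auto simp: isCont_def)
  then have "((\<lambda>x. 2 * B * norm (L x (T x0 u) - L x0 (T x0 u))) \<longlongrightarrow> 0) (at x0)" by simp
  ultimately have "((\<lambda>x. T x u - T x0 u) \<longlongrightarrow> 0) (at x0)"
    by (rule Lim_null_comparison)
  then show ?thesis unfolding isCont_def using Lim_null by blast
qed

text \<open>The shear sending \<open>(x, w)\<close> to \<open>(x, L x w)\<close> has the inverse
  sending \<open>(x, u)\<close> to \<open>(x, T x u)\<close>, and its derivative is triangular,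
  hence explicitly invertible. The rule for derivatives of inverse maps then needs only continuity
  of the inverse, which is \<open>inverse_family_continuous\<close>.\<close>

lemma has_derivative_inverse_family:
  fixes L T :: "'x::euclidean_space \<Rightarrow> 'a::euclidean_space \<Rightarrow> 'a"
  assumes S: "open S" "x0 \<in> S" and L: "\<And>x. x \<in> S \<Longrightarrow> linear (L x)"
    and TL: "\<And>x u. x \<in> S \<Longrightarrow> T x (L x u) = u" and LT: "\<And>x u. x \<in> S \<Longrightarrow> L x (T x u) = u"
    and dL: "\<And>u. ((\<lambda>y. L y u) has_derivative L' u) (at x0)"
  shows "((\<lambda>x. T x u) has_derivative (\<lambda>v. - T x0 (L' (T x0 u) v))) (at x0)"
proof -
  have linT: "linear (T x)" if "x \<in> S" for x
    using linear_inverse_function L TL LT that by blast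
  define w where "w = T x0 u"
  define f where "f p = (fst p, L (fst p) (snd p))" for p
  define g where "g p = (fst p, T (fst p) (snd p))" for p
  define f' where "f' p = (fst p, L' w (fst p) + L x0 (snd p))" for p
  define g' where "g' p = (fst p, T x0 (snd p - L' w (fst p)))" for p
  have linL': "linear (L' w)" using dL has_derivative_linear by blast
  have "(g has_derivative g') (at (x0, u))"
  proof (rule has_derivative_inverse_basic[where T="S \<times> UNIV"])
    have "((\<lambda>p. L (fst p) (snd p)) has_derivative (\<lambda>v. L' (snd (x0, w)) (fst v) + L (fst (x0, w)) (snd v))) (at (x0, w))"
    proof (rule has_derivative_linear_family[where T="S \<times> UNIV" and A="\<lambda>p. L (fst p)" and w=snd
          and A'="\<lambda>u v. L' u (fst v)"])
      fix u show "((\<lambda>p. L (fst p) u) has_derivative (\<lambda>v. L' u (fst v))) (at (x0, w))"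
        using has_derivative_compose[OF has_derivative_fst[OF has_derivative_ident], of "\<lambda>y. L y u" "L' u" "(x0, w)"]
          dL[of u] by simp
    qed (use S L in \<open>auto intro: open_Times has_derivative_snd has_derivative_ident\<close>)
    then have "(f has_derivative f') (at (x0, w))"
      using has_derivative_Pair[OF has_derivative_fst[OF has_derivative_ident]]
      unfolding f_def f'_def by simp
    then show "(f has_derivative f') (at (g (x0, u)))"
      by (simp add: g_def w_def)
    have bl: "bounded_linear (T x0)" "bounded_linear (L' w)"
      using linT[OF S(2)] linL' linear_conv_bounded_linear by blast+
    show "bounded_linear g'"
      unfolding g'_def
      by (rule bounded_linear_Pair[OF bounded_linear_fst bounded_linear_compose[OF bl(1)
            bounded_linear_sub[OF bounded_linear_snd bounded_linear_compose[OF bl(2) bounded_linear_fst]]]])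
    show "g' \<circ> f' = id" using S by (auto simp: g'_def f'_def TL)
    have "isCont (\<lambda>x. T x i) x0" for i
      by (rule inverse_family_continuous[OF S L TL LT has_derivative_continuous[OF dL]])
    then have "isCont (\<lambda>p. T (fst p) i) (x0, u)" for i
      using isCont_o2[of "(x0, u)" fst "\<lambda>x. T x i"] by simp
    then have Ti: "((\<lambda>p. T (fst p) i) \<longlongrightarrow> T x0 i) (at (x0, u))" for i
      by (simp add: isCont_def)
    have "((\<lambda>p. \<Sum>i\<in>Basis. (snd p \<bullet> i) *\<^sub>R T (fst p) i) \<longlongrightarrow> (\<Sum>i\<in>Basis. (snd (x0, u) \<bullet> i) *\<^sub>R T x0 i)) (at (x0, u))"
      by (intro tendsto_intros Ti)
    moreover have "eventually (\<lambda>p. p \<in> S \<times> UNIV) (at (x0, u))"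
      using S by (intro eventually_at_in_open' open_Times) auto
    then have "eventually (\<lambda>p. (\<Sum>i\<in>Basis. (snd p \<bullet> i) *\<^sub>R T (fst p) i) = T (fst p) (snd p)) (at (x0, u))"
      by eventually_elim (rule linear_basis_expansion[OF linT, symmetric], auto)
    ultimately have "((\<lambda>p. T (fst p) (snd p)) \<longlongrightarrow> (\<Sum>i\<in>Basis. (snd (x0, u) \<bullet> i) *\<^sub>R T x0 i)) (at (x0, u))"
      by (rule Lim_transform_eventually)
    then have "((\<lambda>p. T (fst p) (snd p)) \<longlongrightarrow> T x0 u) (at (x0, u))"
      using linear_basis_expansion[OF linT[OF S(2)], of u] by simp
    from tendsto_Pair[OF tendsto_fst[OF tendsto_ident_at] this]
    show "continuous (at (x0, u)) g"
      unfolding g_def isCont_def by simp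
  qed (use S in \<open>auto simp: f_def g_def LT intro: open_Times\<close>)
  then have "((\<lambda>p. snd (g p)) has_derivative (\<lambda>p. snd (g' p))) (at (x0, u))"
    by (rule has_derivative_snd)
  then have "((\<lambda>x. snd (g (x, u))) has_derivative (\<lambda>v. snd (g' (v, 0)))) (at x0)"
    by (rule has_derivative_compose[OF has_derivative_Pair[OF has_derivative_ident has_derivative_const]])
  then show ?thesis
    by (simp add: g_def g'_def w_def linear_neg[OF linT[OF S(2)]])
qed

text \<open>The primitive is the integral of the form along the segment from \<open>e\<close> to
  \<open>x\<close>. In \<open>A' x v u\<close> the direction of differentiation is \<open>v\<close>
  and the argument is \<open>u\<close>, so \<open>sym\<close> is closedness.\<close>

lemma poincare_one_form:
  fixes A :: "'a::euclidean_space \<Rightarrow> 'a \<Rightarrow> 'b::banach"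
  assumes S: "open S" "convex S" "e \<in> S" and lin: "\<And>x. x \<in> S \<Longrightarrow> linear (A x)"
    and der: "\<And>x u. x \<in> S \<Longrightarrow> ((\<lambda>y. A y u) has_derivative (\<lambda>v. A' x v u)) (at x)"
    and cont: "\<And>u v. continuous_on S (\<lambda>x. A' x v u)"
    and sym: "\<And>x u v. x \<in> S \<Longrightarrow> A' x v u = A' x u v"
  obtains f where "f e = 0" "\<And>x. x \<in> S \<Longrightarrow> (f has_derivative A x) (at x)"
proof -
  define p where "p x t = e + t *\<^sub>R (x - e)" for x and t :: real
  have pS: "p x t \<in> S" if "x \<in> S" "0 \<le> t" "t \<le> 1" for x t
  proof -
    have "p x t = (1 - t) *\<^sub>R e + t *\<^sub>R x" by (simp add: p_def algebra_simps)
    then show ?thesis using S that by (simp add: convexD_alt)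
  qed
  have linA': "linear (A' x v)" if "x \<in> S" for x v
    using has_derivative_linear[OF der[OF that]] sym[OF that] by (auto simp: linear_iff)
  have linA'2: "linear (\<lambda>v. A' x v u)" if "x \<in> S" for x u
    using has_derivative_linear[OF der[OF that]] .
  \<comment> \<open>The derivative of the integrand in \<open>x\<close>. By \<open>sym\<close> it is
    also the derivative of \<open>t *\<^sub>R A (p x t) h\<close> in \<open>t\<close>, so its
    integral over the unit interval is \<open>A x h\<close>.\<close>
  define dF where "dF x t h = t *\<^sub>R A' (p x t) h (x - e) + A (p x t) h" for x t h
  have dF: "((\<lambda>y. A (p y t) (y - e)) has_derivative dF x t) (at x)" if "x \<in> S" "0 \<le> t" "t \<le> 1" for x t
  proof -
    have dp: "((\<lambda>y. p y t) has_derivative (\<lambda>h. t *\<^sub>R h)) (at x)"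
      unfolding p_def by (auto intro!: derivative_eq_intros)
    have 1: "((\<lambda>y. A (p y t) u) has_derivative (\<lambda>v. A' (p x t) (t *\<^sub>R v) u)) (at x)" for u
      using diff_chain_at[OF dp der[OF pS[OF that]]] by (simp add: o_def)
    have pd: "open {y. p y t \<in> S}"
      unfolding p_def by (intro open_Collect_mem_continuous S(1) continuous_intros)
    have "((\<lambda>y. A (p y t) (y - e)) has_derivative
        (\<lambda>v. A' (p x t) (t *\<^sub>R v) (x - e) + A (p x t) v)) (at x)"
      by (rule has_derivative_linear_family[OF pd _ lin 1]) (use pS that in \<open>auto intro!: derivative_eq_intros\<close>)
    then show ?thesis
      unfolding dF_def by (simp add: linear_cmul[OF linA'2[OF pS[OF that]]])
  qed
  have bl: "bounded_linear (dF x t)" if "x \<in> S" "0 \<le> t" "t \<le> 1" for x t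
    using dF[OF that] has_derivative_bounded_linear by blast
  define F where "F x = integral (cbox 0 1) (\<lambda>t. A (p x t) (x - e))" for x
  have contA: "continuous_on S (\<lambda>x. A x u)" for u
    by (intro continuous_at_imp_continuous_on ballI has_derivative_continuous) (rule der)
  have contp: "continuous_on (S \<times> {0..1}) (\<lambda>q. p (fst q) (snd q))"
    unfolding p_def by (intro continuous_intros)
  have pSq: "p (fst q) (snd q) \<in> S" if "q \<in> S \<times> {0..1}" for q using pS that by auto
  have contAp: "continuous_on (S \<times> {0..1}) (\<lambda>q. A (p (fst q) (snd q)) u)" for u
    by (rule continuous_on_compose2[OF contA contp]) (use pSq in blast)
  have contA'p: "continuous_on (S \<times> {0..1}) (\<lambda>q. A' (p (fst q) (snd q)) v u)" for u v
    by (rule continuous_on_compose2[OF cont contp]) (use pSq in blast)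
  have contF: "continuous_on (S \<times> {0..1}) (\<lambda>q. A (p (fst q) (snd q)) (fst q - e))"
    by (rule continuous_on_linear_family[OF lin[OF pSq] contAp]) (assumption, intro continuous_intros)
  have contdF: "continuous_on (S \<times> {0..1}) (\<lambda>q. dF (fst q) (snd q) h)" for h
    unfolding dF_def
    by (intro continuous_on_add continuous_on_scaleR contAp
        continuous_on_linear_family[OF linA'[OF pSq] contA'p] continuous_intros) assumption
  have slice: "continuous_on {0..1} (\<lambda>t. h x t)"
    if "continuous_on (S \<times> {0..1}) (\<lambda>q. h (fst q) (snd q))" "x \<in> S" for h :: "'a \<Rightarrow> real \<Rightarrow> 'b" and x
    using continuous_on_compose2[OF that(1) continuous_on_Pair[OF continuous_on_const continuous_on_id], of x "{0..1}"] that(2)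
    by auto
  \<comment> \<open>\<open>leibniz_rule\<close> wants the partial derivative as a continuous family
    of bounded linear maps.\<close>
  have contbl: "continuous_on (S \<times> {0..1}) (\<lambda>q. Blinfun (dF (fst q) (snd q)))"
  proof (rule continuous_on_blinfun_componentwise)
    fix i :: 'a
    show "continuous_on (S \<times> {0..1}) (\<lambda>q. blinfun_apply (Blinfun (dF (fst q) (snd q))) i)"
      by (rule continuous_on_eq[OF contdF[of i]]) (use bl in \<open>auto simp: bounded_linear_Blinfun_apply\<close>)
  qed
  have "(F has_derivative A x) (at x)" if "x \<in> S" for x
  proof -
    have "(F has_derivative integral (cbox 0 1) (\<lambda>t. Blinfun (dF x t))) (at x within S)"
      unfolding F_def
    proof (rule leibniz_rule[where fx="\<lambda>x t. Blinfun (dF x t)"])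
      fix x t assume "x \<in> S" "t \<in> cbox 0 (1::real)"
      then show "((\<lambda>x. A (p x t) (x - e)) has_derivative blinfun_apply (Blinfun (dF x t))) (at x within S)"
        using dF bl by (auto simp: bounded_linear_Blinfun_apply intro: has_derivative_at_withinI)
    next
      fix x assume "x \<in> S"
      then show "(\<lambda>t. A (p x t) (x - e)) integrable_on cbox 0 1"
        using slice[OF contF] by (auto intro: integrable_continuous_real)
    next
      show "continuous_on (S \<times> cbox 0 1) (\<lambda>(x, t). Blinfun (dF x t))"
        using contbl by (simp add: case_prod_beta)
    qed (use S that in auto)
    moreover have "blinfun_apply (integral (cbox 0 1) (\<lambda>t. Blinfun (dF x t))) h = A x h" for h
    proof -
      have "continuous_on {0..1} (\<lambda>t. Blinfun (dF x t))"
        using continuous_on_compose2[OF contbl continuous_on_Pair[OF continuous_on_const continuous_on_id], of x "{0..1}"] that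
        by auto
      then have "(\<lambda>t. Blinfun (dF x t)) integrable_on cbox 0 1"
        by (simp add: integrable_continuous_real)
      from integral_linear[OF this, of "\<lambda>b. blinfun_apply b h"]
      have "blinfun_apply (integral (cbox 0 1) (\<lambda>t. Blinfun (dF x t))) h =
          integral (cbox 0 1) (\<lambda>t. blinfun_apply (Blinfun (dF x t)) h)"
        by (simp add: o_def blinfun.bounded_linear_left)
      also have "\<dots> = integral {0..1} (\<lambda>t. dF x t h)"
        by (auto intro!: integral_cong simp: bounded_linear_Blinfun_apply bl that)
      also have "\<dots> = 1 *\<^sub>R A (p x 1) h - 0 *\<^sub>R A (p x 0) h"
      proof (rule integral_unique, rule fundamental_theorem_of_calculus)
        fix t :: real assume t: "t \<in> {0..1}"
        have 1: "((\<lambda>t. p x t) has_derivative (\<lambda>s. s *\<^sub>R (x - e))) (at t)"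
          unfolding p_def by (auto intro!: derivative_eq_intros)
        have "((\<lambda>t. A (p x t) h) has_derivative (\<lambda>s. A' (p x t) (s *\<^sub>R (x - e)) h)) (at t)"
          using diff_chain_at[OF 1 der[OF pS]] that t by (simp add: o_def)
        then have "((\<lambda>t. A (p x t) h) has_vector_derivative A' (p x t) (x - e) h) (at t)"
          using t that unfolding has_vector_derivative_def
          by (simp add: linear_cmul[OF linA'2[OF pS[OF that]]])
        from has_vector_derivative_scaleR[OF DERIV_ident this]
        have "((\<lambda>t. t *\<^sub>R A (p x t) h) has_vector_derivative t *\<^sub>R A' (p x t) (x - e) h + 1 *\<^sub>R A (p x t) h) (at t)"
          by simp
        then show "((\<lambda>t. t *\<^sub>R A (p x t) h) has_vector_derivative dF x t h) (at t within {0..1})"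
          using sym[OF pS[OF that]] t by (auto simp: dF_def intro: has_vector_derivative_at_within)
      qed simp
      also have "\<dots> = A x h" by (simp add: p_def)
      finally show ?thesis .
    qed
    then have "blinfun_apply (integral (cbox 0 1) (\<lambda>t. Blinfun (dF x t))) = A x" by (rule ext)
    ultimately have "(F has_derivative A x) (at x within S)" by (rule has_derivative_eq_rhs)
    then show ?thesis by (simp add: at_within_open[OF that S(1)])
  qed
  moreover have "F e = 0"
    using linear_0[OF lin[OF S(3)]] by (simp add: F_def p_def)
  ultimately show ?thesis using that by blast
qed

lemma has_derivative_zero_imp_eq:
  fixes f :: "'a::real_normed_vector \<Rightarrow> 'b::real_inner"
  assumes "open S" "convex S" "x \<in> S" "y \<in> S" "\<And>x. x \<in> S \<Longrightarrow> (f has_derivative (\<lambda>h. 0)) (at x)"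
  shows "f x = f y"
  using has_derivative_zero_unique[OF assms(2), of f x y] assms has_derivative_at_withinI by blast

section \<open>Orthogonal projection\<close>

lemma orth_proj_ex1:
  fixes X :: "'a::euclidean_space"
  assumes "subspace S"
  shows "\<exists>!Y. Y \<in> S \<and> X - Y \<in> orthogonal_comp S"
proof (rule ex_ex1I)
  have "X \<in> S + orthogonal_comp S"
    using subspace_sum_orthogonal_comp[OF assms] by simp
  then show "\<exists>Y. Y \<in> S \<and> X - Y \<in> orthogonal_comp S"
    by (auto elim!: set_plus_elim)
next
  fix Y Y' assume "Y \<in> S \<and> X - Y \<in> orthogonal_comp S" "Y' \<in> S \<and> X - Y' \<in> orthogonal_comp S"
  then have "Y' - Y \<in> S" "(X - Y) - (X - Y') \<in> orthogonal_comp S"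
    using assms subspace_orthogonal_comp subspace_diff by blast+
  then have "Y' - Y \<in> S \<inter> orthogonal_comp S" by simp
  then have "orthogonal (Y' - Y) (Y' - Y)" unfolding orthogonal_comp_def by blast
  then show "Y = Y'" by (simp add: orthogonal_self)
qed

lemma
  fixes X :: "'a::euclidean_space"
  assumes "subspace S"
  shows orth_proj_mem: "orth_proj S X \<in> S"
    and orth_proj_residual: "X - orth_proj S X \<in> orthogonal_comp S"
  using theI'[OF orth_proj_ex1[OF assms, of X]] unfolding orth_proj_def by auto

lemma orth_proj_eqI:
  fixes X :: "'a::euclidean_space"
  assumes "subspace S" "Y \<in> S" "X - Y \<in> orthogonal_comp S"
  shows "orth_proj S X = Y"
  using orth_proj_ex1[OF assms(1)] orth_proj_mem[OF assms(1)] orth_proj_residual[OF assms(1)] assms(2,3)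
  by blast

lemma linear_orth_proj:
  assumes "subspace (S :: 'a::euclidean_space set)"
  shows "linear (orth_proj S)"
proof (rule linearI)
  note mem = orth_proj_mem[OF assms] and res = orth_proj_residual[OF assms]
  show "orth_proj S (x + y) = orth_proj S x + orth_proj S y" for x y
    using subspace_add[OF subspace_orthogonal_comp res[of x] res[of y]]
    by (intro orth_proj_eqI assms subspace_add mem) (simp add: algebra_simps)
  show "orth_proj S (c *\<^sub>R x) = c *\<^sub>R orth_proj S x" for c x
    using subspace_scale[OF subspace_orthogonal_comp res[of x], of c]
    by (intro orth_proj_eqI assms subspace_scale mem) (simp add: algebra_simps)
qed

lemma orth_proj_inner:
  fixes X :: "'a::euclidean_space"
  assumes "subspace S" "z \<in> S"
  shows "orth_proj S X \<bullet> z = X \<bullet> z"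
  using orth_proj_residual[OF assms(1), of X] assms(2)
  by (auto simp: orthogonal_comp_def orthogonal_def inner_diff_right inner_commute)

section \<open>Extension of a local exponential map\<close>

locale two_step_bracket =
  fixes br :: "'a::euclidean_space \<Rightarrow> 'a \<Rightarrow> 'a"
  assumes bracket_bilinear: "bilinear br"
    and bracket_antisym: "br y x = - br x y"
    and bracket_nilpotent: "br (br x y) z = 0"
begin

lemma bounded_bilinear_bracket: "bounded_bilinear br"
  using bracket_bilinear bilinear_conv_bounded_bilinear by blast

sublocale br: bounded_bilinear br
  by (rule bounded_bilinear_bracket)

lemma bracket_self [simp]: "br x x = 0"
  using bracket_antisym[of x x] by (simp add: eq_neg_iff_add_eq_0 flip: scaleR_2)

lemma bracket_nilpotent_right [simp]: "br z (br x y) = 0"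
  using bracket_antisym[of z "br x y"] bracket_nilpotent by simp

text \<open>The Baker--Campbell--Hausdorff product, which stops at the first bracket for a 2-step
  nilpotent Lie algebra.\<close>

definition bch :: "'a \<Rightarrow> 'a \<Rightarrow> 'a" (infixl \<open>\<star>\<close> 70)
  where "x \<star> y = x + y + (1/2) *\<^sub>R br x y"

text \<open>Both sides are the sum of the three vectors plus half the brackets of the ordered pairs;
  all double brackets vanish.\<close>

lemma bch_assoc: "(x \<star> y) \<star> z = x \<star> (y \<star> z)"
  by (simp add: bch_def br.add_left br.add_right br.scaleR_left br.scaleR_right bracket_nilpotent algebra_simps)

lemma bch_0_left [simp]: "0 \<star> x = x" and bch_0_right [simp]: "x \<star> 0 = x"
  by (simp_all add: bch_def br.zero_left br.zero_right)

lemma bch_minus_left [simp]: "(-x) \<star> x = 0" and bch_minus_right [simp]: "x \<star> (-x) = 0"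
  by (simp_all add: bch_def br.minus_left br.minus_right)

lemma bch_minus_cancel [simp]: "x \<star> ((-x) \<star> y) = y" "(-x) \<star> (x \<star> y) = y"
  by (simp_all flip: bch_assoc)

lemma bch_scaleR: "(a *\<^sub>R x) \<star> (b *\<^sub>R x) = (a + b) *\<^sub>R x"
  by (simp add: bch_def br.scaleR_left br.scaleR_right scaleR_add_left)

lemma bch_central: "(\<And>y. br z y = 0) \<Longrightarrow> z \<star> x = z + x" "(\<And>y. br z y = 0) \<Longrightarrow> x \<star> z = x + z"
  using bracket_antisym[of x z] by (simp_all add: bch_def)

lemma continuous_on_bch [continuous_intros]:
  "continuous_on S f \<Longrightarrow> continuous_on S g \<Longrightarrow> continuous_on S (\<lambda>x. f x \<star> g x)"
  unfolding bch_def by (intro continuous_intros br.continuous_on)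

end

text \<open>\<open>E\<close> models the exponential map near \<open>0\<close>. The factors in
  \<open>E_bch\<close> lie in the ball while their product may leave it, so \<open>E\<close> must be
  meaningful slightly beyond. With only topological assumptions on the group, the extension becomes
  an argument about topological groups.\<close>

locale local_exponential = two_step_bracket br + group N
  for br :: "'a::euclidean_space \<Rightarrow> 'a \<Rightarrow> 'a" and N :: "('g::t2_space, 'm) monoid_scheme" (structure) +
  fixes E :: "'a \<Rightarrow> 'g" and \<rho> :: real
  assumes carrier_UNIV [simp]: "carrier N = UNIV"
    and continuous_mult: "continuous_on UNIV (\<lambda>(x, y). x \<otimes> y)"
    and continuous_inv: "continuous_on UNIV (\<lambda>x. inv x)"
    and radius_pos: "\<rho> > 0"
    and E_bch: "x \<in> ball 0 \<rho> \<Longrightarrow> y \<in> ball 0 \<rho> \<Longrightarrow> E (x \<star> y) = E x \<otimes> E y"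
    and continuous_E: "continuous_on (ball 0 \<rho>) E"
    and inj_E: "inj_on E (ball 0 \<rho>)"
    and open_E: "open (E ` ball 0 \<rho>)"
    and continuous_E_inverse: "continuous_on (E ` ball 0 \<rho>) (inv_into (ball 0 \<rho>) E)"
    and simply_connected: "simply_connected (UNIV :: 'g set)"
begin

lemma continuous_on_mult:
  assumes "continuous_on S f" "continuous_on S g"
  shows "continuous_on S (\<lambda>x. f x \<otimes> g x)"
  using continuous_on_compose2[OF continuous_mult continuous_on_Pair[OF assms]] by simp

lemma continuous_on_inv: "continuous_on S f \<Longrightarrow> continuous_on S (\<lambda>x. inv (f x))"
  using continuous_on_compose2[OF continuous_inv] by simp

lemma left_translate_open:
  assumes "open U"
  shows "open ((\<lambda>x. p \<otimes> x) ` U)"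
proof -
  have "(\<lambda>x. p \<otimes> x) ` U = (\<lambda>x. inv p \<otimes> x) -` U"
  proof (rule equalityI; rule subsetI)
    fix y assume "y \<in> (\<lambda>x. inv p \<otimes> x) -` U"
    moreover have "y = p \<otimes> (inv p \<otimes> y)" by (simp flip: m_assoc)
    ultimately show "y \<in> (\<lambda>x. p \<otimes> x) ` U" by blast
  qed (auto simp flip: m_assoc)
  moreover have "open ((\<lambda>x. inv p \<otimes> x) -` U)"
    by (intro open_vimage assms continuous_on_mult continuous_intros)
  ultimately show ?thesis by simp
qed

section \<open>Extension by doubling\<close>

definition Exp :: "'a \<Rightarrow> 'g" where
  "Exp X = (let k = (LEAST k. norm X < 2 ^ k * \<rho>) in E ((1 / 2 ^ k) *\<^sub>R X) [^] (2 ^ k :: nat))"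

lemma scale_large: "\<exists>k. norm X < 2 ^ k * \<rho>"
proof -
  obtain k where "norm X / \<rho> < 2 ^ k"
    using real_arch_pow[of 2 "norm X / \<rho>"] by auto
  then show ?thesis using radius_pos by (auto simp: field_simps)
qed

lemma scale_large_mono:
  assumes "norm X < 2 ^ k * \<rho>" "k \<le> l"
  shows "norm X < 2 ^ l * \<rho>"
proof -
  have "2 ^ k * \<rho> \<le> 2 ^ l * \<rho>"
    using assms(2) radius_pos by (intro mult_right_mono power_increasing) auto
  then show ?thesis using assms(1) by linarith
qed

lemma scaled_in_ball: "norm X < 2 ^ k * \<rho> \<Longrightarrow> (1 / 2 ^ k) *\<^sub>R X \<in> ball 0 \<rho>"
  by (simp add: field_simps)

lemma E_square: "x \<in> ball 0 \<rho> \<Longrightarrow> E (2 *\<^sub>R x) = E x \<otimes> E x"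
  using E_bch[of x x] bch_scaleR[of 1 x 1] by simp

text \<open>Passing from \<open>k\<close> to \<open>Suc k\<close> halves the argument of
  \<open>E\<close> and squares the result. Hence one large exponent can serve several vectors at
  once.\<close>

lemma Exp_eq:
  assumes "norm X < 2 ^ k * \<rho>"
  shows "Exp X = E ((1 / 2 ^ k) *\<^sub>R X) [^] (2 ^ k :: nat)"
proof -
  define k0 where "k0 = (LEAST k. norm X < 2 ^ k * \<rho>)"
  have k0: "norm X < 2 ^ k0 * \<rho>" "k0 \<le> k"
    unfolding k0_def using assms by (auto intro: LeastI Least_le)
  have "E ((1 / 2 ^ k0) *\<^sub>R X) [^] (2 ^ k0 :: nat) = E ((1 / 2 ^ k) *\<^sub>R X) [^] (2 ^ k :: nat)"
    using k0(2)
  proof (induction k rule: dec_induct)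
    case (step k)
    let ?Y = "(1 / 2 ^ Suc k) *\<^sub>R X"
    have "?Y \<in> ball 0 \<rho>"
      using scaled_in_ball scale_large_mono[OF k0(1)] step(1) by (meson le_SucI)
    then have "E (2 *\<^sub>R ?Y) = E ?Y \<otimes> E ?Y" by (rule E_square)
    moreover have "2 *\<^sub>R ?Y = (1 / 2 ^ k) *\<^sub>R X" by simp
    ultimately have "E ((1 / 2 ^ k) *\<^sub>R X) = E ?Y [^] (2 :: nat)"
      by (simp add: numeral_2_eq_2)
    then have "E ((1 / 2 ^ k) *\<^sub>R X) [^] (2 ^ k :: nat) = E ?Y [^] (2 ^ Suc k :: nat)"
      by (simp add: nat_pow_pow)
    with step show ?case by simp
  qed simp
  then show ?thesis by (simp add: Exp_def k0_def Let_def)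
qed

lemma Exp_eq_E: "X \<in> ball 0 \<rho> \<Longrightarrow> Exp X = E X"
  using Exp_eq[of X 0] by (simp add: nat_pow_Suc)

lemma Exp_double: "Exp (2 *\<^sub>R X) = Exp X \<otimes> Exp X"
proof -
  obtain k where k: "norm X < 2 ^ k * \<rho>" using scale_large by blast
  let ?e = "E ((1 / 2 ^ k) *\<^sub>R X)"
  have "norm (2 *\<^sub>R X) < 2 ^ Suc k * \<rho>" using k by simp
  from Exp_eq[OF this] have "Exp (2 *\<^sub>R X) = ?e [^] (2 ^ Suc k :: nat)" by simp
  also have "\<dots> = ?e [^] (2 ^ k + 2 ^ k :: nat)" by (simp add: mult_2)
  also have "\<dots> = ?e [^] (2 ^ k :: nat) \<otimes> ?e [^] (2 ^ k :: nat)" by (simp add: nat_pow_mult)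
  finally show ?thesis by (simp add: Exp_eq[OF k])
qed

text \<open>At a common scale the two factors commute, because the bracket with \<open>z\<close>
  vanishes, and powers distribute over products of commuting elements.\<close>

lemma Exp_add_central:
  assumes "\<And>y. br z y = 0"
  shows "Exp (x + z) = Exp x \<otimes> Exp z" "Exp (x + z) = Exp z \<otimes> Exp x"
proof -
  obtain k1 k2 k3 where k: "norm x < 2 ^ k1 * \<rho>" "norm z < 2 ^ k2 * \<rho>" "norm (x + z) < 2 ^ k3 * \<rho>"
    using scale_large by meson
  define k where "k = max k1 (max k2 k3)"
  have k: "norm x < 2 ^ k * \<rho>" "norm z < 2 ^ k * \<rho>" "norm (x + z) < 2 ^ k * \<rho>"
    using scale_large_mono[of _ _ k] k unfolding k_def by (meson max.cobounded1 max.cobounded2 order_trans)+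
  let ?c = "1 / 2 ^ k :: real"
  have cz: "br (?c *\<^sub>R z) y = 0" for y using assms by (simp add: br.scaleR_left)
  have "E (?c *\<^sub>R (x + z)) = E (?c *\<^sub>R x) \<otimes> E (?c *\<^sub>R z)"
    using E_bch[OF scaled_in_ball scaled_in_ball, OF k(1,2)] bch_central(2)[OF cz] by (simp add: scaleR_add_right)
  moreover have "E (?c *\<^sub>R (x + z)) = E (?c *\<^sub>R z) \<otimes> E (?c *\<^sub>R x)"
    using E_bch[OF scaled_in_ball scaled_in_ball, OF k(2,1)] bch_central(1)[OF cz] by (simp add: scaleR_add_right add.commute)
  ultimately show "Exp (x + z) = Exp x \<otimes> Exp z" "Exp (x + z) = Exp z \<otimes> Exp x"
    using Exp_eq[OF k(1)] Exp_eq[OF k(2)] Exp_eq[OF k(3)]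
      pow_mult_distrib[of "E (?c *\<^sub>R x)" "E (?c *\<^sub>R z)"] pow_mult_distrib[of "E (?c *\<^sub>R z)" "E (?c *\<^sub>R x)"]
    by simp_all
qed

text \<open>\<open>Exp_eq_E\<close> identifies \<open>Exp\<close> with \<open>E\<close> inside the
  ball only, so products of small vectors have to be kept there.\<close>

lemma bch_small: "\<exists>r>0. r \<le> \<rho> \<and> (\<forall>x\<in>ball 0 r. \<forall>y\<in>ball 0 r. x \<star> y \<in> ball 0 \<rho>)"
proof -
  have "isCont (\<lambda>p. fst p \<star> snd p) (0, 0)"
    by (intro continuous_on_interior[of UNIV]) (auto intro!: continuous_intros)
  then have "\<exists>d>0. \<forall>p. dist p (0, 0) < d \<longrightarrow> dist (fst p \<star> snd p) (fst (0, 0) \<star> snd (0, 0)) < \<rho>"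
    using radius_pos by (simp add: continuous_at_eps_delta)
  then obtain d where d: "d > 0" "\<And>x y. dist (x, y) (0, 0) < d \<Longrightarrow> norm (x \<star> y) < \<rho>"
    by auto
  have "x \<star> y \<in> ball 0 \<rho>" if "x \<in> ball 0 (min \<rho> (d / 2))" "y \<in> ball 0 (min \<rho> (d / 2))" for x y
  proof -
    have "norm (x, y) \<le> norm x + norm y" by (rule norm_Pair_le)
    then have "dist (x, y) (0, 0) < d" using that by (simp add: dist_norm)
    then show ?thesis using d by simp
  qed
  then show ?thesis using d radius_pos by (intro exI[of _ "min \<rho> (d / 2)"]) auto
qed

text \<open>With \<open>x = X / 2\<close>, \<open>y = Y / 2\<close> the product \<open>Exp X \<otimes> Exp Y = (Exp x)\<^sup>2 \<otimes> (Exp y)\<^sup>2\<close> is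
  reordered at the cost of the central factor \<open>Exp [x, y]\<close>.\<close>

lemma Exp_bch_double:
  assumes R: "\<And>x y. norm x < R \<Longrightarrow> norm y < R \<Longrightarrow> Exp (x \<star> y) = Exp x \<otimes> Exp y"
    and X: "norm X < 2 * R" and Y: "norm Y < 2 * R"
  shows "Exp (X \<star> Y) = Exp X \<otimes> Exp Y"
proof -
  define x y where "x = (1/2) *\<^sub>R X" and "y = (1/2) *\<^sub>R Y"
  have XY: "X = 2 *\<^sub>R x" "Y = 2 *\<^sub>R y" by (simp_all add: x_def y_def)
  have xy: "norm x < R" "norm y < R" using X Y by (simp_all add: x_def y_def)
  define k where "k = br x y"
  have ck: "br k w = 0" for w by (simp add: k_def bracket_nilpotent)
  have "x \<star> y = y \<star> x + k"
    using bracket_antisym[of y x] by (simp add: bch_def k_def algebra_simps flip: scaleR_2)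
  then have swap: "Exp x \<otimes> Exp y = Exp y \<otimes> Exp x \<otimes> Exp k"
    using R[OF xy] R[OF xy(2,1)] Exp_add_central(1)[OF ck] by simp
  have "Exp X \<otimes> Exp Y = Exp x \<otimes> (Exp x \<otimes> Exp y) \<otimes> Exp y"
    by (simp add: XY Exp_double m_assoc)
  also have "\<dots> = Exp x \<otimes> (Exp y \<otimes> Exp x) \<otimes> (Exp k \<otimes> Exp y)"
    by (simp add: swap m_assoc)
  also have "Exp k \<otimes> Exp y = Exp y \<otimes> Exp k"
    using Exp_add_central[OF ck, of y] by simp
  also have "Exp x \<otimes> (Exp y \<otimes> Exp x) \<otimes> (Exp y \<otimes> Exp k) = (Exp x \<otimes> Exp y) \<otimes> (Exp x \<otimes> Exp y) \<otimes> Exp k"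
    by (simp add: m_assoc)
  also have "\<dots> = Exp (2 *\<^sub>R (x \<star> y) + k)"
    by (simp add: R[OF xy, symmetric] Exp_double[symmetric] Exp_add_central(1)[OF ck])
  also have "2 *\<^sub>R (x \<star> y) + k = X \<star> Y"
    by (simp add: XY bch_def k_def br.scaleR_left br.scaleR_right scaleR_add_right flip: scaleR_2)
  finally show ?thesis by simp
qed

text \<open>Each use of \<open>Exp_bch_double\<close> doubles the radius on which the homomorphism
  law holds; the starting radius comes from \<open>bch_small\<close>.\<close>

lemma Exp_bch: "Exp (X \<star> Y) = Exp X \<otimes> Exp Y"
proof -
  obtain r where r: "r > 0" "r \<le> \<rho>" "\<And>x y. x \<in> ball 0 r \<Longrightarrow> y \<in> ball 0 r \<Longrightarrow> x \<star> y \<in> ball 0 \<rho>"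
    using bch_small by blast
  have small: "Exp (x \<star> y) = Exp x \<otimes> Exp y" if "norm x < r" "norm y < r" for x y
    using that r by (simp add: Exp_eq_E E_bch)
  have *: "norm x < 2 ^ n * r \<Longrightarrow> norm y < 2 ^ n * r \<Longrightarrow> Exp (x \<star> y) = Exp x \<otimes> Exp y" for n x y
  proof (induction n arbitrary: x y)
    case (Suc n)
    then show ?case using Exp_bch_double[OF Suc.IH, where X=x and Y=y] by simp
  qed (simp add: small)
  obtain n where "(norm X + norm Y) / r < 2 ^ n"
    using real_arch_pow[of 2 "(norm X + norm Y) / r"] by auto
  then have "norm X + norm Y < 2 ^ n * r" using r by (simp add: field_simps)
  then show ?thesis
    using norm_ge_zero[of X] norm_ge_zero[of Y] by (intro *[of _ n]) linarith+
qed

lemma Exp_0 [simp]: "Exp 0 = \<one>"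
  using Exp_bch[of 0 0] by simp

lemma Exp_minus: "Exp (- X) = inv (Exp X)"
  using Exp_bch[of "- X" X] by (simp add: inv_equality)

lemma Exp_minus_bch: "Exp ((- X) \<star> Y) = inv (Exp X) \<otimes> Exp Y"
  by (simp add: Exp_bch Exp_minus)

lemma open_bch_ball: "open {Y. (- X) \<star> Y \<in> ball 0 \<rho>}"
  by (intro open_Collect_mem_continuous open_ball continuous_intros)

text \<open>Near \<open>X\<close> the map is a left translate of \<open>E\<close>, since
  \<open>Exp Y = Exp X \<otimes> E ((- X) \<star> Y)\<close> there.\<close>

lemma continuous_Exp: "continuous_on S Exp"
proof -
  have "isCont Exp X" for X
  proof -
    let ?U = "{Y. (- X) \<star> Y \<in> ball 0 \<rho>}"
    have "continuous_on ?U (\<lambda>Y. Exp X \<otimes> E ((- X) \<star> Y))"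
      by (intro continuous_on_mult continuous_on_const continuous_on_compose2[OF continuous_E])
        (auto intro!: continuous_intros)
    moreover have "Exp X \<otimes> E ((- X) \<star> Y) = Exp Y" if "Y \<in> ?U" for Y
      using that Exp_minus_bch[of X Y] by (simp add: Exp_eq_E flip: m_assoc)
    ultimately have "continuous_on ?U Exp" by (metis (no_types, lifting) continuous_on_eq)
    moreover have "X \<in> ?U" using radius_pos by simp
    ultimately show ?thesis using open_bch_ball continuous_on_eq_continuous_at by blast
  qed
  then show ?thesis by (simp add: continuous_at_imp_continuous_on)
qed

section \<open>Bijectivity for a simply connected group\<close>

lemma path_connected_group: "\<exists>g. path g \<and> pathstart g = p \<and> pathfinish g = (q :: 'g)"
proof -
  \<comment> \<open>\<open>simply_connected\<close> speaks of free homotopies of loops, so even two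
    constant loops are homotopic, and the track of a base point joins \<open>p\<close> to
    \<open>q\<close>.\<close>
  have "homotopic_loops UNIV (\<lambda>_::real. p) (\<lambda>_. q)"
    using simply_connected unfolding simply_connected_def path_def pathstart_def pathfinish_def by simp
  then obtain h where h: "continuous_on ({0..1::real} \<times> {0..1::real}) h"
    "\<And>x. x \<in> {0..1} \<Longrightarrow> h (0, x) = p" "\<And>x. x \<in> {0..1} \<Longrightarrow> h (1, x) = q"
    unfolding homotopic_loops by auto
  have "path (\<lambda>t. h (t, 0))"
    unfolding path_def by (intro continuous_on_compose2[OF h(1)] continuous_intros) auto
  then show ?thesis
    using h by (intro exI[of _ "\<lambda>t. h (t, 0)"]) (simp add: pathstart_def pathfinish_def)
qed

lemma connected_group: "connected (UNIV :: 'g set)"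
  by (rule path_connected_imp_connected) (use path_connected_group in \<open>auto simp: path_connected_def\<close>)

text \<open>The range is an open subgroup of a connected group: both it and its complement are
  unions of translates of the open image of the small ball.\<close>

lemma surj_Exp: "range Exp = UNIV"
proof -
  let ?\<Omega> = "E ` ball 0 \<rho>"
  have sub: "Exp X \<otimes> w \<in> range Exp" if "w \<in> ?\<Omega>" for X w
    using that Exp_eq_E Exp_bch by (metis (no_types, lifting) image_iff rangeI)
  have one: "\<one> \<in> ?\<Omega>"
    using radius_pos Exp_eq_E[of 0] by (metis Exp_0 centre_in_ball imageI)
  have tr: "p \<in> (\<lambda>x. p \<otimes> x) ` ?\<Omega>" for p
    using one by (metis carrier_UNIV image_eqI r_one UNIV_I)
  have "open (\<Union>p\<in>range Exp. (\<lambda>x. p \<otimes> x) ` ?\<Omega>)"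
    using left_translate_open[OF open_E] by blast
  moreover have "(\<Union>p\<in>range Exp. (\<lambda>x. p \<otimes> x) ` ?\<Omega>) = range Exp"
    by (intro equalityI UN_least image_subsetI) (use sub in auto, use tr in fast)
  ultimately have 1: "open (range Exp)" by simp
  have "open (\<Union>p\<in>- range Exp. (\<lambda>x. p \<otimes> x) ` ?\<Omega>)"
    using left_translate_open[OF open_E] by blast
  moreover have "p \<otimes> w \<notin> range Exp" if pw: "p \<notin> range Exp" "w \<in> ?\<Omega>" for p w
  proof
    assume "p \<otimes> w \<in> range Exp"
    then obtain X where X: "p \<otimes> w = Exp X" by auto
    obtain Y where Y: "w = Exp Y" using pw(2) Exp_eq_E by (metis imageE)
    have "p = (p \<otimes> w) \<otimes> inv w" by (simp add: m_assoc)
    also have "\<dots> = Exp (X \<star> (- Y))" by (simp add: Exp_bch Exp_minus flip: X Y)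
    finally show False using pw(1) by blast
  qed
  then have "(\<Union>p\<in>- range Exp. (\<lambda>x. p \<otimes> x) ` ?\<Omega>) = - range Exp"
    by (intro equalityI UN_least image_subsetI) (auto, use tr in fast)
  ultimately have 2: "open (- range Exp)" by simp
  show ?thesis
    using connectedD[OF connected_group 1 2] by blast
qed

lemma Exp_kernel_small: "X \<in> ball 0 \<rho> \<Longrightarrow> Exp X = \<one> \<Longrightarrow> X = 0"
  using inj_onD[OF inj_E, of X 0] Exp_eq_E[of X] Exp_eq_E[of 0] radius_pos by simp

text \<open>The kernel is discrete, since its only element in the small ball is \<open>0\<close>; a
  continuous map into it is locally constant.\<close>

lemma Exp_kernel_constant:
  fixes f :: "'t::topological_space \<Rightarrow> 'a"
  assumes "connected S" "continuous_on S f" "\<And>s. s \<in> S \<Longrightarrow> Exp (f s) = \<one>" "s \<in> S" "t \<in> S"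
  shows "f s = f t"
proof -
  have "\<forall>x\<in>S. eventually (\<lambda>y. f x = f y) (at x within S)"
  proof
    fix x assume x: "x \<in> S"
    have "f x \<in> {Y. (- f x) \<star> Y \<in> ball 0 \<rho>}" using radius_pos by simp
    moreover have "(f \<longlongrightarrow> f x) (at x within S)"
      using assms(2) x by (simp add: continuous_on_def)
    ultimately have "eventually (\<lambda>y. f y \<in> {Y. (- f x) \<star> Y \<in> ball 0 \<rho>}) (at x within S)"
      using open_bch_ball topological_tendstoD by blast
    moreover have "eventually (\<lambda>y. y \<in> S) (at x within S)"
      by (simp add: eventually_at_filter)
    ultimately show "eventually (\<lambda>y. f x = f y) (at x within S)"
    proof eventually_elim
      case (elim y)
      then have "Exp ((- f x) \<star> f y) = \<one>"
        using assms(3)[OF x] assms(3)[of y] by (simp add: Exp_minus_bch)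
      then have "(- f x) \<star> f y = 0" using elim Exp_kernel_small by blast
      then show ?case using bch_minus_cancel(1)[of "f x" "f y"] by simp
    qed
  qed
  then show ?thesis using connected_local_const[OF assms(1,4,5)] by blast
qed

text \<open>Uniform continuity for maps into a group without a metric: \<open>\<delta>\<close> is a
  Lebesgue number of a cover of \<open>K\<close> by sets on which all quotients stay in the given
  neighborhood of \<open>\<one>\<close>.\<close>

lemma uniform_translates:
  fixes h :: "'t::metric_space \<Rightarrow> 'g"
  assumes "compact K" "continuous_on K h"
  shows "\<exists>\<delta>>0. \<forall>x\<in>K. \<forall>y\<in>K. dist x y < \<delta> \<longrightarrow> inv (h x) \<otimes> h y \<in> E ` ball 0 \<rho>"
proof -
  let ?\<Omega> = "E ` ball 0 \<rho>"
  have one: "\<one> \<in> ?\<Omega>"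
    using radius_pos Exp_eq_E[of 0] by (metis Exp_0 centre_in_ball imageI)
  have "continuous_on (K \<times> K) (\<lambda>q. inv (h (fst q)) \<otimes> h (snd q))"
    by (intro continuous_on_mult continuous_on_inv continuous_on_compose2[OF assms(2)] continuous_intros) auto
  from continuous_on_open_invariant[THEN iffD1, OF this, rule_format, OF open_E]
  obtain O' where O': "open O'" "O' \<inter> (K \<times> K) = (\<lambda>q. inv (h (fst q)) \<otimes> h (snd q)) -` ?\<Omega> \<inter> (K \<times> K)"
    by blast
  have "\<exists>A. open A \<and> x \<in> A \<and> A \<times> A \<subseteq> O'" if "x \<in> K" for x
  proof -
    have "(x, x) \<in> O'" using O'(2) that one by auto
    then obtain A B where "open A" "open B" "(x, x) \<in> A \<times> B" "A \<times> B \<subseteq> O'"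
      using O'(1) open_prod_elim by blast
    then show ?thesis by (intro exI[of _ "A \<inter> B"]) auto
  qed
  then obtain A where A: "\<And>x. x \<in> K \<Longrightarrow> open (A x) \<and> x \<in> A x \<and> A x \<times> A x \<subseteq> O'" by metis
  have "K \<subseteq> \<Union> (A ` K)" using A by blast
  then obtain e where e: "e > 0" "\<And>x. x \<in> K \<Longrightarrow> \<exists>G\<in>A ` K. ball x e \<subseteq> G"
    using Heine_Borel_lemma[OF assms(1), of "A ` K"] A by blast
  have "inv (h x) \<otimes> h y \<in> ?\<Omega>" if xy: "x \<in> K" "y \<in> K" "dist x y < e" for x y
  proof -
    obtain z where z: "z \<in> K" "ball x e \<subseteq> A z" using e(2)[OF xy(1)] by blast
    have "x \<in> A z" "y \<in> A z" using z(2) xy e(1) by auto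
    then have "(x, y) \<in> O' \<inter> (K \<times> K)" using A[OF z(1)] xy by blast
    then show ?thesis using O'(2) by auto
  qed
  then show ?thesis using e(1) by blast
qed

text \<open>A lift of \<open>h\<close> along \<open>Exp\<close> is obtained without patching: on a star-shaped compact set,
  \<open>h x\<close> is the product of the factors \<open>(h (i x / n))\<^sup>-\<^sup>1 \<otimes> h ((i + 1) x / n)\<close>, which for large \<open>n\<close>
  all lie in the image of the local exponential map.\<close>

lemma Exp_lift:
  fixes h :: "'t::real_normed_vector \<Rightarrow> 'g"
  assumes K: "compact K" "\<And>x t. x \<in> K \<Longrightarrow> 0 \<le> t \<Longrightarrow> t \<le> 1 \<Longrightarrow> t *\<^sub>R x \<in> K"
    and h: "continuous_on K h" "h 0 = \<one>"
  obtains H where "continuous_on K H" "\<And>x. x \<in> K \<Longrightarrow> Exp (H x) = h x"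
proof -
  obtain \<delta> where \<delta>: "\<delta> > 0" "\<And>x y. x \<in> K \<Longrightarrow> y \<in> K \<Longrightarrow> dist x y < \<delta> \<Longrightarrow> inv (h x) \<otimes> h y \<in> E ` ball 0 \<rho>"
    using uniform_translates[OF K(1) h(1)] by blast
  obtain B where B: "B > 0" "\<And>x. x \<in> K \<Longrightarrow> norm x \<le> B"
    using compact_imp_bounded[OF K(1)] bounded_pos by blast
  obtain n :: nat where n: "B / \<delta> < real n" using reals_Archimedean2 by blast
  have n0: "n > 0" using n B \<delta> by (cases n) (auto simp: field_simps not_less)
  let ?p = "\<lambda>i x. (real i / real n) *\<^sub>R x"
  have pK: "?p i x \<in> K" if "x \<in> K" "i \<le> n" for i x using K(2) that n0 by simp
  have "\<exists>H. continuous_on K H \<and> (\<forall>x\<in>K. Exp (H x) = h (?p i x))" if "i \<le> n" for i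
    using that
  proof (induction i)
    case 0
    then show ?case using h by (intro exI[of _ "\<lambda>_. 0"]) auto
  next
    case (Suc i)
    then obtain H where H: "continuous_on K H" "\<And>x. x \<in> K \<Longrightarrow> Exp (H x) = h (?p i x)" by auto
    let ?q = "\<lambda>x. inv (h (?p i x)) \<otimes> h (?p (Suc i) x)"
    let ?L = "inv_into (ball 0 \<rho>) E"
    have q: "?q x \<in> E ` ball 0 \<rho>" if "x \<in> K" for x
    proof (rule \<delta>(2))
      have eq: "?p (Suc i) x - ?p i x = (1 / real n) *\<^sub>R x"
        by (simp only: of_nat_Suc add_divide_distrib scaleR_left_distrib) simp
      have "dist (?p i x) (?p (Suc i) x) = norm (?p (Suc i) x - ?p i x)"
        by (metis dist_norm dist_commute)
      also have "\<dots> = norm x / n" unfolding eq by simp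
      also have "\<dots> \<le> B / n" using B that by (simp add: divide_right_mono)
      also have "\<dots> < \<delta>" using n n0 \<delta>(1) by (simp add: field_simps)
      finally show "dist (?p i x) (?p (Suc i) x) < \<delta>" .
    qed (use pK[OF that, of i] pK[OF that, of "Suc i"] Suc.prems in auto)
    have ch: "continuous_on K (\<lambda>x. h (?p j x))" if "j \<le> n" for j
      by (intro continuous_on_compose2[OF h(1)] continuous_intros) (use pK that in auto)
    have "continuous_on K ?q" using Suc.prems by (intro continuous_on_mult continuous_on_inv ch) auto
    then have "continuous_on K (\<lambda>x. H x \<star> ?L (?q x))"
      using q by (intro continuous_on_bch H continuous_on_compose2[OF continuous_E_inverse]) auto
    moreover have "Exp (H x \<star> ?L (?q x)) = h (?p (Suc i) x)" if "x \<in> K" for x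
    proof -
      have "?L (?q x) \<in> ball 0 \<rho>" using inv_into_into[OF q[OF that]] .
      then have "Exp (?L (?q x)) = ?q x" using f_inv_into_f[OF q[OF that]] Exp_eq_E by simp
      then show ?thesis using that by (simp add: Exp_bch H flip: m_assoc)
    qed
    ultimately show ?case by blast
  qed
  from this[of n] obtain H where "continuous_on K H" "\<forall>x\<in>K. Exp (H x) = h (?p n x)" by auto
  then show ?thesis using that n0 by auto
qed

text \<open>The curve \<open>Exp (t *\<^sub>R d)\<close> is a loop. A free homotopy contracting it
  lifts to the square, and comparing the lift on the sides shows that the lifted loop closes; yet
  that lift is a translate of the segment from \<open>0\<close> to \<open>d\<close>.\<close>

lemma Exp_kernel: "Exp d = \<one> \<Longrightarrow> d = 0"
proof -
  assume d: "Exp d = \<one>"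
  let ?I = "{0..1::real}"
  have "path (\<lambda>t. Exp (t *\<^sub>R d))" "path (\<lambda>_::real. \<one>)"
    unfolding path_def by (auto intro!: continuous_on_compose2[OF continuous_Exp[of UNIV]] continuous_intros)
  moreover have "pathfinish (\<lambda>t. Exp (t *\<^sub>R d)) = pathstart (\<lambda>t. Exp (t *\<^sub>R d))"
    "pathfinish (\<lambda>_::real. \<one>) = pathstart (\<lambda>_::real. \<one>)"
    by (simp_all add: pathfinish_def pathstart_def d)
  ultimately have "homotopic_loops UNIV (\<lambda>t. Exp (t *\<^sub>R d)) (\<lambda>_::real. \<one>)"
    using simply_connected unfolding simply_connected_def by blast
  then obtain h where h: "continuous_on (?I \<times> ?I) h"
    and h0: "\<And>x. x \<in> ?I \<Longrightarrow> h (0, x) = Exp (x *\<^sub>R d)" and h1: "\<And>x. x \<in> ?I \<Longrightarrow> h (1, x) = \<one>"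
    and loop: "\<And>t. t \<in> ?I \<Longrightarrow> h (t, 1) = h (t, 0)"
    unfolding homotopic_loops by (auto simp: pathstart_def pathfinish_def)
  have 1: "compact (?I \<times> ?I)" by (intro compact_Times) auto
  have 2: "t *\<^sub>R x \<in> ?I \<times> ?I" if "x \<in> ?I \<times> ?I" "0 \<le> t" "t \<le> 1" for x t
    using that by (auto simp: mem_Times_iff mult_le_one)
  have 3: "h 0 = \<one>" using h0[of 0] by (simp add: zero_prod_def)
  from Exp_lift[OF 1 2 h 3] obtain H
    where H: "continuous_on (?I \<times> ?I) H" "\<And>x. x \<in> ?I \<times> ?I \<Longrightarrow> Exp (H x) = h x"
    by blast
  have cont: "continuous_on ?I (\<lambda>t. H (f t, g t))"
    if "continuous_on ?I f" "continuous_on ?I g" "\<And>t. t \<in> ?I \<Longrightarrow> f t \<in> ?I" "\<And>t. t \<in> ?I \<Longrightarrow> g t \<in> ?I" for f g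
    by (rule continuous_on_compose2[OF H(1) continuous_on_Pair[OF that(1,2)]]) (use that(3,4) in blast)
  \<comment> \<open>On the edge where the homotopy is constant the lift takes values in the
    kernel.\<close>
  have "H (1, 0) = H (1, 1)"
    by (rule Exp_kernel_constant[of ?I "\<lambda>t. H (1, t)"]) (auto simp: H(2) h1 intro!: cont continuous_intros)
  \<comment> \<open>The two other sides carry the same curve, so their lifts differ by a kernel
    element that cannot vary.\<close>
  moreover have "(- H (0, 0)) \<star> H (0, 1) = (- H (1, 0)) \<star> H (1, 1)"
    by (rule Exp_kernel_constant[of ?I "\<lambda>s. (- H (s, 0)) \<star> H (s, 1)"])
      (auto simp: Exp_minus_bch H(2) loop intro!: continuous_on_bch continuous_on_minus cont continuous_intros)
  ultimately have "H (0, 1) = H (0, 0)"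
    using bch_minus_cancel(1)[of "H (0, 0)" "H (0, 1)"] by simp
  moreover have "(- (0 *\<^sub>R d)) \<star> H (0, 0) = (- (1 *\<^sub>R d)) \<star> H (0, 1)"
    by (rule Exp_kernel_constant[of ?I "\<lambda>t. (- (t *\<^sub>R d)) \<star> H (0, t)"])
      (auto simp: Exp_minus_bch H(2) h0 intro!: continuous_on_bch continuous_on_minus cont continuous_intros)
  ultimately have "H (0, 0) = (- d) \<star> H (0, 0)" by simp
  then have "H (0, 0) \<star> (- H (0, 0)) = (- d) \<star> (H (0, 0) \<star> (- H (0, 0)))"
    by (metis bch_assoc)
  then show "d = 0" by simp
qed

lemma bij_Exp: "bij Exp"
proof (rule bijI)
  show "inj Exp"
  proof (rule injI)
    fix x y assume "Exp x = Exp y"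
    then have "Exp ((- x) \<star> y) = \<one>" by (simp add: Exp_minus_bch)
    then have "(- x) \<star> y = 0" by (rule Exp_kernel)
    then show "x = y" using bch_minus_cancel(1)[of x y] by simp
  qed
qed (rule surj_Exp)

end

section \<open>Lie groups in charts\<close>

locale lie_grp =
  fixes N :: "('g::{t2_space, second_countable_topology}, 'a::euclidean_space) lie_structure" (structure)
  assumes lie_group: "lie_group N"
begin

sublocale group N
  using lie_group unfolding lie_group_def by blast

lemma carrier_eq_UNIV [simp]: "carrier N = UNIV"
  using lie_group unfolding lie_group_def by blast

abbreviation "A \<equiv> atlas N"
abbreviation "b \<equiv> base N"
abbreviation "e \<equiv> snd b \<one>"

definition im :: "('g, 'a) chart \<Rightarrow> 'a set" where
  "im c = snd c ` fst c"

lemma base_in_atlas [simp]: "b \<in> A" and one_in_base [simp]: "\<one> \<in> fst b"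
  using lie_group unfolding lie_group_def by blast+

lemma chart_cover: "\<exists>c\<in>A. p \<in> fst c"
  using lie_group unfolding lie_group_def smooth_atlas_def by blast

lemma
  assumes "c \<in> A"
  shows open_chart_domain: "open (fst c)" and open_im: "open (im c)"
    and homeomorphism_chart: "homeomorphism (fst c) (im c) (snd c) (chart_inv c)"
  using assms lie_group unfolding lie_group_def smooth_atlas_def is_chart_def im_def by blast+

lemma
  assumes "c \<in> A"
  shows chart_inv_mem: "y \<in> im c \<Longrightarrow> chart_inv c y \<in> fst c"
    and chart_chart_inv: "y \<in> im c \<Longrightarrow> snd c (chart_inv c y) = y"
    and chart_inv_chart: "p \<in> fst c \<Longrightarrow> chart_inv c (snd c p) = p"
    and chart_mem: "p \<in> fst c \<Longrightarrow> snd c p \<in> im c"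
    and continuous_chart: "continuous_on (fst c) (snd c)"
    and continuous_chart_inv: "continuous_on (im c) (chart_inv c)"
  using homeomorphism_chart[OF assms] unfolding homeomorphism_def by auto

lemma e_in_im [simp]: "e \<in> im b" by (simp add: chart_mem)
lemma chart_inv_e [simp]: "chart_inv b e = \<one>" by (simp add: chart_inv_chart)

lemma continuous_mult: "continuous_on UNIV (\<lambda>(x, y). x \<otimes> y)"
  and continuous_inv: "continuous_on UNIV (\<lambda>x. inv x)"
  using lie_group unfolding lie_group_def smooth_map_def by blast+

lemma continuous_on_mult:
  assumes "continuous_on S f" "continuous_on S g"
  shows "continuous_on S (\<lambda>x. f x \<otimes> g x)"
  using continuous_on_compose2[OF continuous_mult continuous_on_Pair[OF assms]] by simp

section \<open>Multiplication and left translations in charts\<close>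

definition mdom :: "('g, 'a) chart \<Rightarrow> ('g, 'a) chart \<Rightarrow> ('g, 'a) chart \<Rightarrow> ('a \<times> 'a) set" where
  "mdom c d k = {q \<in> im c \<times> im d. chart_inv c (fst q) \<otimes> chart_inv d (snd q) \<in> fst k}"

definition mult_chart :: "('g, 'a) chart \<Rightarrow> ('g, 'a) chart \<Rightarrow> ('g, 'a) chart \<Rightarrow> 'a \<times> 'a \<Rightarrow> 'a" where
  "mult_chart c d k q = snd k (chart_inv c (fst q) \<otimes> chart_inv d (snd q))"

lemma
  assumes c: "c \<in> A" and d: "d \<in> A"
  shows continuous_mult_chart_inv:
    "continuous_on (im c \<times> im d) (\<lambda>q. chart_inv c (fst q) \<otimes> chart_inv d (snd q))"
  by (intro continuous_on_mult continuous_on_compose2[OF continuous_chart_inv[OF c] continuous_on_fst[OF continuous_on_id]]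
      continuous_on_compose2[OF continuous_chart_inv[OF d] continuous_on_snd[OF continuous_on_id]]) auto

lemma open_mdom:
  assumes c: "c \<in> A" and d: "d \<in> A" and k: "k \<in> A"
  shows "open (mdom c d k)"
proof -
  have "mdom c d k = (\<lambda>q. chart_inv c (fst q) \<otimes> chart_inv d (snd q)) -` fst k \<inter> (im c \<times> im d)"
    by (auto simp: mdom_def)
  moreover have "open (im c \<times> im d)" using c d open_im by (simp add: open_Times)
  from continuous_on_open_vimage[OF this, THEN iffD1, OF continuous_mult_chart_inv[OF c d], rule_format,
      OF open_chart_domain[OF k]]
  have "open ((\<lambda>q. chart_inv c (fst q) \<otimes> chart_inv d (snd q)) -` fst k \<inter> (im c \<times> im d))" .
  ultimately show ?thesis by simp
qed

text \<open>Smoothness for \<open>prod_atlas\<close> made explicit. The inverse of a product chart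
  is the pair of inverses only on its image, hence the final congruence.\<close>

lemma smooth_mult_chart:
  assumes c: "c \<in> A" and d: "d \<in> A" and k: "k \<in> A"
  shows "smooth_on (mdom c d k) (mult_chart c d k)"
proof -
  let ?cd = "(fst c \<times> fst d, map_prod (snd c) (snd d))"
  have cd: "?cd \<in> prod_atlas A A" using c d unfolding prod_atlas_def by blast
  have injcd: "inj_on (map_prod (snd c) (snd d)) (fst c \<times> fst d)"
    using chart_inv_chart[OF c] chart_inv_chart[OF d] by (intro map_prod_inj_on) (metis inj_on_inverseI)+
  have inv: "chart_inv ?cd q = (chart_inv c (fst q), chart_inv d (snd q))" if "q \<in> im c \<times> im d" for q
    unfolding chart_inv_def[of ?cd] fst_conv snd_conv
    by (rule inv_into_f_eq[OF _ _ , of "map_prod (snd c) (snd d)" "fst c \<times> fst d"])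
      (use that injcd in \<open>auto simp: chart_inv_mem[OF c] chart_inv_mem[OF d] chart_chart_inv[OF c] chart_chart_inv[OF d]\<close>)
  have dom: "snd ?cd ` (fst ?cd \<inter> (\<lambda>(x, y). x \<otimes> y) -` fst k) = mdom c d k"
  proof (rule equalityI; rule subsetI)
    fix q assume "q \<in> mdom c d k"
    then have "q = map_prod (snd c) (snd d) (chart_inv c (fst q), chart_inv d (snd q))"
      "(chart_inv c (fst q), chart_inv d (snd q)) \<in> fst ?cd \<inter> (\<lambda>(x, y). x \<otimes> y) -` fst k"
      by (auto simp: mdom_def chart_inv_mem[OF c] chart_inv_mem[OF d] chart_chart_inv[OF c] chart_chart_inv[OF d])
    then show "q \<in> snd ?cd ` (fst ?cd \<inter> (\<lambda>(x, y). x \<otimes> y) -` fst k)"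
      unfolding snd_conv by (rule image_eqI)
  qed (auto simp: mdom_def chart_inv_chart[OF c] chart_inv_chart[OF d] chart_mem[OF c] chart_mem[OF d])
  have "smooth_on (mdom c d k) (snd k \<circ> (\<lambda>(x, y). x \<otimes> y) \<circ> chart_inv ?cd)"
    using lie_group cd k unfolding lie_group_def smooth_map_def dom[symmetric] by blast
  then show ?thesis
    by (rule smooth_on_cong[OF open_mdom[OF c d k], rotated])
      (auto simp: mult_chart_def inv mdom_def)
qed

text \<open>The differential at \<open>q\<close> of left translation by \<open>p\<close>, read in
  \<open>d\<close> near \<open>q\<close> and in \<open>k\<close> near \<open>p \<otimes> q\<close>.
  Both \<open>to_lie\<close> and \<open>from_lie\<close> are instances, so one chain rule serves
  all.\<close>

definition dleft :: "'g \<Rightarrow> ('g, 'a) chart \<Rightarrow> ('g, 'a) chart \<Rightarrow> 'g \<Rightarrow> 'a \<Rightarrow> 'a" where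
  "dleft p d k q = frechet_derivative (\<lambda>y. snd k (p \<otimes> chart_inv d y)) (at (snd d q))"

lemma to_lie_eq_dleft: "to_lie N c p = dleft (inv p) c b p"
  and from_lie_eq_dleft: "from_lie N c p = dleft p b c \<one>"
  by (auto simp: to_lie_def from_lie_def dleft_def)

definition ldom :: "'g \<Rightarrow> ('g, 'a) chart \<Rightarrow> ('g, 'a) chart \<Rightarrow> 'a set" where
  "ldom p d k = {y \<in> im d. p \<otimes> chart_inv d y \<in> fst k}"

lemma left_translation_slice:
  assumes c: "c \<in> A" "p \<in> fst c"
  shows "y \<in> ldom p d k \<longleftrightarrow> (snd c p, y) \<in> mdom c d k"
    and "snd k (p \<otimes> chart_inv d y) = mult_chart c d k (snd c p, y)"
  using assms by (auto simp: ldom_def mdom_def mult_chart_def chart_inv_chart chart_mem)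

text \<open>With \<open>p\<close> fixed in a chart around it, left translation is an affine slice of
  the smooth multiplication.\<close>

lemma
  assumes d: "d \<in> A" and k: "k \<in> A"
  shows open_ldom: "open (ldom p d k)"
    and smooth_left_translation: "smooth_on (ldom p d k) (\<lambda>y. snd k (p \<otimes> chart_inv d y))"
proof -
  obtain c where c: "c \<in> A" "p \<in> fst c" using chart_cover by blast
  have "ldom p d k = {y. (snd c p, y) \<in> mdom c d k}"
    using left_translation_slice(1)[OF c] by blast
  then show op: "open (ldom p d k)"
    using open_Collect_mem_continuous[OF open_mdom[OF c(1) d k], of "\<lambda>y. (snd c p, y)"]
    by (simp add: continuous_on_Pair continuous_on_id continuous_on_const)
  have "bounded_linear (\<lambda>y :: 'a. (0 :: 'a, y))"
    by (intro bounded_linear_Pair bounded_linear_zero bounded_linear_ident)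
  then have "smooth_on (ldom p d k) (\<lambda>y. mult_chart c d k ((0, y) + (snd c p, 0)))"
    by (rule smooth_on_affine[OF op _ _ smooth_mult_chart[OF c(1) d k]])
      (simp add: left_translation_slice(1)[OF c])
  then show "smooth_on (ldom p d k) (\<lambda>y. snd k (p \<otimes> chart_inv d y))"
    by (simp add: left_translation_slice(2)[OF c])
qed

lemma chart_mem_ldom:
  assumes "d \<in> A" "q \<in> fst d" "p \<otimes> q \<in> fst k"
  shows "snd d q \<in> ldom p d k"
  using assms by (simp add: ldom_def chart_mem chart_inv_chart)

lemma dleft_has_derivative:
  assumes "d \<in> A" "k \<in> A" "q \<in> fst d" "p \<otimes> q \<in> fst k"
  shows "((\<lambda>y. snd k (p \<otimes> chart_inv d y)) has_derivative dleft p d k q) (at (snd d q))"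
  unfolding dleft_def
  by (rule smooth_on_imp_has_derivative[OF smooth_left_translation chart_mem_ldom]) (use assms in auto)

lemma linear_dleft:
  assumes "d \<in> A" "k \<in> A" "q \<in> fst d" "p \<otimes> q \<in> fst k"
  shows "linear (dleft p d k q)"
  using dleft_has_derivative[OF assms] has_derivative_linear by blast

text \<open>The chain rule applied to associativity. The relations below between
  \<open>to_lie\<close>, \<open>from_lie\<close> and translations are its instances.\<close>

lemma dleft_chain:
  assumes "d \<in> A" "k \<in> A" "l \<in> A" "q \<in> fst d" "p \<otimes> q \<in> fst k" "p' \<otimes> (p \<otimes> q) \<in> fst l"
  shows "dleft p' k l (p \<otimes> q) (dleft p d k q u) = dleft (p' \<otimes> p) d l q u"
proof -
  have 1: "((\<lambda>y. snd k (p \<otimes> chart_inv d y)) has_derivative dleft p d k q) (at (snd d q))"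
    by (rule dleft_has_derivative) (use assms in auto)
  have 2: "((\<lambda>y. snd l (p' \<otimes> chart_inv k y)) has_derivative dleft p' k l (p \<otimes> q)) (at (snd k (p \<otimes> q)))"
    by (rule dleft_has_derivative) (use assms in auto)
  have 3: "((\<lambda>y. snd l ((p' \<otimes> p) \<otimes> chart_inv d y)) has_derivative dleft (p' \<otimes> p) d l q) (at (snd d q))"
    by (rule dleft_has_derivative) (use assms in \<open>auto simp: m_assoc\<close>)
  have "((\<lambda>y. snd l (p' \<otimes> chart_inv k (snd k (p \<otimes> chart_inv d y)))) has_derivative
      (\<lambda>u. dleft p' k l (p \<otimes> q) (dleft p d k q u))) (at (snd d q))"
    using has_derivative_compose[OF 1, of "\<lambda>y. snd l (p' \<otimes> chart_inv k y)" "dleft p' k l (p \<otimes> q)"] 2 assms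
    by (simp add: chart_inv_chart)
  then have "((\<lambda>y. snd l ((p' \<otimes> p) \<otimes> chart_inv d y)) has_derivative
      (\<lambda>u. dleft p' k l (p \<otimes> q) (dleft p d k q u))) (at (snd d q))"
    by (rule has_derivative_transform_within_open[OF _ open_ldom[of d k p] chart_mem_ldom])
      (use assms in \<open>auto simp: ldom_def chart_inv_chart m_assoc\<close>)
  from has_derivative_unique[OF this 3] show ?thesis by (simp add: fun_eq_iff)
qed

lemma dleft_one:
  assumes "d \<in> A" "q \<in> fst d"
  shows "dleft \<one> d d q u = u"
proof -
  have "((\<lambda>y. snd d (\<one> \<otimes> chart_inv d y)) has_derivative dleft \<one> d d q) (at (snd d q))"
    by (rule dleft_has_derivative) (use assms in auto)
  moreover have "((\<lambda>y. snd d (\<one> \<otimes> chart_inv d y)) has_derivative (\<lambda>u. u)) (at (snd d q))"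
    by (rule has_derivative_transform_within_open[OF has_derivative_ident open_im])
      (use assms in \<open>auto simp: chart_mem chart_chart_inv\<close>)
  ultimately show ?thesis using has_derivative_unique by (metis (no_types, lifting))
qed

lemma to_lie_from_lie:
  assumes "c \<in> A" "p \<in> fst c"
  shows "to_lie N c p (from_lie N c p X) = X"
  using dleft_chain[of b c b \<one> p "inv p" X] assms
  by (simp add: to_lie_eq_dleft from_lie_eq_dleft dleft_one)

lemma from_lie_to_lie:
  assumes "c \<in> A" "p \<in> fst c"
  shows "from_lie N c p (to_lie N c p u) = u"
  using dleft_chain[of c b c p "inv p" p u] assms
  by (simp add: to_lie_eq_dleft from_lie_eq_dleft dleft_one)

lemma linear_to_lie: "c \<in> A \<Longrightarrow> p \<in> fst c \<Longrightarrow> linear (to_lie N c p)"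
  unfolding to_lie_eq_dleft by (rule linear_dleft) auto

lemma linear_from_lie: "c \<in> A \<Longrightarrow> p \<in> fst c \<Longrightarrow> linear (from_lie N c p)"
  unfolding from_lie_eq_dleft by (rule linear_dleft) auto

lemma to_lie_dleft:
  assumes "d \<in> A" "k \<in> A" "q \<in> fst d" "p \<otimes> q \<in> fst k"
  shows "to_lie N k (p \<otimes> q) (dleft p d k q u) = to_lie N d q u"
proof -
  have "inv (p \<otimes> q) \<otimes> p = inv q"
    by (simp add: inv_mult_group m_assoc)
  then show ?thesis
    using dleft_chain[of d k b q p "inv (p \<otimes> q)" u] assms by (simp add: to_lie_eq_dleft)
qed

lemma dleft_from_lie:
  assumes "d \<in> A" "k \<in> A" "q \<in> fst d" "p \<otimes> q \<in> fst k"
  shows "dleft p d k q (from_lie N d q X) = from_lie N k (p \<otimes> q) X"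
  using dleft_chain[of b d k \<one> q p X] assms by (simp add: from_lie_eq_dleft)

lemma from_lie_one [simp]: "from_lie N b \<one> X = X"
  by (simp add: from_lie_eq_dleft dleft_one)

lemma to_lie_one [simp]: "to_lie N b \<one> X = X"
  by (simp add: to_lie_eq_dleft dleft_one)

section \<open>The left-invariant frame and the Maurer--Cartan form\<close>

definition L :: "('g, 'a) chart \<Rightarrow> 'a \<Rightarrow> 'a \<Rightarrow> 'a" where
  "L c x = from_lie N c (chart_inv c x)"

text \<open>The Maurer--Cartan form in coordinates; pointwise it inverts the frame
  \<open>L c x\<close>.\<close>

definition T :: "('g, 'a) chart \<Rightarrow> 'a \<Rightarrow> 'a \<Rightarrow> 'a" where
  "T c x = to_lie N c (chart_inv c x)"

definition DL :: "('g, 'a) chart \<Rightarrow> 'a \<Rightarrow> 'a \<Rightarrow> 'a \<Rightarrow> 'a" where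
  "DL c x X = frechet_derivative (\<lambda>y. L c y X) (at x)"

text \<open>The formula comes from differentiating \<open>L c x (T c x u) = u\<close>. The direction
  of differentiation \<open>v\<close> precedes the argument here, whereas in \<open>DL\<close> it
  follows it.\<close>

definition DT :: "('g, 'a) chart \<Rightarrow> 'a \<Rightarrow> 'a \<Rightarrow> 'a \<Rightarrow> 'a" where
  "DT c x v u = - T c x (DL c x (T c x u) v)"

lemma
  assumes "c \<in> A" "x \<in> im c"
  shows linear_L: "linear (L c x)" and linear_T: "linear (T c x)"
    and T_L: "T c x (L c x u) = u" and L_T: "L c x (T c x u) = u"
  using assms by (auto simp: L_def T_def chart_inv_mem linear_from_lie linear_to_lie to_lie_from_lie from_lie_to_lie)

lemma T_e [simp]: "T b e u = u" and L_e [simp]: "L b e u = u"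
  by (simp_all add: T_def L_def)

text \<open>The frame is the derivative of the multiplication in its second factor at
  \<open>(x, e)\<close>, a point that depends affinely on \<open>x\<close>.\<close>

lemma smooth_L:
  assumes c: "c \<in> A"
  shows "smooth_on (im c) (\<lambda>x. L c x X)"
proof -
  let ?M = "mult_chart c b c"
  have mem: "(x, e) \<in> mdom c b c" if "x \<in> im c" for x
    using that c by (simp add: mdom_def chart_inv_mem)
  have L: "L c x X = frechet_derivative ?M (at ((x, 0) + (0, e))) (0, X)" if x: "x \<in> im c" for x
  proof -
    have "(?M has_derivative frechet_derivative ?M (at (x, e))) (at (x, e))"
      using smooth_on_imp_has_derivative[OF smooth_mult_chart mem] x c by simp
    then have "((\<lambda>y. ?M (x, y)) has_derivative (\<lambda>v. frechet_derivative ?M (at (x, e)) (0, v))) (at e)"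
      by (rule has_derivative_compose[OF has_derivative_Pair[OF has_derivative_const has_derivative_ident]])
    then have "((\<lambda>y. snd c (chart_inv c x \<otimes> chart_inv b y)) has_derivative
        (\<lambda>v. frechet_derivative ?M (at (x, e)) (0, v))) (at e)"
      by (simp add: mult_chart_def)
    from frechet_derivative_at[OF this] show ?thesis
      by (simp add: L_def from_lie_def fun_eq_iff)
  qed
  have "bounded_linear (\<lambda>x :: 'a. (x, 0 :: 'a))"
    by (intro bounded_linear_Pair bounded_linear_zero bounded_linear_ident)
  then have "smooth_on (im c) (\<lambda>x. frechet_derivative ?M (at ((x, 0) + (0, e))) (0, X))"
    by (rule smooth_on_affine[OF open_im[OF c] _ _ smooth_on_frechet_derivative[OF smooth_mult_chart]])
      (use c mem in auto)
  then show ?thesis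
    by (rule smooth_on_cong[OF open_im[OF c], rotated]) (simp add: L)
qed

lemma DL_has_derivative:
  assumes "c \<in> A" "x \<in> im c"
  shows "((\<lambda>y. L c y X) has_derivative DL c x X) (at x)"
  unfolding DL_def by (rule smooth_on_imp_has_derivative[OF smooth_L]) (use assms in auto)

lemma DT_has_derivative:
  assumes "c \<in> A" "x \<in> im c"
  shows "((\<lambda>y. T c y u) has_derivative (\<lambda>v. DT c x v u)) (at x)"
  unfolding DT_def
  by (rule has_derivative_inverse_family[OF open_im[OF assms(1)] assms(2) linear_L T_L L_T])
    (use assms DL_has_derivative in auto)

lemma linear_DL:
  assumes "c \<in> A" "x \<in> im c"
  shows "linear (\<lambda>X. DL c x X v)"
proof (rule linearI)
  fix X Y and r :: real
  have "((\<lambda>y. L c y X + L c y Y) has_derivative (\<lambda>v. DL c x X v + DL c x Y v)) (at x)"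
    by (intro has_derivative_add DL_has_derivative assms)
  then have "((\<lambda>y. L c y (X + Y)) has_derivative (\<lambda>v. DL c x X v + DL c x Y v)) (at x)"
    by (rule has_derivative_transform_within_open[OF _ open_im[OF assms(1)] assms(2)])
      (simp add: linear_add[OF linear_L] assms)
  from has_derivative_unique[OF this DL_has_derivative[OF assms]]
  show "DL c x (X + Y) v = DL c x X v + DL c x Y v" by (simp add: fun_eq_iff)
  have "((\<lambda>y. r *\<^sub>R L c y X) has_derivative (\<lambda>v. r *\<^sub>R DL c x X v)) (at x)"
    by (intro has_derivative_scaleR_right DL_has_derivative assms)
  then have "((\<lambda>y. L c y (r *\<^sub>R X)) has_derivative (\<lambda>v. r *\<^sub>R DL c x X v)) (at x)"
    by (rule has_derivative_transform_within_open[OF _ open_im[OF assms(1)] assms(2)])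
      (simp add: linear_cmul[OF linear_L] assms)
  from has_derivative_unique[OF this DL_has_derivative[OF assms]]
  show "DL c x (r *\<^sub>R X) v = r *\<^sub>R DL c x X v" by (simp add: fun_eq_iff)
qed

lemma continuous_T: "c \<in> A \<Longrightarrow> continuous_on (im c) (\<lambda>x. T c x u)"
  by (intro continuous_at_imp_continuous_on ballI has_derivative_continuous) (rule DT_has_derivative)

lemma continuous_DT:
  assumes c: "c \<in> A"
  shows "continuous_on (im c) (\<lambda>x. DT c x v u)"
proof -
  have "continuous_on (im c) (\<lambda>x. DL c x X v)" for X
    unfolding DL_def
    by (rule smooth_on_imp_continuous_on[OF smooth_on_frechet_derivative[OF smooth_L[OF c]]])
  then have "continuous_on (im c) (\<lambda>x. DL c x (T c x u) v)"
    by (rule continuous_on_linear_family[OF linear_DL[OF c] _ continuous_T[OF c], rotated])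
  then show ?thesis
    unfolding DT_def
    by (intro continuous_on_minus continuous_on_linear_family[OF linear_T[OF c] continuous_T[OF c]])
qed

lemma lie_bracket_eq: "lie_bracket N X Y = DL b e Y X - DL b e X Y"
  by (simp add: lie_bracket_def DL_def L_def Let_def)

lemma bilinear_lie_bracket: "bilinear (lie_bracket N)"
proof -
  have 1: "linear (\<lambda>X. DL b e X v)" for v by (rule linear_DL) auto
  have 2: "linear (DL b e X)" for X
    using DL_has_derivative[of b e X] has_derivative_linear by auto
  show ?thesis
    unfolding bilinear_def lie_bracket_eq by (intro conjI allI linear_compose_sub 1 2)
qed

lemma lie_bracket_antisym: "lie_bracket N Y X = - lie_bracket N X Y"
  by (simp add: lie_bracket_eq)

text \<open>Left-invariant fields are related by the left translation by \<open>p\<close>, so that their Lie bracket at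
  \<open>p\<close> is the image of the one at the identity; the second derivatives of the translation cancel by
  symmetry.\<close>

lemma left_invariant_bracket:
  assumes c: "c \<in> A" and x: "x \<in> im c"
  shows "DL c x Y (L c x X) - DL c x X (L c x Y) = L c x (lie_bracket N X Y)"
proof -
  define p where "p = chart_inv c x"
  have p: "p \<in> fst c" "snd c p = x" using c x by (simp_all add: p_def chart_inv_mem chart_chart_inv)
  define \<psi> where "\<psi> = (\<lambda>y. snd c (p \<otimes> chart_inv b y))"
  define U where "U = ldom p b c"
  have U: "open U" "e \<in> U" unfolding U_def using c p by (auto simp: open_ldom chart_mem_ldom)
  have sm: "smooth_on U \<psi>" unfolding U_def \<psi>_def using c by (intro smooth_left_translation) auto
  have \<psi>e: "\<psi> e = x" by (simp add: \<psi>_def p)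
  have d\<psi>: "frechet_derivative \<psi> (at e) = L c x"
    by (simp add: \<psi>_def L_def from_lie_def p_def fun_eq_iff)
  define D2 where "D2 X = frechet_derivative (\<lambda>y. frechet_derivative \<psi> (at y) X) (at e)" for X
  have main: "DL c x X (L c x Y) = D2 X Y + L c x (DL b e X Y)" for X Y
  proof -
    have related: "L c (\<psi> y) X = frechet_derivative \<psi> (at y) (L b y X)" if "y \<in> U" for y
    proof -
      have y: "y \<in> im b" "p \<otimes> chart_inv b y \<in> fst c" using that by (auto simp: U_def ldom_def)
      then have "frechet_derivative \<psi> (at y) = dleft p b c (chart_inv b y)"
        by (simp add: \<psi>_def dleft_def chart_chart_inv)
      then show ?thesis
        using dleft_from_lie[of b c "chart_inv b y" p X] c y
        by (simp add: L_def \<psi>_def chart_inv_mem chart_inv_chart)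
    qed
    have 1: "(\<psi> has_derivative L c x) (at e)"
      using smooth_on_imp_has_derivative[OF sm U(2)] d\<psi> by simp
    have "((\<lambda>y. L c (\<psi> y) X) has_derivative (\<lambda>v. DL c x X (L c x v))) (at e)"
      using has_derivative_compose[OF 1, of "\<lambda>y. L c y X" "DL c x X"] DL_has_derivative[OF c x] \<psi>e by simp
    then have lhs: "((\<lambda>y. frechet_derivative \<psi> (at y) (L b y X)) has_derivative (\<lambda>v. DL c x X (L c x v))) (at e)"
      by (rule has_derivative_transform_within_open[OF _ U]) (rule related)
    have "((\<lambda>y. frechet_derivative \<psi> (at y) (L b y X)) has_derivative
        (\<lambda>v. D2 (L b e X) v + frechet_derivative \<psi> (at e) (DL b e X v))) (at e)"
    proof (rule has_derivative_linear_family[OF U, where A="\<lambda>y. frechet_derivative \<psi> (at y)" and A'=D2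
          and w="\<lambda>y. L b y X" and w'="DL b e X"])
      show "linear (frechet_derivative \<psi> (at y))" if "y \<in> U" for y
        using smooth_on_imp_has_derivative[OF sm that] has_derivative_linear by blast
      show "((\<lambda>y. frechet_derivative \<psi> (at y) u) has_derivative D2 u) (at e)" for u
        unfolding D2_def by (rule smooth_on_imp_has_derivative[OF smooth_on_frechet_derivative[OF sm] U(2)])
      show "((\<lambda>y. L b y X) has_derivative DL b e X) (at e)"
        by (rule DL_has_derivative) auto
    qed
    from has_derivative_unique[OF lhs this] show ?thesis by (simp add: fun_eq_iff d\<psi>)
  qed
  have "D2 X Y = D2 Y X"
    unfolding D2_def by (rule smooth_on_second_derivative_symmetric[OF U sm])
  then show ?thesis
    by (simp add: main lie_bracket_eq linear_diff[OF linear_L[OF c x]])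
qed

text \<open>With each vector written as a value of the frame, the antisymmetrized \<open>DT\<close>
  is minus \<open>T\<close> of the bracket of two left-invariant fields.\<close>

lemma maurer_cartan:
  assumes c: "c \<in> A" and x: "x \<in> im c"
  shows "DT c x u w - DT c x w u = - lie_bracket N (T c x u) (T c x w)"
proof -
  have "DT c x u w - DT c x w u = - T c x (DL c x (T c x w) (L c x (T c x u)) - DL c x (T c x u) (L c x (T c x w)))"
    by (simp add: DT_def L_T[OF c x] linear_diff[OF linear_T[OF c x]])
  then show ?thesis by (simp add: left_invariant_bracket[OF c x] T_L[OF c x])
qed

lemma linear_DT:
  assumes "c \<in> A" "x \<in> im c"
  shows "linear (\<lambda>v. DT c x v u)" "linear (DT c x v)"
proof -
  show 1: "linear (\<lambda>v. DT c x v u)" for u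
    using DT_has_derivative[OF assms] has_derivative_linear by blast
  have "linear (\<lambda>u. - T c x ((\<lambda>X. DL c x X v) (T c x u)))"
    by (intro linear_compose_neg linear_compose[OF linear_compose[OF linear_T[OF assms] linear_DL[OF assms]]
          linear_T[OF assms], unfolded o_def])
  then show "linear (DT c x v)" unfolding DT_def by simp
qed

end

section \<open>The local logarithm of a 2-step nilpotent group\<close>

context two_step_bracket
begin

section \<open>Computing modulo the center\<close>

definition center :: "'a set" where
  "center = {z. \<forall>y. br z y = 0}"

text \<open>A concrete model of the quotient by the center: its kernel is the center, and brackets
  do not see the discarded part.\<close>

definition nproj :: "'a \<Rightarrow> 'a" where
  "nproj x = x - orth_proj center x"

lemma subspace_center: "subspace center"
  by (auto simp: subspace_def center_def br.zero_left br.add_left br.scaleR_left)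

lemma center_bracket: "z \<in> center \<Longrightarrow> br z y = 0" "z \<in> center \<Longrightarrow> br y z = 0"
  using bracket_antisym[of y z] by (simp_all add: center_def)

lemma bracket_in_center: "br x y \<in> center"
  by (simp add: center_def bracket_nilpotent)

lemma linear_nproj: "linear nproj"
  unfolding nproj_def
  by (intro linear_compose_sub linear_ident linear_orth_proj subspace_center)

lemma bounded_linear_nproj: "bounded_linear nproj"
  using linear_nproj linear_conv_bounded_linear by blast

lemma diff_nproj_in_center: "x - nproj x \<in> center"
  by (simp add: nproj_def orth_proj_mem subspace_center)

lemma nproj_central [simp]: "z \<in> center \<Longrightarrow> nproj z = 0"
  by (simp add: nproj_def orth_proj_eqI[of center z z] subspace_center subspace_0 subspace_orthogonal_comp)

lemma nproj_orthogonal: "v \<in> orthogonal_comp center \<Longrightarrow> nproj v = v"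
  by (simp add: nproj_def orth_proj_eqI[of center 0 v] subspace_center subspace_0)

lemma nproj_eq_0_imp: "nproj x = 0 \<Longrightarrow> x \<in> center"
  using diff_nproj_in_center[of x] by simp

lemma bracket_nproj [simp]: "br (nproj x) y = br x y" "br y (nproj x) = br y x"
  using center_bracket[OF diff_nproj_in_center[of x], of y]
  by (simp_all add: br.diff_left br.diff_right)

lemma nproj_nproj [simp]: "nproj (nproj x) = nproj x"
  using linear_diff[OF linear_nproj, of x "nproj x"] nproj_central[OF diff_nproj_in_center[of x]] by simp

lemma nproj_bracket [simp]: "nproj (br x y) = 0"
  by (simp add: bracket_in_center)

lemma nproj_add: "nproj (x + y) = nproj x + nproj y" and nproj_diff: "nproj (x - y) = nproj x - nproj y"
  and nproj_scaleR: "nproj (r *\<^sub>R x) = r *\<^sub>R nproj x"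
  by (simp_all add: linear_add[OF linear_nproj] linear_diff[OF linear_nproj] linear_cmul[OF linear_nproj])

lemma nproj_bch: "nproj (x \<star> y) = nproj x + nproj y"
  by (simp add: bch_def nproj_add nproj_scaleR)

text \<open>The left logarithmic derivative of \<open>\<phi>\<close> with respect to the product \<open>\<star>\<close> is
  \<open>\<phi>' - [\<phi>, \<phi>'] / 2\<close>; solving for \<open>\<phi>'\<close> gives the form used here.\<close>

lemma logarithmic_derivative_unique:
  fixes \<phi>1 \<phi>2 :: "'x::real_normed_vector \<Rightarrow> 'a"
  assumes S: "open S" "convex S" and x: "x0 \<in> S" "x \<in> S"
    and 1: "\<And>x. x \<in> S \<Longrightarrow> (\<phi>1 has_derivative (\<lambda>u. \<theta> x u + (1/2) *\<^sub>R br (\<phi>1 x) (\<theta> x u))) (at x)"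
    and 2: "\<And>x. x \<in> S \<Longrightarrow> (\<phi>2 has_derivative (\<lambda>u. \<theta> x u + (1/2) *\<^sub>R br (\<phi>2 x) (\<theta> x u))) (at x)"
    and eq: "\<phi>1 x0 = \<phi>2 x0"
  shows "\<phi>1 x = \<phi>2 x"
proof -
  let ?D = "\<lambda>x. \<phi>1 x - \<phi>2 x"
  have D: "(?D has_derivative (\<lambda>u. (1/2) *\<^sub>R br (?D x) (\<theta> x u))) (at x)" if "x \<in> S" for x
    using has_derivative_diff[OF 1[OF that] 2[OF that]]
    by (rule has_derivative_eq_rhs) (simp add: fun_eq_iff br.diff_left scaleR_diff_right)
  \<comment> \<open>The equation for \<open>?D\<close> has its right side in the center, so
    \<open>?D\<close> is constant modulo the center, hence central, and then its whole derivative
    vanishes.\<close>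
  have "((\<lambda>x. nproj (?D x)) has_derivative (\<lambda>u. 0)) (at x)" if "x \<in> S" for x
    using bounded_linear.has_derivative[OF bounded_linear_nproj D[OF that]]
    by (simp add: nproj_scaleR)
  then have "nproj (?D y) = nproj (?D x0)" if "y \<in> S" for y
    using has_derivative_zero_imp_eq[OF S that x(1)] by blast
  then have "?D y \<in> center" if "y \<in> S" for y
    using that eq by (intro nproj_eq_0_imp) (simp add: subspace_0 subspace_center)
  then have "(?D has_derivative (\<lambda>u. 0)) (at y)" if "y \<in> S" for y
    using D[OF that] that by (simp add: center_bracket)
  then have "?D x = ?D x0" using has_derivative_zero_imp_eq[OF S x(2,1)] by blast
  then show ?thesis using eq by simp
qed

end

locale nilpotent_lie_grp = lie_grp N
  for N :: "('g::{t2_space, second_countable_topology}, 'a::euclidean_space) lie_structure" (structure) +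
  assumes nilpotent: "two_step_nilpotent N"
begin

sublocale two_step_bracket "lie_bracket N"
proof
  show "lie_bracket N (lie_bracket N X Y) Z = 0" for X Y Z
    using nilpotent by (simp add: two_step_nilpotent_def)
qed (rule bilinear_lie_bracket, rule lie_bracket_antisym)

notation bch (infixl \<open>\<star>\<close> 70)

lemma lie_center_eq: "lie_center N = center"
  by (simp add: lie_center_def center_def)

text \<open>A local logarithm is a primitive of the Maurer--Cartan form for \<open>\<star>\<close>. Modulo the center
  the Maurer--Cartan form is closed; once its primitive \<open>v\<close> is known, subtracting it and correcting by
  \<open>[v, T] / 2\<close> leaves a closed form with values in the center.\<close>

lemma local_logarithm:
  assumes S: "open S" "convex S" "e \<in> S" "S \<subseteq> im b"
  obtains f where "f e = 0"
    "\<And>x. x \<in> S \<Longrightarrow> (f has_derivative (\<lambda>u. T b x u + (1/2) *\<^sub>R lie_bracket N (f x) (T b x u))) (at x)"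
proof -
  have im: "x \<in> im b" if "x \<in> S" for x using S that by blast
  note T = linear_T[OF base_in_atlas im] and mc = maurer_cartan[OF base_in_atlas im]
  note dT = DT_has_derivative[OF base_in_atlas im]
  have cDT: "continuous_on S (\<lambda>x. DT b x v u)" and cT: "continuous_on S (\<lambda>x. T b x u)" for u v
    by (rule continuous_on_subset[OF continuous_DT[OF base_in_atlas] S(4)],
        rule continuous_on_subset[OF continuous_T[OF base_in_atlas] S(4)])
  obtain v where v: "v e = 0" "\<And>x. x \<in> S \<Longrightarrow> (v has_derivative (\<lambda>u. nproj (T b x u))) (at x)"
  proof (rule poincare_one_form[OF S(1-3), of "\<lambda>x u. nproj (T b x u)" "\<lambda>x v u. nproj (DT b x v u)"])
    show "linear (\<lambda>u. nproj (T b x u))" if "x \<in> S" for x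
      using linear_compose[OF T[OF that] linear_nproj] by (simp add: o_def)
    show "((\<lambda>y. nproj (T b y u)) has_derivative (\<lambda>v. nproj (DT b x v u))) (at x)" if "x \<in> S" for x u
      by (rule bounded_linear.has_derivative[OF bounded_linear_nproj dT[OF that]])
    show "continuous_on S (\<lambda>x. nproj (DT b x v u))" for u v
      by (rule bounded_linear.continuous_on[OF bounded_linear_nproj cDT])
    show "nproj (DT b x v u) = nproj (DT b x u v)" if "x \<in> S" for x u v
      using arg_cong[OF mc[OF that, of v u], of nproj] nproj_diff linear_neg[OF linear_nproj]
      by simp
  qed blast
  define B where "B x u = T b x u - nproj (T b x u) + (1/2) *\<^sub>R lie_bracket N (v x) (T b x u)" for x u
  have nB: "nproj (B x u) = 0" for x u
    by (simp add: B_def nproj_add nproj_diff nproj_scaleR)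
  obtain z where z: "z e = 0" "\<And>x. x \<in> S \<Longrightarrow> (z has_derivative B x) (at x)"
  proof (rule poincare_one_form[OF S(1-3), of B "\<lambda>x w u. DT b x w u - nproj (DT b x w u) +
        (1/2) *\<^sub>R (lie_bracket N (v x) (DT b x w u) + lie_bracket N (nproj (T b x w)) (T b x u))"])
    fix x assume x: "x \<in> S"
    show "linear (B x)"
      unfolding B_def
      by (rule linearI)
        (simp_all add: linear_add[OF T[OF x]] linear_cmul[OF T[OF x]] nproj_add nproj_scaleR
          br.add_right br.scaleR_right algebra_simps)
    show "((\<lambda>y. B y u) has_derivative (\<lambda>w. DT b x w u - nproj (DT b x w u) +
        (1/2) *\<^sub>R (lie_bracket N (v x) (DT b x w u) + lie_bracket N (nproj (T b x w)) (T b x u)))) (at x)" for u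
      unfolding B_def
      by (intro has_derivative_add has_derivative_diff has_derivative_scaleR_right dT[OF x]
          bounded_linear.has_derivative[OF bounded_linear_nproj] br.FDERIV v(2)[OF x])
    show "DT b x w u - nproj (DT b x w u) +
        (1/2) *\<^sub>R (lie_bracket N (v x) (DT b x w u) + lie_bracket N (nproj (T b x w)) (T b x u)) =
      DT b x u w - nproj (DT b x u w) +
        (1/2) *\<^sub>R (lie_bracket N (v x) (DT b x u w) + lie_bracket N (nproj (T b x u)) (T b x w))" for u w
    proof -
      \<comment> \<open>The Maurer--Cartan form fails to be closed by one full bracket; exchanging
        \<open>w\<close> and \<open>u\<close> in the half bracket compensates exactly this, which
        forces the factor \<open>1/2\<close>.\<close>
      have eq: "DT b x w u = DT b x u w - lie_bracket N (T b x w) (T b x u)"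
        using mc[OF x, of w u] by (simp add: algebra_simps)
      have "nproj (DT b x w u) = nproj (DT b x u w)"
        by (simp add: eq nproj_diff)
      moreover have "lie_bracket N (v x) (DT b x w u) = lie_bracket N (v x) (DT b x u w)"
        by (simp add: eq br.diff_right)
      moreover have "lie_bracket N (T b x u) (T b x w) = - lie_bracket N (T b x w) (T b x u)"
        by (rule lie_bracket_antisym)
      ultimately show ?thesis
        by (simp add: eq algebra_simps flip: scaleR_2)
    qed
  next
    have "continuous_on S v"
      by (intro continuous_at_imp_continuous_on ballI has_derivative_continuous) (rule v(2))
    then show "continuous_on S (\<lambda>x. DT b x w u - nproj (DT b x w u) +
        (1/2) *\<^sub>R (lie_bracket N (v x) (DT b x w u) + lie_bracket N (nproj (T b x w)) (T b x u)))" for u w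
      by (intro continuous_on_add continuous_on_diff continuous_on_scaleR continuous_on_const cDT cT
          bounded_linear.continuous_on[OF bounded_linear_nproj] br.continuous_on)
  qed blast
  have "((\<lambda>x. nproj (z x)) has_derivative (\<lambda>u. 0)) (at x)" if "x \<in> S" for x
    using bounded_linear.has_derivative[OF bounded_linear_nproj z(2)[OF that]] by (simp add: nB)
  then have "nproj (z x) = nproj (z e)" if "x \<in> S" for x
    using has_derivative_zero_imp_eq[OF S(1,2) that S(3)] by blast
  then have zc: "z x \<in> center" if "x \<in> S" for x
    using that z(1) by (intro nproj_eq_0_imp) (simp add: subspace_0 subspace_center)
  show ?thesis
  proof (rule that[of "\<lambda>x. v x + z x"])
    fix x assume x: "x \<in> S"
    show "((\<lambda>x. v x + z x) has_derivative (\<lambda>u. T b x u + (1/2) *\<^sub>R lie_bracket N (v x + z x) (T b x u))) (at x)"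
      using has_derivative_add[OF v(2)[OF x] z(2)[OF x]]
      by (rule has_derivative_eq_rhs) (simp add: B_def br.add_left center_bracket zc[OF x] fun_eq_iff)
  qed (simp add: v z)
qed

end

section \<open>A local exponential chart\<close>

locale exp_chart = nilpotent_lie_grp N
  for N :: "('g::{t2_space, second_countable_topology}, 'a::euclidean_space) lie_structure" (structure) +
  fixes f g :: "'a \<Rightarrow> 'a" and \<rho> :: real
  assumes radius_pos: "\<rho> > 0"
    and g_im: "X \<in> ball 0 \<rho> \<Longrightarrow> g X \<in> im b"
    and f_g: "X \<in> ball 0 \<rho> \<Longrightarrow> f (g X) = X"
    and g_0: "g 0 = e"
    and f_has_derivative: "(f has_derivative (\<lambda>u. u)) (at e)"
    and g_has_derivative: "(g has_derivative (\<lambda>u. u)) (at 0)"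
    and continuous_g: "continuous_on (ball 0 \<rho>) g"
    and open_g: "open (g ` ball 0 \<rho>)"
    and continuous_f: "continuous_on (g ` ball 0 \<rho>) f"
    and g_bch: "X \<in> ball 0 \<rho> \<Longrightarrow> Y \<in> ball 0 \<rho> \<Longrightarrow>
      chart_inv b (g (bch X Y)) = chart_inv b (g X) \<otimes> chart_inv b (g Y)"
    and simply_connected: "simply_connected (UNIV :: 'g set)"

context nilpotent_lie_grp
begin

text \<open>For fixed \<open>x\<close> both sides solve the same equation in \<open>y\<close> and
  agree at \<open>e\<close>: the Maurer--Cartan form is invariant under left translation, and so is
  the logarithmic derivative for \<open>\<star>\<close>.\<close>

lemma local_logarithm_bch:
  assumes r: "r \<le> r0" "ball e r0 \<subseteq> im b"
    and f: "f e = 0" "\<And>x. x \<in> ball e r0 \<Longrightarrow>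
      (f has_derivative (\<lambda>u. T b x u + (1/2) *\<^sub>R lie_bracket N (f x) (T b x u))) (at x)"
    and M: "\<And>x y. x \<in> ball e r \<Longrightarrow> y \<in> ball e r \<Longrightarrow>
      (x, y) \<in> mdom b b b \<and> mult_chart b b b (x, y) \<in> ball e r0"
    and x: "x \<in> ball e r" and y: "y \<in> ball e r"
  shows "f (mult_chart b b b (x, y)) = f x \<star> f y"
proof -
  have im: "x \<in> im b" if "x \<in> ball e r" for x using that r by (auto simp: subset_iff)
  define p where "p = chart_inv b x"
  have p: "p \<in> fst b" "snd b p = x" using im[OF x] by (simp_all add: p_def chart_inv_mem chart_chart_inv)
  have Mp: "mult_chart b b b (x, y) = snd b (p \<otimes> chart_inv b y)" for y
    by (simp add: mult_chart_def p_def)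
  show ?thesis
  proof (rule logarithmic_derivative_unique[of "ball e r" e y "\<lambda>y. f (mult_chart b b b (x, y))" "T b" "\<lambda>y. f x \<star> f y"])
    show "e \<in> ball e r" using y by (metis dist_self mem_ball zero_le_dist le_less_trans)
    fix y assume y: "y \<in> ball e r"
    let ?q = "chart_inv b y" and ?m = "mult_chart b b b (x, y)"
    have q: "?q \<in> fst b" "snd b ?q = y" "p \<otimes> ?q \<in> fst b"
      using im[OF y] M[OF x y] by (auto simp: chart_inv_mem chart_chart_inv mdom_def p_def)
    have 1: "((\<lambda>y. mult_chart b b b (x, y)) has_derivative dleft p b b ?q) (at y)"
      using dleft_has_derivative[of b b ?q p] q by (simp add: Mp)
    have T: "T b ?m (dleft p b b ?q u) = T b y u" for u
      using to_lie_dleft[of b b ?q p u] q by (simp add: T_def Mp chart_inv_chart)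
    show "((\<lambda>y. f (mult_chart b b b (x, y))) has_derivative
        (\<lambda>u. T b y u + (1/2) *\<^sub>R lie_bracket N (f ?m) (T b y u))) (at y)"
      using has_derivative_compose[OF 1 f(2)] M[OF x y] by (simp add: T)
    have fy: "(f has_derivative (\<lambda>u. T b y u + (1/2) *\<^sub>R lie_bracket N (f y) (T b y u))) (at y)"
      using f(2)[of y] y r by auto
    have "((\<lambda>y. f x \<star> f y) has_derivative (\<lambda>u. 0 + (T b y u + (1/2) *\<^sub>R lie_bracket N (f y) (T b y u)) +
        (1/2) *\<^sub>R (lie_bracket N (f x) (T b y u + (1/2) *\<^sub>R lie_bracket N (f y) (T b y u)) + lie_bracket N 0 (f y)))) (at y)"
      unfolding bch_def
      by (intro has_derivative_add has_derivative_const has_derivative_scaleR_right br.FDERIV fy)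
    then show "((\<lambda>y. f x \<star> f y) has_derivative
        (\<lambda>u. T b y u + (1/2) *\<^sub>R lie_bracket N (f x \<star> f y) (T b y u))) (at y)"
      by (rule has_derivative_eq_rhs)
        (simp add: bch_def br.add_left br.add_right br.scaleR_left br.scaleR_right br.zero_left
          bracket_nilpotent algebra_simps fun_eq_iff)
  qed (use y f p in \<open>auto simp: Mp\<close>)
qed

lemma exp_chart_exists:
  assumes sc: "simply_connected (UNIV :: 'g set)"
  obtains f g \<rho> where "exp_chart N f g \<rho>"
proof -
  let ?M = "mult_chart b b b"
  obtain r0 where r0: "r0 > 0" "ball e r0 \<subseteq> im b"
    using open_im[OF base_in_atlas] e_in_im openE by blast
  obtain f where f: "f e = 0" "\<And>x. x \<in> ball e r0 \<Longrightarrow>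
      (f has_derivative (\<lambda>u. T b x u + (1/2) *\<^sub>R lie_bracket N (f x) (T b x u))) (at x)"
    using local_logarithm[of "ball e r0"] r0 by auto
  have cM: "continuous_on (mdom b b b) ?M"
    by (intro smooth_on_imp_continuous_on smooth_mult_chart) auto
  have oM: "open (mdom b b b)" by (intro open_mdom) auto
  have eM: "(e, e) \<in> mdom b b b" "?M (e, e) = e" by (simp_all add: mdom_def mult_chart_def)
  have "open (?M -` ball e r0 \<inter> mdom b b b)"
    using continuous_on_open_vimage[OF oM, THEN iffD1, OF cM, rule_format, OF open_ball] .
  moreover have "(e, e) \<in> ?M -` ball e r0 \<inter> mdom b b b" using eM r0 by simp
  ultimately obtain r1 where r1: "r1 > 0"
    "\<And>x y. x \<in> ball e r1 \<Longrightarrow> y \<in> ball e r1 \<Longrightarrow> (x, y) \<in> ?M -` ball e r0 \<inter> mdom b b b"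
    using open_contains_ball_square by blast
  define r where "r = min r0 r1"
  have r: "r > 0" "r \<le> r0" "\<And>x y. x \<in> ball e r \<Longrightarrow> y \<in> ball e r \<Longrightarrow> (x, y) \<in> mdom b b b \<and> ?M (x, y) \<in> ball e r0"
    using r0 r1 by (auto simp: r_def)
  have r_im: "ball e r \<subseteq> im b" using r0 r by auto
  have hom: "f (?M (x, y)) = f x \<star> f y" if "x \<in> ball e r" "y \<in> ball e r" for x y
    by (rule local_logarithm_bch[where f=f and r=r and ?r0.0=r0]) (use r(2) r0(2) f r(3) that in blast)+
  define f' where "f' x = Blinfun (\<lambda>u. T b x u + (1/2) *\<^sub>R lie_bracket N (f x) (T b x u))" for x
  have f': "blinfun_apply (f' x) = (\<lambda>u. T b x u + (1/2) *\<^sub>R lie_bracket N (f x) (T b x u))"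
    if "x \<in> ball e r0" for x
    unfolding f'_def
    by (rule bounded_linear_Blinfun_apply[OF has_derivative_bounded_linear[OF f(2)[OF that]]])
  have cf: "continuous_on (ball e r0) f"
    by (intro continuous_at_imp_continuous_on ballI has_derivative_continuous) (rule f(2))
  have cT: "continuous_on (ball e r0) (\<lambda>x. T b x u)" for u
    by (rule continuous_on_subset[OF continuous_T r0(2)]) simp
  \<comment> \<open>At \<open>e\<close> the derivative of \<open>f\<close> is the identity:
    \<open>f e = 0\<close> removes the bracket and \<open>T b e\<close> is the identity. Hence
    \<open>id_blinfun\<close> is the required inverse.\<close>
  obtain U V g g' where U: "open U" "U \<subseteq> ball e r" "e \<in> U" and V: "open V" "f e \<in> V"
    and hm: "homeomorphism U V f g" and g: "\<And>y. y \<in> V \<Longrightarrow> (g has_derivative g' y) (at y)"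
    and g': "\<And>y. y \<in> V \<Longrightarrow> g' y = inv_into UNIV (blinfun_apply (f' (g y)))"
  proof (rule inverse_function_theorem[of "ball e r" f f' e id_blinfun])
    show "(f has_derivative blinfun_apply (f' x)) (at x)" if "x \<in> ball e r" for x
      using f(2)[of x] f'[of x] that r by auto
    show "continuous_on (ball e r) f'"
    proof (rule continuous_on_subset[of "ball e r0"], rule continuous_on_blinfun_componentwise)
      show "continuous_on (ball e r0) (\<lambda>x. blinfun_apply (f' x) i)" for i
      proof (rule continuous_on_eq)
        show "continuous_on (ball e r0) (\<lambda>x. T b x i + (1/2) *\<^sub>R lie_bracket N (f x) (T b x i))"
          by (intro continuous_on_add continuous_on_scaleR continuous_on_const br.continuous_on cf cT)
      qed (simp add: f')
    qed (use r in auto)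
    show "id_blinfun o\<^sub>L f' e = id_blinfun"
      using r0 f(1) by (intro blinfun_eqI) (simp add: f' br.zero_left)
  qed (use r in auto)
  have g0: "g 0 = e" using homeomorphism_apply1[OF hm U(3)] f(1) by simp
  have gU: "g X \<in> U" "f (g X) = X" if "X \<in> V" for X
    using hm that unfolding homeomorphism_def by auto
  have gf: "g (f x) = x" if "x \<in> U" for x
    using hm that unfolding homeomorphism_def by auto
  have cg: "continuous_on V g" using hm unfolding homeomorphism_def by auto
  have dg: "(g has_derivative (\<lambda>u. u)) (at 0)"
  proof -
    have "blinfun_apply (f' e) = (\<lambda>u. u)" using r0 by (simp add: f' f br.zero_left)
    then show ?thesis
      using g[of 0] g'[of 0] V f(1) g0 inv_id by (simp add: id_def)
  qed
  \<comment> \<open>The radius is chosen below so that the product of \<open>g X\<close> and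
    \<open>g Y\<close> stays in \<open>U\<close>, where \<open>g\<close> undoes \<open>f\<close>,
    and \<open>X \<star> Y\<close> stays in \<open>V\<close>, possibly outside the ball.\<close>
  define \<mu> where "\<mu> q = ?M (g (fst q), g (snd q))" for q
  have "continuous_on (V \<times> V) \<mu>"
    unfolding \<mu>_def
  proof (rule continuous_on_compose2[OF cM])
    show "continuous_on (V \<times> V) (\<lambda>q. (g (fst q), g (snd q)))"
      by (intro continuous_on_Pair continuous_on_compose2[OF cg continuous_on_fst[OF continuous_on_id]]
          continuous_on_compose2[OF cg continuous_on_snd[OF continuous_on_id]]) auto
    show "(\<lambda>q. (g (fst q), g (snd q))) ` (V \<times> V) \<subseteq> mdom b b b"
      using gU(1) U(2) r(3) by (auto simp: subset_iff)
  qed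
  then have 1: "open (\<mu> -` U \<inter> V \<times> V)"
    using continuous_on_open_vimage[of "V \<times> V" \<mu>] V(1) U(1) by (auto simp: open_Times)
  have 2: "open {q. fst q \<star> snd q \<in> V}"
    by (intro open_Collect_mem_continuous V continuous_on_bch continuous_on_fst continuous_on_snd continuous_on_id)
  have "(0, 0) \<in> (\<mu> -` U \<inter> V \<times> V) \<inter> {q. fst q \<star> snd q \<in> V}"
    using V f(1) U(3) by (simp add: \<mu>_def g0 eM)
  from open_contains_ball_square[OF open_Int[OF 1 2] this]
  obtain \<rho> where \<rho>: "\<rho> > 0" "\<And>X Y. X \<in> ball 0 \<rho> \<Longrightarrow> Y \<in> ball 0 \<rho> \<Longrightarrow>
      (X, Y) \<in> (\<mu> -` U \<inter> V \<times> V) \<inter> {q. fst q \<star> snd q \<in> V}" by blast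
  have \<rho>V: "X \<in> V" if "X \<in> ball 0 \<rho>" for X using \<rho>(2)[OF that that] by simp
  have gball: "g ` ball 0 \<rho> = f -` ball 0 \<rho> \<inter> U"
  proof (rule equalityI; rule subsetI)
    fix x assume "x \<in> f -` ball 0 \<rho> \<inter> U"
    then show "x \<in> g ` ball 0 \<rho>" using gf by (metis IntD1 IntD2 image_eqI vimageD)
  qed (use gU \<rho>V in auto)
  have cfU: "continuous_on U f" using hm unfolding homeomorphism_def by auto
  have "exp_chart N f g \<rho>"
  proof
    show "(f has_derivative (\<lambda>u. u)) (at e)"
      using f(2)[of e] r0 by (simp add: f(1) br.zero_left)
    show "open (g ` ball 0 \<rho>)"
      unfolding gball using continuous_on_open_vimage[OF U(1), THEN iffD1, OF cfU, rule_format, OF open_ball] .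
    show "continuous_on (ball 0 \<rho>) g" using cg \<rho>V continuous_on_subset by blast
    show "continuous_on (g ` ball 0 \<rho>) f" unfolding gball using cfU continuous_on_subset by blast
    fix X Y :: 'a assume X: "X \<in> ball 0 \<rho>" and Y: "Y \<in> ball 0 \<rho>"
    have XY: "X \<star> Y \<in> V" "?M (g X, g Y) \<in> U" "g X \<in> ball e r" "g Y \<in> ball e r"
      using \<rho>(2)[OF X Y] subsetD[OF U(2) gU(1)[OF \<rho>V[OF X]]] subsetD[OF U(2) gU(1)[OF \<rho>V[OF Y]]]
      by (simp_all add: \<mu>_def)
    have "f (?M (g X, g Y)) = X \<star> Y"
      using hom[OF XY(3,4)] gU(2) \<rho>V X Y by simp
    then have "g (X \<star> Y) = ?M (g X, g Y)" using gf[OF XY(2)] by simp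
    then show "chart_inv b (g (X \<star> Y)) = chart_inv b (g X) \<otimes> chart_inv b (g Y)"
      using r(3)[OF XY(3,4)] by (simp add: mult_chart_def mdom_def chart_inv_chart)
    show "g X \<in> im b" using gU(1)[OF \<rho>V[OF X]] U(2) r_im by blast
    show "f (g X) = X" using gU(2)[OF \<rho>V[OF X]] .
  qed (use \<rho>(1) g0 dg sc in auto)
  then show ?thesis by (rule that)
qed

end

section \<open>The exponential map\<close>

context exp_chart
begin

sublocale exp: local_exponential "lie_bracket N" N "\<lambda>X. chart_inv b (g X)" \<rho>
proof
  let ?E = "\<lambda>X. chart_inv b (g X)"
  have img: "?E ` ball 0 \<rho> = snd b -` (g ` ball 0 \<rho>) \<inter> fst b"
  proof (rule equalityI; rule subsetI)
    fix p assume p: "p \<in> snd b -` (g ` ball 0 \<rho>) \<inter> fst b"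
    then obtain X where "X \<in> ball 0 \<rho>" "snd b p = g X" by auto
    then show "p \<in> ?E ` ball 0 \<rho>" using p chart_inv_chart[of b p] by (auto intro!: image_eqI[of _ _ X])
  qed (auto simp: chart_chart_inv chart_inv_mem g_im)
  have fE: "f (snd b (?E X)) = X" if "X \<in> ball 0 \<rho>" for X
    using that by (simp add: chart_chart_inv g_im f_g)
  show inj: "inj_on ?E (ball 0 \<rho>)" by (rule inj_on_inverseI[of _ "\<lambda>p. f (snd b p)"]) (rule fE)
  show "open (?E ` ball 0 \<rho>)"
    unfolding img
    using continuous_on_open_vimage[OF open_chart_domain[OF base_in_atlas], THEN iffD1,
        OF continuous_chart[OF base_in_atlas], rule_format, OF open_g] .
  show "continuous_on (?E ` ball 0 \<rho>) (inv_into (ball 0 \<rho>) ?E)"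
  proof (rule continuous_on_eq)
    show "continuous_on (?E ` ball 0 \<rho>) (\<lambda>p. f (snd b p))"
      unfolding img
      by (rule continuous_on_compose2[OF continuous_f continuous_on_subset[OF continuous_chart[OF base_in_atlas]]]) auto
    fix p assume "p \<in> ?E ` ball 0 \<rho>"
    then obtain X where X: "X \<in> ball 0 \<rho>" "p = ?E X" by auto
    show "f (snd b p) = inv_into (ball 0 \<rho>) ?E p"
      unfolding X(2) inv_into_f_f[OF inj X(1)] by (rule fE[OF X(1)])
  qed
  show "continuous_on (ball 0 \<rho>) ?E"
    by (rule continuous_on_compose2[OF continuous_chart_inv[OF base_in_atlas] continuous_g]) (use g_im in auto)
qed (use radius_pos g_bch continuous_mult continuous_inv simply_connected in auto)

abbreviation "Exp \<equiv> exp.Exp"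

lemma Exp_eq: "X \<in> ball 0 \<rho> \<Longrightarrow> Exp X = chart_inv b (g X)"
  by (rule exp.Exp_eq_E)

text \<open>Around \<open>t0\<close> the curve is \<open>Exp (t0 *\<^sub>R X)\<close> times
  \<open>Exp ((t - t0) *\<^sub>R X)\<close>, and \<open>g\<close> has the identity as derivative at
  \<open>0\<close>. Thus it is an integral curve of the left-invariant field of
  \<open>X\<close>.\<close>

lemma Exp_curve_has_vector_derivative:
  assumes d: "d \<in> A" "Exp (t0 *\<^sub>R X) \<in> fst d"
  shows "((\<lambda>t. snd d (Exp (t *\<^sub>R X))) has_vector_derivative L d (snd d (Exp (t0 *\<^sub>R X))) X) (at t0)"
proof -
  define p where "p = Exp (t0 *\<^sub>R X)"
  let ?I = "{t. (t - t0) *\<^sub>R X \<in> ball 0 \<rho>}"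
  have I: "open ?I" "t0 \<in> ?I"
    by (intro open_Collect_mem_continuous open_ball continuous_intros) (simp add: radius_pos)
  have 1: "((\<lambda>t. (t - t0) *\<^sub>R X) has_derivative (\<lambda>h. h *\<^sub>R X)) (at t0)"
    by (auto intro!: derivative_eq_intros)
  have 2: "((\<lambda>t. g ((t - t0) *\<^sub>R X)) has_derivative (\<lambda>h. h *\<^sub>R X)) (at t0)"
    using has_derivative_compose[OF 1, of g "\<lambda>u. u"] g_has_derivative by simp
  have 3: "((\<lambda>y. snd d (p \<otimes> chart_inv b y)) has_derivative dleft p b d \<one>) (at e)"
    using dleft_has_derivative[of b d \<one> p] d by (simp add: p_def)
  have "((\<lambda>t. snd d (p \<otimes> chart_inv b (g ((t - t0) *\<^sub>R X)))) has_derivative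
      (\<lambda>h. dleft p b d \<one> (h *\<^sub>R X))) (at t0)"
    using has_derivative_compose[OF 2, of "\<lambda>y. snd d (p \<otimes> chart_inv b y)" "dleft p b d \<one>"] 3 g_0 by simp
  moreover have "dleft p b d \<one> (h *\<^sub>R X) = h *\<^sub>R L d (snd d p) X" for h
    using d linear_cmul[OF linear_dleft[of b d \<one> p]]
    by (simp add: L_def chart_inv_chart from_lie_eq_dleft p_def)
  ultimately have "((\<lambda>t. snd d (p \<otimes> chart_inv b (g ((t - t0) *\<^sub>R X)))) has_derivative
      (\<lambda>h. h *\<^sub>R L d (snd d p) X)) (at t0)" by simp
  then have "((\<lambda>t. snd d (Exp (t *\<^sub>R X))) has_derivative (\<lambda>h. h *\<^sub>R L d (snd d p) X)) (at t0)"
  proof (rule has_derivative_transform_within_open[OF _ I])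
    fix t assume "t \<in> ?I"
    then have "p \<otimes> chart_inv b (g ((t - t0) *\<^sub>R X)) = Exp ((t0 *\<^sub>R X) \<star> ((t - t0) *\<^sub>R X))"
      by (simp add: p_def exp.Exp_bch Exp_eq)
    then show "snd d (p \<otimes> chart_inv b (g ((t - t0) *\<^sub>R X))) = snd d (Exp (t *\<^sub>R X))"
      by (simp add: bch_scaleR)
  qed
  then show ?thesis by (simp add: has_vector_derivative_def p_def)
qed

text \<open>An integral curve of a smooth field is smooth to all orders by
  \<open>smooth_on_integral_curve\<close>, taken with the identity as \<open>h\<close>.\<close>

lemma one_param_subgroup_Exp: "one_param_subgroup N (\<lambda>t. Exp (t *\<^sub>R X))"
proof -
  have cont: "continuous_on UNIV (\<lambda>t :: real. Exp (t *\<^sub>R X))"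
    by (rule continuous_on_compose2[OF exp.continuous_Exp[of UNIV]]) (auto intro!: continuous_intros)
  have "smooth_on ((\<lambda>t. Exp (t *\<^sub>R X)) -` fst d) (\<lambda>t. snd d (Exp (t *\<^sub>R X)))" if d: "d \<in> A" for d
  proof (rule smooth_on_integral_curve[OF open_im[OF d] _ smooth_L[OF d, of X] smooth_on_ident[OF open_im[OF d]]])
    show "open ((\<lambda>t. Exp (t *\<^sub>R X)) -` fst d)"
      by (rule open_vimage[OF open_chart_domain[OF d] cont])
  qed (use d Exp_curve_has_vector_derivative chart_mem in auto)
  moreover have "Exp ((s + t) *\<^sub>R X) = Exp (s *\<^sub>R X) \<otimes> Exp (t *\<^sub>R X)" for s t
    by (simp add: bch_scaleR flip: exp.Exp_bch)
  ultimately show ?thesis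
    unfolding one_param_subgroup_def smooth_map_real_atlas using cont by blast
qed

section \<open>The global logarithm and the identification of \<open>lie_exp\<close>\<close>

definition Log :: "'g \<Rightarrow> 'a" where
  "Log = inv_into UNIV Exp"

lemma Log_Exp [simp]: "Log (Exp X) = X"
  using exp.bij_Exp by (simp add: Log_def bij_is_inj inv_f_f)

lemma Exp_Log [simp]: "Exp (Log p) = p"
  using exp.surj_Exp by (simp add: Log_def f_inv_into_f)

lemma Log_mult: "Log (p \<otimes> q) = Log p \<star> Log q"
  using Log_Exp[of "Log p \<star> Log q"] by (simp add: exp.Exp_bch)

lemma Log_one [simp]: "Log \<one> = 0"
  using Log_Exp[of 0] by simp

definition near_one :: "'g set" where
  "near_one = (\<lambda>X. chart_inv b (g X)) ` ball 0 \<rho>"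

lemma open_near_one: "open near_one"
  unfolding near_one_def by (rule exp.open_E)

lemma one_near_one: "\<one> \<in> near_one"
  unfolding near_one_def using radius_pos g_0 by (intro image_eqI[of _ _ 0]) auto

lemma Log_near_one:
  assumes "p \<in> near_one"
  shows "Log p = f (snd b p)"
proof -
  obtain X where X: "X \<in> ball 0 \<rho>" "p = chart_inv b (g X)"
    using assms by (auto simp: near_one_def)
  then have "Log p = X" using Exp_eq[OF X(1)] by (metis Log_Exp)
  then show ?thesis using X by (simp add: chart_chart_inv g_im f_g)
qed

text \<open>\<open>Log (\<sigma> s)\<close> is the product under \<open>\<star>\<close> of
  \<open>Log (\<sigma> t)\<close> and the logarithm of
  \<open>inv (\<sigma> t) \<otimes> \<sigma> s\<close>; the latter is near \<open>\<one>\<close>,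
  where \<open>f\<close> has the identity as derivative. This takes the place of the derivative of
  the exponential map.\<close>

lemma Log_curve_has_vector_derivative:
  fixes \<sigma> :: "real \<Rightarrow> 'g"
  assumes cont: "continuous_on UNIV \<sigma>"
    and der: "((\<lambda>s. snd b (inv (\<sigma> t) \<otimes> \<sigma> s)) has_vector_derivative \<xi>) (at t)"
  shows "((\<lambda>s. Log (\<sigma> s)) has_vector_derivative \<xi> + (1/2) *\<^sub>R lie_bracket N (Log (\<sigma> t)) \<xi>) (at t)"
proof -
  let ?I = "{s. inv (\<sigma> t) \<otimes> \<sigma> s \<in> near_one}"
  have I: "open ?I" "t \<in> ?I"
    using one_near_one cont
    by (auto intro!: open_Collect_mem_continuous open_near_one continuous_on_mult continuous_intros)
  let ?c = "Log (\<sigma> t)" and ?f = "\<lambda>s. f (snd b (inv (\<sigma> t) \<otimes> \<sigma> s))"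
  have 1: "(?f has_derivative (\<lambda>h. h *\<^sub>R \<xi>)) (at t)"
    using has_derivative_compose[OF der[unfolded has_vector_derivative_def], of f "\<lambda>u. u"] f_has_derivative by simp
  have "((\<lambda>s. ?c \<star> ?f s) has_derivative (\<lambda>h. 0 + h *\<^sub>R \<xi> +
      (1/2) *\<^sub>R (lie_bracket N ?c (h *\<^sub>R \<xi>) + lie_bracket N 0 (?f t)))) (at t)"
    unfolding bch_def
    by (intro has_derivative_add has_derivative_const has_derivative_scaleR_right br.FDERIV 1)
  then have "((\<lambda>s. ?c \<star> ?f s) has_derivative (\<lambda>h. h *\<^sub>R (\<xi> + (1/2) *\<^sub>R lie_bracket N ?c \<xi>))) (at t)"
    by (rule has_derivative_eq_rhs) (simp add: fun_eq_iff br.zero_left br.scaleR_right scaleR_add_right)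
  then have "((\<lambda>s. Log (\<sigma> s)) has_derivative (\<lambda>h. h *\<^sub>R (\<xi> + (1/2) *\<^sub>R lie_bracket N ?c \<xi>))) (at t)"
  proof (rule has_derivative_transform_within_open[OF _ I])
    fix s assume "s \<in> ?I"
    then have "?f s = Log (inv (\<sigma> t) \<otimes> \<sigma> s)" by (simp add: Log_near_one)
    then have "?c \<star> ?f s = Log (\<sigma> t \<otimes> (inv (\<sigma> t) \<otimes> \<sigma> s))" by (simp add: Log_mult)
    then show "?c \<star> ?f s = Log (\<sigma> s)" by (simp flip: m_assoc)
  qed
  then show ?thesis by (simp add: has_vector_derivative_def)
qed

text \<open>The logarithms of the subgroup commute under \<open>\<star>\<close>, so their brackets
  vanish and \<open>c\<close> is additive; its derivative at \<open>0\<close> then propagates to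
  every \<open>t\<close>.\<close>

lemma one_param_subgroup_eq_Exp:
  assumes \<gamma>: "one_param_subgroup N \<gamma>" and der: "((snd b \<circ> \<gamma>) has_vector_derivative X) (at 0)"
  shows "\<gamma> t = Exp (t *\<^sub>R X)"
proof -
  have add: "\<gamma> (s + t) = \<gamma> s \<otimes> \<gamma> t" for s t using \<gamma> by (simp add: one_param_subgroup_def)
  have cont: "continuous_on UNIV \<gamma>"
    using \<gamma> by (simp add: one_param_subgroup_def smooth_map_def)
  have "\<gamma> 0 = inv (\<gamma> 0) \<otimes> (\<gamma> 0 \<otimes> \<gamma> 0)" by (simp flip: m_assoc)
  then have \<gamma>0: "\<gamma> 0 = \<one>" using add[of 0 0] by simp
  define c where "c t = Log (\<gamma> t)" for t
  have c_bch: "c (s + t) = c s \<star> c t" for s t by (simp add: c_def add Log_mult)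
  have "c s \<star> c t = c t \<star> c s" for s t using c_bch[of s t] c_bch[of t s] by (simp add: add.commute)
  then have "lie_bracket N (c s) (c t) = 0" for s t
    using bracket_antisym[of "c t" "c s"] by (simp add: bch_def eq_neg_iff_add_eq_0 flip: scaleR_2)
  then have c_add: "c (s + t) = c s + c t" for s t by (simp add: c_bch bch_def)
  have c0: "c 0 = 0" by (simp add: c_def \<gamma>0)
  have "((\<lambda>s. snd b (inv (\<gamma> 0) \<otimes> \<gamma> s)) has_vector_derivative X) (at 0)"
    using der by (simp add: \<gamma>0 o_def)
  from Log_curve_has_vector_derivative[OF cont this]
  have dc0: "(c has_vector_derivative X) (at 0)" by (simp add: \<gamma>0 br.zero_left c_def[abs_def])
  have "(c has_vector_derivative X) (at t)" for t
  proof -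
    have "((\<lambda>s. s - t) has_vector_derivative 1) (at t)" by (auto intro!: derivative_eq_intros)
    from vector_diff_chain_at[OF this, of c X] dc0
    have "((\<lambda>s. c (s - t)) has_vector_derivative X) (at t)" by (simp add: o_def)
    then have "((\<lambda>s. c (s - t) + c t) has_vector_derivative X) (at t)"
      by (auto intro!: derivative_eq_intros)
    then show ?thesis by (simp flip: c_add)
  qed
  then have "((\<lambda>t. c t - t *\<^sub>R X) has_derivative (\<lambda>h. 0)) (at t)" for t
    unfolding has_vector_derivative_def by (auto intro!: derivative_eq_intros)
  then have "c t - t *\<^sub>R X = c 0 - 0 *\<^sub>R X"
    by (intro has_derivative_zero_imp_eq[of UNIV]) auto
  then have "c t = t *\<^sub>R X" by (simp add: c0)
  then show ?thesis using Exp_Log[of "\<gamma> t"] by (simp add: c_def)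
qed

lemma lie_exp_eq_Exp: "lie_exp N X = Exp X"
proof -
  have "(THE \<gamma>. one_param_subgroup N \<gamma> \<and> ((snd b \<circ> \<gamma>) has_vector_derivative X) (at 0)) = (\<lambda>t. Exp (t *\<^sub>R X))"
  proof (rule the_equality)
    show "one_param_subgroup N (\<lambda>t. Exp (t *\<^sub>R X)) \<and>
        ((snd b \<circ> (\<lambda>t. Exp (t *\<^sub>R X))) has_vector_derivative X) (at 0)"
      using one_param_subgroup_Exp Exp_curve_has_vector_derivative[of b 0 X] by (simp add: o_def)
  qed (use one_param_subgroup_eq_Exp in blast)
  then show ?thesis by (simp add: lie_exp_def)
qed

text \<open>Translating the curve itself back to the identity lets the single chart \<open>b\<close>
  serve at every point.\<close>

definition velocity :: "(real \<Rightarrow> 'g) \<Rightarrow> real \<Rightarrow> 'a" where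
  "velocity \<sigma> t = vector_derivative (\<lambda>s. snd b (inv (\<sigma> t) \<otimes> \<sigma> s)) (at t)"

lemma
  assumes \<sigma>: "smooth_map real_atlas A \<sigma>" and k: "k \<in> A" "\<sigma> t \<in> fst k"
  shows velocity_has_vector_derivative:
      "((\<lambda>s. snd b (inv (\<sigma> t) \<otimes> \<sigma> s)) has_vector_derivative velocity \<sigma> t) (at t)"
    and velocity_eq: "velocity \<sigma> t = T k (snd k (\<sigma> t)) (vector_derivative (\<lambda>s. snd k (\<sigma> s)) (at t))"
    and chart_curve_differentiable:
      "((\<lambda>s. snd k (\<sigma> s)) has_vector_derivative vector_derivative (\<lambda>s. snd k (\<sigma> s)) (at t)) (at t)"
proof -
  let ?I = "\<sigma> -` fst k" and ?\<kappa> = "\<lambda>s. snd k (\<sigma> s)"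
  have cont: "continuous_on UNIV \<sigma>" and sm: "smooth_on ?I ?\<kappa>"
    using \<sigma> k by (auto simp: smooth_map_real_atlas)
  have I: "open ?I" "t \<in> ?I"
    using open_vimage[OF open_chart_domain[OF k(1)] cont] k by auto
  have "?\<kappa> differentiable (at t)"
    using smooth_on_imp_has_derivative[OF sm I(2)] differentiable_def by blast
  then show \<kappa>: "(?\<kappa> has_vector_derivative vector_derivative ?\<kappa> (at t)) (at t)"
    using vector_derivative_works by blast
  let ?p = "inv (\<sigma> t)"
  have 1: "((\<lambda>y. snd b (?p \<otimes> chart_inv k y)) has_derivative dleft ?p k b (\<sigma> t)) (at (?\<kappa> t))"
    by (rule dleft_has_derivative) (use k in auto)
  have "((\<lambda>s. snd b (?p \<otimes> chart_inv k (?\<kappa> s))) has_derivative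
      (\<lambda>h. dleft ?p k b (\<sigma> t) (h *\<^sub>R vector_derivative ?\<kappa> (at t)))) (at t)"
    by (rule has_derivative_compose[OF \<kappa>[unfolded has_vector_derivative_def] 1])
  then have "((\<lambda>s. snd b (?p \<otimes> \<sigma> s)) has_derivative
      (\<lambda>h. dleft ?p k b (\<sigma> t) (h *\<^sub>R vector_derivative ?\<kappa> (at t)))) (at t)"
    by (rule has_derivative_transform_within_open[OF _ I]) (use k in \<open>simp add: chart_inv_chart\<close>)
  moreover have "dleft ?p k b (\<sigma> t) (h *\<^sub>R v) = h *\<^sub>R T k (?\<kappa> t) v" for h v
    using linear_cmul[OF linear_dleft[of k b "\<sigma> t" ?p]] k
    by (simp add: T_def chart_inv_chart to_lie_eq_dleft)
  ultimately have 2: "((\<lambda>s. snd b (?p \<otimes> \<sigma> s)) has_vector_derivative T k (?\<kappa> t) (vector_derivative ?\<kappa> (at t))) (at t)"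
    by (simp add: has_vector_derivative_def)
  then show "velocity \<sigma> t = T k (?\<kappa> t) (vector_derivative ?\<kappa> (at t))"
    by (simp add: velocity_def vector_derivative_at)
  with 2 show "((\<lambda>s. snd b (?p \<otimes> \<sigma> s)) has_vector_derivative velocity \<sigma> t) (at t)" by simp
qed

section \<open>Magnetic trajectories\<close>

lemma metric_eq: "metric N k y u v = T k y u \<bullet> T k y v"
  by (simp add: metric_def T_def)

lemma frechet_derivative_metric:
  assumes "k \<in> A" "x \<in> im k"
  shows "frechet_derivative (\<lambda>y. metric N k y u v) (at x) w =
    T k x u \<bullet> DT k x w v + DT k x w u \<bullet> T k x v"
proof -
  have "((\<lambda>y. T k y u \<bullet> T k y v) has_derivative (\<lambda>w. T k x u \<bullet> DT k x w v + DT k x w u \<bullet> T k x v)) (at x)"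
    by (intro has_derivative_inner DT_has_derivative assms)
  from frechet_derivative_at[OF this] show ?thesis by (simp add: metric_eq fun_eq_iff)
qed

text \<open>The Maurer--Cartan equation turns \<open>DT k x w v\<close> into
  \<open>DT k x v w\<close> plus a bracket, after which the terms \<open>DT k x v w\<close> cancel.
  What remains is the derivative of the form along \<open>v\<close> and the coadjoint term. An
  acceleration needs only equal arguments.\<close>

lemma christoffel_eq:
  assumes k: "k \<in> A" "x \<in> im k"
  shows "2 * metric N k x (christoffel (metric N k) x v v) w =
     2 * (DT k x v v \<bullet> T k x w - T k x v \<bullet> lie_bracket N (T k x v) (T k x w))"
proof -
  let ?R = "\<lambda>w. frechet_derivative (\<lambda>y. metric N k y v w) (at x) v
     + frechet_derivative (\<lambda>y. metric N k y v w) (at x) v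
     - frechet_derivative (\<lambda>y. metric N k y v v) (at x) w"
  have R: "?R w = 2 * (DT k x v v \<bullet> T k x w - T k x v \<bullet> lie_bracket N (T k x v) (T k x w))" for w
  proof -
    have "DT k x w v = DT k x v w + lie_bracket N (T k x v) (T k x w)"
      using maurer_cartan[OF k, of v w] by (simp add: algebra_simps)
    then show ?thesis
      by (simp add: frechet_derivative_metric[OF k] inner_add_right inner_commute algebra_simps)
  qed
  define r where "r Y = 2 * (DT k x v v \<bullet> Y - T k x v \<bullet> lie_bracket N (T k x v) Y)" for Y
  have lin: "linear r"
    unfolding r_def by (rule linearI) (simp_all add: inner_add_right br.add_right br.scaleR_right algebra_simps)
  \<comment> \<open>The Riesz representative of half the functional \<open>r\<close>, carried to the
    chart by \<open>L k x\<close>; it is the value of the definite description in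
    \<open>christoffel\<close>.\<close>
  define a where "a = L k x ((1/2) *\<^sub>R (\<Sum>i\<in>Basis. r i *\<^sub>R i))"
  have Ta: "2 * (T k x a \<bullet> Y) = r Y" for Y
    using linear_basis_expansion[OF lin, of Y]
    by (simp add: a_def T_L[OF k] inner_sum_left inner_sum_right inner_commute mult.commute)
  have ex: "2 * metric N k x a w = ?R w" for w
    unfolding R using Ta[of "T k x w"] by (simp add: metric_eq r_def)
  have "christoffel (metric N k) x v v = a"
    unfolding christoffel_def
  proof (rule the_equality)
    show "\<forall>w. 2 * metric N k x a w = ?R w" using ex by blast
    fix a' assume a': "\<forall>w. 2 * metric N k x a' w = ?R w"
    have "T k x a' \<bullet> Y = T k x a \<bullet> Y" for Y
      using a'[rule_format, of "L k x Y"] ex[of "L k x Y"] by (simp add: metric_eq T_L[OF k])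
    then have "T k x a' = T k x a" by (rule vector_eq_rdot[THEN iffD1, rule_format])
    then show "a' = a" using L_T[OF k] by metis
  qed
  then show ?thesis using ex R by simp
qed

text \<open>The component of the Euler--Arnold equation along the center: the coadjoint term
  \<open>\<langle>\<xi>, [\<xi>, z]\<rangle>\<close> vanishes.\<close>

lemma magnetic_trajectory_central_momentum:
  assumes \<sigma>: "magnetic_trajectory N F q \<sigma>" and z: "z \<in> center"
  shows "((\<lambda>t. velocity \<sigma> t \<bullet> z) has_real_derivative q * (F (velocity \<sigma> t) \<bullet> z)) (at t)"
proof -
  have sm\<sigma>: "smooth_map real_atlas A \<sigma>" using \<sigma> by (simp add: magnetic_trajectory_def)
  obtain k where k: "k \<in> A" "\<sigma> t \<in> fst k" using chart_cover by blast
  let ?I = "\<sigma> -` fst k" and ?\<kappa> = "\<lambda>s. snd k (\<sigma> s)"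
  let ?\<kappa>' = "\<lambda>s. vector_derivative ?\<kappa> (at s)"
  have cont: "continuous_on UNIV \<sigma>" and sm: "smooth_on ?I ?\<kappa>"
    using sm\<sigma> k by (auto simp: smooth_map_real_atlas)
  have I: "open ?I" "t \<in> ?I"
    using open_vimage[OF open_chart_domain[OF k(1)] cont] k by auto
  define x v where "x = ?\<kappa> t" and "v = ?\<kappa>' t"
  have x: "x \<in> im k" using k by (simp add: x_def chart_mem)
  have d\<kappa>: "(?\<kappa> has_vector_derivative ?\<kappa>' s) (at s)" if "s \<in> ?I" for s
    using chart_curve_differentiable[OF sm\<sigma> k(1)] that by simp
  have "frechet_derivative ?\<kappa> (at s) 1 = ?\<kappa>' s" if "s \<in> ?I" for s
    using frechet_derivative_at[OF d\<kappa>[OF that, unfolded has_vector_derivative_def], symmetric] by simp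
  then have "smooth_on ?I ?\<kappa>'"
    by (rule smooth_on_cong[OF I(1) _ smooth_on_frechet_derivative[OF sm, of 1]])
  from smooth_on_imp_has_derivative[OF this I(2)]
  have "?\<kappa>' differentiable (at t)" using differentiable_def by blast
  then obtain \<kappa>'' where \<kappa>'': "(?\<kappa>' has_vector_derivative \<kappa>'') (at t)"
    using vector_derivative_works by blast
  let ?\<Gamma> = "christoffel (metric N k) x v v"
  have "covariant_acceleration (metric N k) (snd k \<circ> \<sigma>) t = \<kappa>'' + ?\<Gamma>"
    using vector_derivative_at[OF \<kappa>''] by (simp add: covariant_acceleration_def o_def x_def v_def)
  moreover have "left_inv_tensor N F k (\<sigma> t) (vector_derivative (snd k \<circ> \<sigma>) (at t)) = L k x (F (T k x v))"
    using k by (simp add: left_inv_tensor_def L_def T_def x_def v_def chart_inv_chart o_def)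
  ultimately have eq: "\<kappa>'' + ?\<Gamma> = q *\<^sub>R L k x (F (T k x v))"
    using \<sigma> k by (simp add: magnetic_trajectory_def)
  have "T k x \<kappa>'' + T k x ?\<Gamma> = q *\<^sub>R F (T k x v)"
    using arg_cong[OF eq, of "T k x"]
    by (simp add: linear_add[OF linear_T] linear_cmul[OF linear_T] T_L k x)
  then have "T k x \<kappa>'' \<bullet> z + T k x ?\<Gamma> \<bullet> z = q * (F (T k x v) \<bullet> z)"
    by (metis inner_add_left inner_scaleR_left)
  moreover have "T k x ?\<Gamma> \<bullet> z = DT k x v v \<bullet> z"
    using christoffel_eq[OF k(1) x, of v "L k x z"] z by (simp add: metric_eq T_L k x center_bracket)
  \<comment> \<open>The bracketed vector is the derivative at \<open>t\<close> of
    \<open>T k (?\<kappa> s) (?\<kappa>' s)\<close>, that is, of the velocity.\<close>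
  ultimately have eqz: "(DT k x v v + T k x \<kappa>'') \<bullet> z = q * (F (T k x v) \<bullet> z)"
    by (simp add: inner_add_left)
  have "((\<lambda>s. T k (?\<kappa> s) (?\<kappa>' s)) has_derivative (\<lambda>h. DT k x (h *\<^sub>R v) (?\<kappa>' t) + T k (?\<kappa> t) (h *\<^sub>R \<kappa>''))) (at t)"
  proof (rule has_derivative_linear_family[OF I, where A="\<lambda>s. T k (?\<kappa> s)" and w="?\<kappa>'"
        and A'="\<lambda>u h. DT k x (h *\<^sub>R v) u" and w'="\<lambda>h. h *\<^sub>R \<kappa>''"])
    show "linear (T k (?\<kappa> s))" if "s \<in> ?I" for s using that k by (simp add: linear_T chart_mem)
    show "((\<lambda>s. T k (?\<kappa> s) u) has_derivative (\<lambda>h. DT k x (h *\<^sub>R v) u)) (at t)" for u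
      unfolding x_def v_def
      by (rule has_derivative_compose[OF d\<kappa>[OF I(2), unfolded has_vector_derivative_def]
            DT_has_derivative[OF k(1) x[unfolded x_def]]])
    show "(?\<kappa>' has_derivative (\<lambda>h. h *\<^sub>R \<kappa>'')) (at t)"
      using \<kappa>'' by (simp add: has_vector_derivative_def)
  qed
  then have "((\<lambda>s. T k (?\<kappa> s) (?\<kappa>' s)) has_derivative (\<lambda>h. h *\<^sub>R (DT k x v v + T k x \<kappa>''))) (at t)"
    by (rule has_derivative_eq_rhs)
      (simp add: fun_eq_iff linear_cmul[OF linear_DT(1)] linear_cmul[OF linear_T] k x scaleR_add_right
        flip: x_def v_def)
  then have "(velocity \<sigma> has_derivative (\<lambda>h. h *\<^sub>R (DT k x v v + T k x \<kappa>''))) (at t)"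
    by (rule has_derivative_transform_within_open[OF _ I]) (use velocity_eq[OF sm\<sigma> k(1)] in simp)
  from has_derivative_inner_left[OF this, of z]
  have "((\<lambda>t. velocity \<sigma> t \<bullet> z) has_derivative (*) (q * (F (T k x v) \<bullet> z))) (at t)"
    by (rule has_derivative_eq_rhs) (simp add: eqz fun_eq_iff)
  moreover have "T k x v = velocity \<sigma> t"
    using velocity_eq[OF sm\<sigma> k] by (simp add: x_def v_def)
  ultimately show ?thesis by (simp add: has_field_derivative_def)
qed

text \<open>Closedness at the identity on \<open>X\<close>, \<open>Y\<close>, \<open>z\<close>: the
  Maurer--Cartan equation produces brackets, those with \<open>z\<close> vanish, and skew-symmetry
  cancels the remaining derivatives, leaving only the bracket of \<open>X\<close> and
  \<open>Y\<close>.\<close>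

lemma lorentz_force_bracket_central:
  assumes F: "lorentz_force N F" and z: "z \<in> center"
  shows "F (lie_bracket N X Y) \<bullet> z = 0"
proof -
  have lin: "linear F" and skew: "F X \<bullet> Y = - (X \<bullet> F Y)" for X Y
    using F by (auto simp: lorentz_force_def)
  let ?\<omega> = "\<lambda>y u v. metric N b y (left_inv_tensor N F b (chart_inv b y) u) v"
  have \<omega>: "?\<omega> y u v = F (T b y u) \<bullet> T b y v" if "y \<in> im b" for y u v
    using that T_L[of b y] by (simp add: metric_eq left_inv_tensor_def L_def T_def)
  have d\<omega>: "frechet_derivative (\<lambda>y. ?\<omega> y u v) (at e) w = F u \<bullet> DT b e w v + F (DT b e w u) \<bullet> v" for u v w
  proof -
    have "((\<lambda>y. F (T b y u) \<bullet> T b y v) has_derivative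
        (\<lambda>w. F (T b e u) \<bullet> DT b e w v + F (DT b e w u) \<bullet> T b e v)) (at e)"
      using linear_conv_bounded_linear lin
      by (intro has_derivative_inner bounded_linear.has_derivative[of F] DT_has_derivative) auto
    then have "((\<lambda>y. ?\<omega> y u v) has_derivative (\<lambda>w. F u \<bullet> DT b e w v + F (DT b e w u) \<bullet> v)) (at e)"
      using has_derivative_transform_within_open[OF _ open_im[OF base_in_atlas] e_in_im, of
          "\<lambda>y. F (T b y u) \<bullet> T b y v" _ UNIV "\<lambda>y. ?\<omega> y u v"] \<omega> by simp
    from frechet_derivative_at[OF this] show ?thesis by (simp add: fun_eq_iff)
  qed
  have closed: "frechet_derivative (\<lambda>y. ?\<omega> y Y z) (at e) X - frechet_derivative (\<lambda>y. ?\<omega> y X z) (at e) Y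
      + frechet_derivative (\<lambda>y. ?\<omega> y X Y) (at e) z = 0"
    using F e_in_im unfolding lorentz_force_def closed_two_form_on_def im_def[symmetric]
    using base_in_atlas by blast
  have mc: "DT b e X Y = DT b e Y X - lie_bracket N X Y" "DT b e X z = DT b e z X" "DT b e Y z = DT b e z Y"
    using maurer_cartan[of b e X Y] maurer_cartan[of b e X z] maurer_cartan[of b e Y z] center_bracket[OF z]
    by (simp_all add: algebra_simps)
  have sk: "F Y \<bullet> DT b e z X = - (F (DT b e z X) \<bullet> Y)" "F X \<bullet> DT b e z Y = - (F (DT b e z Y) \<bullet> X)"
    using skew[of "DT b e z X" Y] skew[of "DT b e z Y" X] by (simp_all add: inner_commute)
  show ?thesis
    using closed by (simp add: d\<omega> mc sk linear_diff[OF lin] inner_diff_left)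
qed

text \<open>Modulo the commutator the center is at most a line, and a skew form vanishes on a line.
  Pairings with commutator elements vanish by \<open>lorentz_force_bracket_central\<close>, and by
  skew-symmetry in the other slot.\<close>

lemma lorentz_force_central_central:
  assumes F: "lorentz_force N F" and dim: "dim (lie_center N) \<le> dim (lie_commutator N) + 1"
    and z: "z \<in> center" "z' \<in> center"
  shows "F z \<bullet> z' = 0"
proof -
  have lin: "linear F" and skew: "F X \<bullet> Y = - (X \<bullet> F Y)" for X Y
    using F by (auto simp: lorentz_force_def)
  let ?C = "lie_commutator N"
  have C: "subspace ?C" by (simp add: lie_commutator_def)
  have sub: "?C \<subseteq> center"
    unfolding lie_commutator_def by (rule span_minimal[OF _ subspace_center]) (auto simp: bracket_in_center)
  have FC: "F c \<bullet> w = 0" if "c \<in> ?C" "w \<in> center" for c w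
    using that(1) unfolding lie_commutator_def
  proof (induction rule: span_induct)
    show "subspace {x. F x \<bullet> w = 0}"
      by (auto simp: subspace_def linear_0[OF lin] linear_add[OF lin] linear_cmul[OF lin] inner_add_left)
  qed (use lorentz_force_bracket_central[OF F that(2)] in auto)
  have FC': "F w \<bullet> c = 0" if "c \<in> ?C" "w \<in> center" for c w
    using FC[OF that] skew[of w c] by (simp add: inner_commute)
  show ?thesis
  proof (cases "center \<subseteq> ?C")
    case True
    then show ?thesis using FC z by blast
  next
    case False
    then obtain t where t: "t \<in> center" "t \<notin> ?C" by blast
    \<comment> \<open>One extra vector already reaches the dimension that the hypothesis allows the
      center, so nothing else is missing.\<close>
    have "dim (insert t ?C) = dim ?C + 1"
      using t C by (simp add: dim_insert span_eq_iff[THEN iffD2])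
    then have "dim center \<le> dim (insert t ?C)" using dim by (simp add: lie_center_eq)
    moreover have "insert t ?C \<subseteq> center" using t sub by blast
    ultimately have "span (insert t ?C) = span center" by (metis dim_eq_span)
    then have "span (insert t ?C) = center" using subspace_center span_eq_iff by metis
    then have "\<exists>a. z - a *\<^sub>R t \<in> ?C" "\<exists>a. z' - a *\<^sub>R t \<in> ?C"
      using z C by (auto simp: span_insert span_eq_iff[THEN iffD2])
    then obtain a a' where a: "z - a *\<^sub>R t \<in> ?C" "z' - a' *\<^sub>R t \<in> ?C" by blast
    have tt: "F t \<bullet> t = 0" using skew[of t t] by (simp add: inner_commute)
    \<comment> \<open>Both arguments are split along \<open>t\<close>: the first two terms contain a
      commutator element, the last is \<open>0\<close> by skew-symmetry.\<close>
    have "F z \<bullet> z' = F (z - a *\<^sub>R t) \<bullet> z' + a * (F t \<bullet> (z' - a' *\<^sub>R t)) + a * a' * (F t \<bullet> t)"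
      by (simp add: linear_diff[OF lin] linear_cmul[OF lin] algebra_simps)
    then show ?thesis using FC[OF a(1) z(2)] FC'[OF a(2) t(1)] tt by simp
  qed
qed

end

section \<open>Conserved momentum and periodicity\<close>

locale magnetic_curve = exp_chart N f g \<rho>
  for N :: "('g::{t2_space, second_countable_topology}, 'a::euclidean_space) lie_structure" (structure)
    and f g \<rho> +
  fixes F :: "'a \<Rightarrow> 'a" and q :: real and \<sigma> :: "real \<Rightarrow> 'g" and V Z :: "real \<Rightarrow> 'a"
  assumes dim_center: "dim (lie_center N) \<le> dim (lie_commutator N) + 1"
    and lorentz: "lorentz_force N F"
    and magnetic: "magnetic_trajectory N F q \<sigma>"
    and start: "\<sigma> 0 = \<one>"
    and \<sigma>_eq: "\<And>t. \<sigma> t = lie_exp N (V t + Z t)"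
    and V: "\<And>t. V t \<in> orthogonal_comp (lie_center N)"
    and Z: "\<And>t. Z t \<in> lie_center N"
begin

abbreviation "\<xi> \<equiv> velocity \<sigma>"

lemma linear_F: "linear F"
  using lorentz by (simp add: lorentz_force_def)

lemma Log_\<sigma>: "Log (\<sigma> t) = V t + Z t"
  by (simp add: \<sigma>_eq lie_exp_eq_Exp)

lemma V_eq: "V t = nproj (Log (\<sigma> t))"
  using V[of t] Z[of t] by (simp add: Log_\<sigma> nproj_add nproj_orthogonal lie_center_eq)

lemma V_0: "V 0 = 0"
  by (simp add: V_eq start linear_0[OF linear_nproj])

lemma smooth_\<sigma>: "smooth_map real_atlas A \<sigma>"
  using magnetic by (simp add: magnetic_trajectory_def)

lemma continuous_\<sigma>: "continuous_on UNIV \<sigma>"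
  using smooth_\<sigma> by (simp add: smooth_map_def)

lemma Log_\<sigma>_has_vector_derivative:
  "((\<lambda>s. Log (\<sigma> s)) has_vector_derivative \<xi> t + (1/2) *\<^sub>R lie_bracket N (Log (\<sigma> t)) (\<xi> t)) (at t)"
proof -
  obtain k where "k \<in> A" "\<sigma> t \<in> fst k" using chart_cover by blast
  then show ?thesis
    by (intro Log_curve_has_vector_derivative continuous_\<sigma> velocity_has_vector_derivative[OF smooth_\<sigma>])
qed

lemma V_has_vector_derivative: "(V has_vector_derivative nproj (\<xi> t)) (at t)"
proof -
  have "((\<lambda>s. nproj (Log (\<sigma> s))) has_vector_derivative
      nproj (\<xi> t + (1/2) *\<^sub>R lie_bracket N (Log (\<sigma> t)) (\<xi> t))) (at t)"
    by (rule bounded_linear.has_vector_derivative[OF bounded_linear_nproj Log_\<sigma>_has_vector_derivative])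
  then show ?thesis by (simp add: V_eq[abs_def] nproj_add nproj_scaleR)
qed

lemma V_deriv: "vector_derivative V (at t) = nproj (\<xi> t)"
  by (rule vector_derivative_at[OF V_has_vector_derivative])

text \<open>Lets \<open>V'\<close> replace the full velocity in the momentum equation, whose right
  side thereby becomes the derivative of a function of \<open>V\<close>.\<close>

lemma F_nproj: "z \<in> center \<Longrightarrow> F (nproj X) \<bullet> z = F X \<bullet> z"
  using lorentz_force_central_central[OF lorentz dim_center diff_nproj_in_center[of X], of z]
  by (simp add: linear_diff[OF linear_F] inner_diff_left)

text \<open>Since \<open>F\<close> maps the center to its orthogonal complement, the central momentum integrates to a
  conserved quantity.\<close>

lemma central_momentum_conserved:
  assumes z: "z \<in> center"
  shows "\<xi> t \<bullet> z - q * (F (V t) \<bullet> z) = \<xi> s \<bullet> z - q * (F (V s) \<bullet> z)"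
proof -
  have blF: "bounded_linear F" using linear_F linear_conv_bounded_linear by blast
  have "((\<lambda>t. \<xi> t \<bullet> z - q * (F (V t) \<bullet> z)) has_derivative (\<lambda>h. 0)) (at t)" for t
  proof -
    have "((\<lambda>t. F (V t)) has_derivative (\<lambda>h. h *\<^sub>R F (nproj (\<xi> t)))) (at t)"
      using bounded_linear.has_vector_derivative[OF blF V_has_vector_derivative]
      by (simp add: has_vector_derivative_def)
    from has_derivative_mult_right[OF has_derivative_inner_left[OF this]]
    have "((\<lambda>t. q * (F (V t) \<bullet> z)) has_derivative (\<lambda>h. q * (h *\<^sub>R F (nproj (\<xi> t)) \<bullet> z))) (at t)" .
    from has_derivative_diff[OF magnetic_trajectory_central_momentum[OF magnetic z, unfolded has_field_derivative_def] this]
    show ?thesis by (rule has_derivative_eq_rhs) (simp add: F_nproj[OF z] fun_eq_iff)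
  qed
  then show ?thesis using has_derivative_zero_imp_eq[of UNIV t s] by auto
qed

lemma F_center_eq_0_iff: "F_center N F W = 0 \<longleftrightarrow> (\<forall>z\<in>center. F W \<bullet> z = 0)"
proof
  assume "F_center N F W = 0"
  then show "\<forall>z\<in>center. F W \<bullet> z = 0"
    using orth_proj_inner[OF subspace_center, of _ "F W"] by (auto simp: F_center_def lie_center_eq)
next
  assume "\<forall>z\<in>center. F W \<bullet> z = 0"
  then have "F W \<in> orthogonal_comp center"
    by (auto simp: orthogonal_comp_def orthogonal_def inner_commute)
  then show "F_center N F W = 0"
    by (simp add: F_center_def lie_center_eq orth_proj_eqI[OF subspace_center subspace_0[OF subspace_center]])
qed

lemma periodic_imp:
  assumes "q \<noteq> 0" and W1: "W1 \<in> orthogonal_comp (lie_center N)" and Z1: "Z1 \<in> lie_center N"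
    and per: "translation_periodic N (lie_exp N (W1 + Z1)) \<sigma> \<omega>"
  shows "F_center N F W1 = 0" "periodic_of_period (\<lambda>t. vector_derivative V (at t)) \<omega>"
proof -
  define l where "l = lie_exp N (W1 + Z1)"
  have shift: "\<sigma> (t + \<omega>) = l \<otimes> \<sigma> t" and "\<omega> \<noteq> 0" for t
    using per by (simp_all add: translation_periodic_def l_def)
  have "nproj (Log l) = W1"
    using W1 Z1 by (simp add: l_def lie_exp_eq_Exp nproj_add nproj_orthogonal lie_center_eq)
  then have V_shift: "V (t + \<omega>) = W1 + V t" for t
    by (simp add: V_eq shift Log_mult nproj_bch)
  have \<xi>_shift: "\<xi> (t + \<omega>) = \<xi> t" for t
  proof -
    obtain k where k: "k \<in> A" "\<sigma> (t + \<omega>) \<in> fst k" using chart_cover by blast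
    \<comment> \<open>The factor \<open>l\<close> cancels in the quotient, so both times give the
      same curve through the identity.\<close>
    have "inv (\<sigma> (t + \<omega>)) \<otimes> \<sigma> (s + \<omega>) = inv (\<sigma> t) \<otimes> \<sigma> s" for s
      by (simp add: shift inv_mult_group m_assoc) (simp flip: m_assoc)
    then have "((\<lambda>s. snd b (inv (\<sigma> t) \<otimes> \<sigma> s)) has_vector_derivative \<xi> (t + \<omega>)) (at t)"
      using has_vector_derivative_shift[OF velocity_has_vector_derivative[OF smooth_\<sigma> k]] by simp
    then show ?thesis unfolding velocity_def[of \<sigma> t] by (simp add: vector_derivative_at)
  qed
  show "periodic_of_period (\<lambda>t. vector_derivative V (at t)) \<omega>"
    using \<open>\<omega> \<noteq> 0\<close> by (simp add: periodic_of_period_def V_deriv \<xi>_shift)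
  \<comment> \<open>Between the times \<open>0\<close> and \<open>\<omega>\<close> the conserved
    quantity could change only by \<open>q * (F W1 \<bullet> z)\<close>. The time is written
    \<open>0 + \<omega>\<close> so that the shift rules apply to it.\<close>
  have "F W1 \<bullet> z = 0" if "z \<in> center" for z
    using central_momentum_conserved[OF that, of "0 + \<omega>" 0] \<open>q \<noteq> 0\<close>
    by (simp only: V_shift \<xi>_shift) (simp add: linear_add[OF linear_F] inner_add_left)
  then show "F_center N F W1 = 0" by (simp add: F_center_eq_0_iff)
qed

lemma periodic_if:
  assumes per: "periodic_of_period (\<lambda>t. vector_derivative V (at t)) \<omega>" and ker: "F_center N F (V \<omega>) = 0"
  shows "lie_exp N (V \<omega> + Z \<omega>) \<otimes> \<sigma> t = \<sigma> (t + \<omega>)"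
proof -
  have n\<xi>: "nproj (\<xi> (t + \<omega>)) = nproj (\<xi> t)" for t
    using per by (simp add: periodic_of_period_def V_deriv)
  have "((\<lambda>t. V (t + \<omega>) - V t) has_vector_derivative nproj (\<xi> (t + \<omega>)) - nproj (\<xi> t)) (at t)" for t
    by (intro has_vector_derivative_diff has_vector_derivative_shift V_has_vector_derivative)
  then have "((\<lambda>t. V (t + \<omega>) - V t) has_derivative (\<lambda>h. 0)) (at t)" for t
    by (simp add: n\<xi> has_vector_derivative_def)
  then have V_shift: "V (t + \<omega>) = V t + V \<omega>" for t
    using has_derivative_zero_imp_eq[of UNIV t 0 "\<lambda>t. V (t + \<omega>) - V t"] V_0 by (simp add: algebra_simps)
  have \<xi>_shift: "\<xi> (t + \<omega>) = \<xi> t" for t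
  proof -
    \<comment> \<open>Periodicity of \<open>V'\<close> puts this difference into the center, the
      conservation law makes it orthogonal to the center; so it is orthogonal to itself.\<close>
    let ?d = "\<xi> (t + \<omega>) - \<xi> t"
    have "?d \<bullet> z = 0" if "z \<in> center" for z
    proof -
      have "F (V \<omega>) \<bullet> z = 0" using ker that by (simp add: F_center_eq_0_iff)
      then show ?thesis
        using central_momentum_conserved[OF that, of "t + \<omega>" t]
        by (simp add: V_shift linear_add[OF linear_F] inner_add_left inner_diff_left)
    qed
    moreover have "?d \<in> center"
      by (rule nproj_eq_0_imp) (simp add: nproj_diff n\<xi>)
    ultimately have "?d \<bullet> ?d = 0" by blast
    then show ?thesis by simp
  qed
  let ?c = "Log (\<sigma> \<omega>)"
  \<comment> \<open>Both curves have the left logarithmic derivative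
    \<open>h *\<^sub>R \<xi> t\<close>, and they agree at \<open>0\<close> because
    \<open>\<sigma> 0 = \<one>\<close>.\<close>
  have "Log (\<sigma> (t + \<omega>)) = ?c \<star> Log (\<sigma> t)"
  proof (rule logarithmic_derivative_unique[of UNIV 0 t "\<lambda>t. Log (\<sigma> (t + \<omega>))" "\<lambda>t h. h *\<^sub>R \<xi> t" "\<lambda>t. ?c \<star> Log (\<sigma> t)"])
    fix t
    have 1: "((\<lambda>s. Log (\<sigma> s)) has_derivative (\<lambda>h. h *\<^sub>R (\<xi> t + (1/2) *\<^sub>R lie_bracket N (Log (\<sigma> t)) (\<xi> t)))) (at t)" for t
      using Log_\<sigma>_has_vector_derivative by (simp add: has_vector_derivative_def)
    have "((\<lambda>t. Log (\<sigma> (t + \<omega>))) has_vector_derivative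
        \<xi> (t + \<omega>) + (1/2) *\<^sub>R lie_bracket N (Log (\<sigma> (t + \<omega>))) (\<xi> (t + \<omega>))) (at t)"
      by (rule has_vector_derivative_shift[OF Log_\<sigma>_has_vector_derivative])
    then show "((\<lambda>t. Log (\<sigma> (t + \<omega>))) has_derivative
        (\<lambda>h. h *\<^sub>R \<xi> t + (1/2) *\<^sub>R lie_bracket N (Log (\<sigma> (t + \<omega>))) (h *\<^sub>R \<xi> t))) (at t)"
      unfolding has_vector_derivative_def
      by (rule has_derivative_eq_rhs) (simp add: fun_eq_iff \<xi>_shift br.scaleR_right scaleR_add_right)
    have "((\<lambda>t. ?c \<star> Log (\<sigma> t)) has_derivative (\<lambda>h. 0 + h *\<^sub>R (\<xi> t + (1/2) *\<^sub>R lie_bracket N (Log (\<sigma> t)) (\<xi> t)) +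
        (1/2) *\<^sub>R (lie_bracket N ?c (h *\<^sub>R (\<xi> t + (1/2) *\<^sub>R lie_bracket N (Log (\<sigma> t)) (\<xi> t))) +
          lie_bracket N 0 (Log (\<sigma> t))))) (at t)"
      unfolding bch_def
      by (intro has_derivative_add has_derivative_const has_derivative_scaleR_right br.FDERIV 1)
    then show "((\<lambda>t. ?c \<star> Log (\<sigma> t)) has_derivative
        (\<lambda>h. h *\<^sub>R \<xi> t + (1/2) *\<^sub>R lie_bracket N (?c \<star> Log (\<sigma> t)) (h *\<^sub>R \<xi> t))) (at t)"
      by (rule has_derivative_eq_rhs)
        (simp add: bch_def br.add_left br.add_right br.scaleR_left br.scaleR_right br.zero_left
          bracket_nilpotent algebra_simps fun_eq_iff)
  qed (simp_all add: start)
  then have "Log (\<sigma> (t + \<omega>)) = Log (\<sigma> \<omega> \<otimes> \<sigma> t)" by (simp add: Log_mult)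
  then have "\<sigma> (t + \<omega>) = \<sigma> \<omega> \<otimes> \<sigma> t" by (metis Exp_Log)
  then show ?thesis by (simp flip: \<sigma>_eq)
qed

end

text \<open>For \<open>q = 0\<close> the equation of motion does not involve \<open>F\<close> and
  says nothing about \<open>F W1\<close>, hence the nonzero charge in the first part. In the
  converse, \<open>lie_exp N (V \<omega> + Z \<omega>)\<close> is \<open>\<sigma> \<omega>\<close>
  and may be the identity, so the translation law is stated on its own and
  \<open>translation_periodic\<close> only when it is not.\<close>

theorem lemma4p4:
  fixes N :: "('g::{t2_space, second_countable_topology}, 'a::euclidean_space) lie_structure"
    and F :: "'a \<Rightarrow> 'a" and q :: real
    and \<sigma> :: "real \<Rightarrow> 'g" and V Z :: "real \<Rightarrow> 'a"
  assumes "lie_group N"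
    and "simply_connected (UNIV :: 'g set)"
    and "two_step_nilpotent N"
    and "dim (lie_center N) \<le> dim (lie_commutator N) + 1"
    and "lorentz_force N F"
    and "magnetic_trajectory N F q \<sigma>"
    and "\<sigma> 0 = \<one>\<^bsub>N\<^esub>"
    and "\<And>t. \<sigma> t = lie_exp N (V t + Z t)"
    and "\<And>t. V t \<in> orthogonal_comp (lie_center N)"
    and "\<And>t. Z t \<in> lie_center N"
  shows "(\<forall>W1 Z1 \<omega>. q \<noteq> 0 \<longrightarrow> W1 \<in> orthogonal_comp (lie_center N) \<longrightarrow> Z1 \<in> lie_center N \<longrightarrow>
             translation_periodic N (lie_exp N (W1 + Z1)) \<sigma> \<omega> \<longrightarrow>
             F_center N F W1 = 0 \<and>
             periodic_of_period (\<lambda>t. vector_derivative V (at t)) \<omega>) \<and>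
         (\<forall>\<omega>. periodic_of_period (\<lambda>t. vector_derivative V (at t)) \<omega> \<longrightarrow>
             F_center N F (V \<omega>) = 0 \<longrightarrow>
             (\<forall>t. lie_exp N (V \<omega> + Z \<omega>) \<otimes>\<^bsub>N\<^esub> \<sigma> t = \<sigma> (t + \<omega>)) \<and>
             (lie_exp N (V \<omega> + Z \<omega>) \<noteq> \<one>\<^bsub>N\<^esub> \<longrightarrow>
                translation_periodic N (lie_exp N (V \<omega> + Z \<omega>)) \<sigma> \<omega>))"
proof -
  interpret nilpotent_lie_grp N
    using assms(1,3) by unfold_locales
  obtain f g \<rho> where "exp_chart N f g \<rho>"
    using exp_chart_exists[OF assms(2)] by blast
  then interpret exp_chart N f g \<rho> .
  interpret magnetic_curve N f g \<rho> F q \<sigma> V Z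
    using assms(4-10) by unfold_locales
  show ?thesis
  proof (intro conjI allI impI)
    fix \<omega> assume per: "periodic_of_period (\<lambda>t. vector_derivative V (at t)) \<omega>" "F_center N F (V \<omega>) = 0"
    show shift: "lie_exp N (V \<omega> + Z \<omega>) \<otimes>\<^bsub>N\<^esub> \<sigma> t = \<sigma> (t + \<omega>)" for t
      using periodic_if[OF per] .
    show "translation_periodic N (lie_exp N (V \<omega> + Z \<omega>)) \<sigma> \<omega>" if "lie_exp N (V \<omega> + Z \<omega>) \<noteq> \<one>\<^bsub>N\<^esub>"
      using that shift per(1) by (simp add: translation_periodic_def periodic_of_period_def)
  qed (use periodic_imp in blast)+
qed

end
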